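(* Let $(L,\Xi,\psi:L\to\Lambda,G)$ be as in the context, with HHL complex $(C_\bullet,d)$, and let $\Phi=\sum_{j\ge0}\delta(h\delta)^j:C_\bullet\to C_{\bullet-1}$ be the morphism defined in the context. Then $\Phi$ is the direct sum over all pairs of strata $(\sigma,\tau)$ of the morphisms $$\Phi_{\sigma,\tau}:=\sum_{\lambda\in\mathcal{P}(\sigma,\tau)}(-1)^{l(\lambda)}w_\lambda:\ \mathcal{O}(\sigma)\to\mathcal{O}(\tau),$$ i.e. the component $\mathcal{O}(\sigma)\to\mathcal{O}(\tau)$ of $\Phi$ is $\Phi_{\sigma,\tau}$, where $\mathcal{P}(\sigma,\tau)$ is the set of paths from $\sigma$ to $\tau$, $l(\lambda)$ is the length of $\lambda$, and $w_\lambda$ is its weight.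
   Context: **Stacks.** $L\cong\mathbb{Z}^n$ is a lattice with basis $v_1,\dots,v_n$, $\Xi$ a subfan of the first orthant fan in $L_{\mathbb{R}}$, $\psi:L\to\Lambda$ a lattice morphism with finite cokernel to a lattice $\Lambda$ of rank $k$, and $G$ an algebraic group over $\mathbb{C}$ mapping to $\ker(L\otimes\mathbb{C}^*\to\Lambda\otimes\mathbb{C}^* )$. $U_\Xi\subset\mathbb{C}^n$ is the open set of points whose set of zero coordinates lies in (spans) a cone of $\Xi$; $\mathcal{X}=[U_\Xi/G]$; $D_j$ is the divisor $x_j=0$. For $a\in\mathbb{Z}^n$, $\mathcal{O}(a)=\mathcal{O}_{\mathcal{X}}(\sum a_jD_j)$, and $[a]$ is its isomorphism class. **Bondal stratification.** Let $\Lambda^*_{\mathbb{R}}=\operatorname{Hom}(\Lambda,\mathbb{R})$, $T=\Lambda^*_{\mathbb{R}}/\Lambda^*$, $H_j(f)=f(\psi(v_j))$. The periodic hyperplane arrangement $\{H_j=m\}$, $m\in\mathbb{Z}$, stratifies $\Lambda^*_{\mathbb{R}}$ into relatively open cells and descends to a finite stratification $S$ of $T$. $\lceil H_j(\widetilde\sigma)\rceil$ is the common value of $\lceil H_j(x)\rceil$ on the relative interior of $\widetilde\sigma$. For $\sigma\in S$ with lift $\widetilde\sigma$, $\mathcal{O}(\sigma)=\mathcal{O}_{\mathcal{X}}(-\sum_j\lceil H_j(\widetilde\sigma)\rceil D_j)$ (different lifts are canonically identified: on $U_\Xi$ they are the trivial bundle with the same character of $G$). $BT$ is the finite set of isomorphism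 classes of the $\mathcal{O}(\sigma)$; $S_{[a]}\subset S$ is the set of strata with $\mathcal{O}(\sigma)$ of class $[a]$. **HHL complex.** Fix orientations of all strata (and induced orientations of lifts). For $\dim\sigma=\dim\tau+1$ and a fixed lift $\widetilde\sigma$, $d_{\sigma,\tau}=\sum_{\widetilde\tau}\mathrm{sgn}(\widetilde\sigma,\widetilde\tau)\prod_jx_j^{\lceil H_j(\widetilde\sigma)\rceil-\lceil H_j(\widetilde\tau)\rceil}:\mathcal{O}(\sigma)\to\mathcal{O}(\tau)$, summed over facets $\widetilde\tau$ of $\widetilde\sigma$ over $\tau$ ($\mathrm{sgn}=1$ if orientations are compatible, $-1$ otherwise). $C_q=\bigoplus_{\dim\sigma=q}\mathcal{O}(\sigma)$, $d=\bigoplus d_{\sigma,\tau}$. **Partial order.** On $BT$: $\mathcal{O}(\tau)\le\mathcal{O}(\sigma)$ iff $\operatorname{Hom}(\mathcal{O}(\sigma),\mathcal{O}(\tau))\neq0$. Standing conventions: this is a partial order, and whenever $\mathcal{O}(\sigma)\cong\mathcal{O}(\tau)$ all monomials occurring in $d_{\sigma,\tau}$ are constant. **Definition of $\Phi$.** For $[a]\in BT$, $C^{\mathrm{BM}}_\bullet(S_{[a]})$ has $C^{\mathrm{BM}}_q=\bigoplus_{\sigma\in S_{[a]},\dim\sigma=q}\mathbb{C}\sigma$ with differential $\partial_{[a],q}:C_q^{\mathrm{BM}}\to C_{q-1}^{\mathrm{BM}}$ given by the signed incidence numbers $\sum_{\widetilde\tau}\mathrm{sgn}(\widetilde\sigma,\widetilde\tau)$.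 Cells are declared orthonormal, and $\partial^+_{[a]}$ is the Moore-Penrose inverse of $\partial_{[a]}$ in each degree. Identify $C_q=\bigoplus_{[a]}C_q^{\mathrm{BM}}(S_{[a]})\otimes\mathcal{O}(a)$ as graded sheaves. Put $h=\bigoplus_{[a]}(-\partial_{[a]}^+)\otimes\mathrm{id}_{\mathcal{O}(a)}$, $\operatorname{gr}d=\bigoplus_{[a]}\partial_{[a]}\otimes\mathrm{id}_{\mathcal{O}(a)}$, $\delta=d-\operatorname{gr}d$, $\Phi=\sum_{j\ge0}\delta(h\delta)^j$ (a finite sum). **Paths and weights.** Let $(\sigma,\tau)$ be strata with $\dim\sigma=\dim\tau+1$ and $\mathcal{O}(\sigma)\ge\mathcal{O}(\tau)$. The pair is of type I if $\mathcal{O}(\sigma)>\mathcal{O}(\tau)$, of type II if $\mathcal{O}(\sigma)=\mathcal{O}(\tau)$ in $BT$. A path $\lambda$ from $\sigma$ to $\tau$ is a sequence $\sigma=\sigma_0,\tau_0,\sigma_1,\tau_1,\dots,\sigma_m,\tau_m=\tau$ ($m\ge0$) of strata such that each $(\sigma_j,\tau_j)$ is a type I pair and each $(\sigma_{j+1},\tau_j)$ is a type II pair; its length $l(\lambda)=m$ is the number of type II pairs. For a type I pair, $\mathrm{HHL}_{\sigma,\tau}=d_{\sigma,\tau}$. For a type II pair in $S_{[a]}$ with $\dim\sigma=q$, $\mathrm{MP}_{\sigma,\tau}$ is the coefficient of $\sigma$ in $\partial_{[a]}^+(\tau)$, explicitly $$\mathrm{MP}_{\sigma,\tau}=\frac1\Delta\sum_{(A,B):\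 \tau\in A,\ \sigma\in B}(-1)^{\mathrm{pos}_B(\sigma)+\mathrm{pos}_A(\tau)}\det(\partial_{[a],q,A\times B})\det(\partial_{[a],q,A\setminus\{\tau\}\times B\setminus\{\sigma\}}),$$ where $(A,B)$ runs over hedges of $\partial_{[a],q}$, i.e. sets $A$ of $(q-1)$-cells and $B$ of $q$-cells of $S_{[a]}$ with $|A|=|B|=\operatorname{rk}\partial_{[a],q}$ such that $\mathbb{C}\{B\}\to\operatorname{im}\partial_{[a],q}$ (restriction of $\partial_{[a],q}$) and $\operatorname{im}\partial_{[a],q}\to\mathbb{C}\{A\}$ (coordinate projection) are isomorphisms; $\partial_{A\times B}$ is the submatrix with rows $A$ and columns $B$; $\mathrm{pos}$ denotes position in the chosen ordering; $\Delta=\sum_{(A,B)}\det(\partial_{[a],q,A\times B})^2$ over all hedges. The weight $w_\lambda$ is the product $\prod_{j=0}^m\mathrm{HHL}_{\sigma_j,\tau_j}\prod_{j=0}^{m-1}\mathrm{MP}_{\sigma_{j+1},\tau_j}$. *)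

theory Defs
  imports
    "HOL-Library.Function_Algebras"
    "HOL-Library.Groups_Big_Fun"
    "HOL-Analysis.Function_Topology"
    "HOL-Algebra.Group"
    "Jordan_Normal_Form.Determinant"
begin

text \<open>Functions into a ring are added and multiplied pointwise (\<^theory>\<open>HOL-Library.Function_Algebras\<close>).\<close>

definition fscale :: "'a::field \<Rightarrow> ('x \<Rightarrow> 'a) \<Rightarrow> 'x \<Rightarrow> 'a" where
  "fscale r f = (\<lambda>x. r * f x)"

interpretation fun_vs: vector_space "fscale :: 'a::field \<Rightarrow> ('x \<Rightarrow> 'a) \<Rightarrow> 'x \<Rightarrow> 'a"
  by unfold_locales (auto simp: fscale_def fun_eq_iff algebra_simps)


section \<open>Lattices\<close>

text \<open>\<open>v 0, \<dots>, v (n - 1)\<close> is a basis of a free abelian group if the unit vectors of \<open>\<int>\<^sup>n\<close>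
  are sent to it by an isomorphism.  Elements of \<open>\<int>\<^sup>n\<close> and points of affine space are functions
  on \<^typ>\<open>nat\<close> vanishing from \<open>n\<close> on; this includes the rank 0 case.\<close>

definition Zvec :: "nat \<Rightarrow> (nat \<Rightarrow> int) set" where
  "Zvec n = {a. \<forall>j\<ge>n. a j = 0}"

definition lattice_basis :: "nat \<Rightarrow> (nat \<Rightarrow> 'l::ab_group_add) \<Rightarrow> bool" where
  "lattice_basis n v \<longleftrightarrow>
     (\<exists>e. bij_betw e (Zvec n) UNIV \<and>
          (\<forall>a\<in>Zvec n. \<forall>b\<in>Zvec n. e (a + b) = e a + e b) \<and>
          (\<forall>j<n. e (\<lambda>i. if i = j then 1 else 0) = v j))"

definition dualR :: "('m::ab_group_add \<Rightarrow> real) set" where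
  "dualR = {f. additive f}"


section \<open>Classical varieties and algebraic groups over the complex numbers\<close>

definition affsp :: "nat \<Rightarrow> (nat \<Rightarrow> complex) set" where
  "affsp m = {x. \<forall>j\<ge>m. x j = 0}"

inductive_set poly_fun :: "nat \<Rightarrow> ((nat \<Rightarrow> complex) \<Rightarrow> complex) set" for m where
  const: "(\<lambda>_. c) \<in> poly_fun m"
| coord: "j < m \<Longrightarrow> (\<lambda>x. x j) \<in> poly_fun m"
| add: "p \<in> poly_fun m \<Longrightarrow> q \<in> poly_fun m \<Longrightarrow> (\<lambda>x. p x + q x) \<in> poly_fun m"
| mult: "p \<in> poly_fun m \<Longrightarrow> q \<in> poly_fun m \<Longrightarrow> (\<lambda>x. p x * q x) \<in> poly_fun m"

definition regular_on :: "nat \<Rightarrow> (nat \<Rightarrow> complex) set \<Rightarrow> ((nat \<Rightarrow> complex) \<Rightarrow> complex) \<Rightarrow> bool" where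
  "regular_on m X f \<longleftrightarrow>
     (\<forall>p\<in>X. \<exists>g\<in>poly_fun m. \<exists>h\<in>poly_fun m. h p \<noteq> 0 \<and> (\<forall>x\<in>X. h x \<noteq> 0 \<longrightarrow> f x = g x / h x))"

definition zariski_closed :: "nat \<Rightarrow> (nat \<Rightarrow> complex) set \<Rightarrow> bool" where
  "zariski_closed m Z \<longleftrightarrow> (\<exists>P\<subseteq>poly_fun m. Z = {x \<in> affsp m. \<forall>p\<in>P. p x = 0})"

text \<open>A chart \<open>(U, m, \<kappa>)\<close> embeds \<open>U\<close> as a Zariski closed subset of affine \<open>m\<close>-space.\<close>

type_synonym 'x chart = "'x set \<times> nat \<times> ('x \<Rightarrow> nat \<Rightarrow> complex)"

text \<open>Morphism condition in charts: near every point \<open>p\<close>, on a principal open neighbourhood that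
  is mapped into the target chart, the coordinates of \<open>F\<close> are fractions of polynomials with common
  denominator \<open>h\<close>.\<close>

definition morphism :: "'x chart set \<Rightarrow> 'y chart set \<Rightarrow> ('x \<Rightarrow> 'y) \<Rightarrow> bool" where
  "morphism A B F \<longleftrightarrow>
     (\<forall>(U, m, \<kappa>)\<in>A. \<forall>(V, l, \<mu>)\<in>B. \<forall>p\<in>U. F p \<in> V \<longrightarrow>
        (\<exists>h\<in>poly_fun m. \<exists>g. (\<forall>r<l. g r \<in> poly_fun m) \<and> h (\<kappa> p) \<noteq> 0 \<and>
           (\<forall>x\<in>U. h (\<kappa> x) \<noteq> 0 \<longrightarrow>
              F x \<in> V \<and> (\<forall>r<l. \<mu> (F x) r = g r (\<kappa> x) / h (\<kappa> x)))))"

text \<open>Compatibility of charts is the condition that the identity is a morphism.  Separatedness is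
  not required: it is automatic for group varieties.\<close>

definition variety :: "'x set \<Rightarrow> 'x chart set \<Rightarrow> bool" where
  "variety X A \<longleftrightarrow>
     finite A \<and> (\<Union>(U, m, \<kappa>)\<in>A. U) = X \<and>
     (\<forall>(U, m, \<kappa>)\<in>A. inj_on \<kappa> U \<and> zariski_closed m (\<kappa> ` U)) \<and>
     morphism A A (\<lambda>x. x)"

definition prod_chart :: "'x chart \<Rightarrow> 'y chart \<Rightarrow> ('x \<times> 'y) chart" where
  "prod_chart = (\<lambda>(U, m, \<kappa>) (V, l, \<mu>).
     (U \<times> V, m + l, \<lambda>(x, y) i. if i < m then \<kappa> x i else \<mu> y (i - m)))"

definition prod_atlas :: "'x chart set \<Rightarrow> 'y chart set \<Rightarrow> ('x \<times> 'y) chart set" where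
  "prod_atlas A B = {prod_chart s t | s t. s \<in> A \<and> t \<in> B}"

text \<open>Over the complex numbers group schemes of finite type are reduced, hence group varieties.\<close>

definition algebraic_group :: "'g monoid \<Rightarrow> 'g chart set \<Rightarrow> bool" where
  "algebraic_group G A \<longleftrightarrow>
     group G \<and> variety (carrier G) A \<and>
     morphism (prod_atlas A A) A (\<lambda>(x, y). x \<otimes>\<^bsub>G\<^esub> y) \<and>
     morphism A A (\<lambda>x. inv\<^bsub>G\<^esub> x)"


section \<open>Matrices indexed by sets, Moore-Penrose inverses and hedges\<close>

text \<open>\<open>M s t\<close> is the component from \<open>s\<close> to \<open>t\<close>;  \<open>mcomp Z N M\<close> is \<open>N\<close> after \<open>M\<close>, through the
  summands indexed by \<open>Z\<close>.\<close>

definition mcomp :: "'s set \<Rightarrow> ('s \<Rightarrow> 's \<Rightarrow> 'r::comm_ring_1) \<Rightarrow> ('s \<Rightarrow> 's \<Rightarrow> 'r) \<Rightarrow> 's \<Rightarrow> 's \<Rightarrow> 'r" where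
  "mcomp Z N M = (\<lambda>s t. \<Sum>z\<in>Z. M s z * N z t)"

text \<open>The Penrose conditions for \<open>P\<close> to be the Moore-Penrose inverse of \<open>M : \<complex>X \<rightarrow> \<complex>Y\<close>, with
  orthonormal bases \<open>X\<close> and \<open>Y\<close>.\<close>

definition is_moore_penrose ::
  "'s set \<Rightarrow> 's set \<Rightarrow> ('s \<Rightarrow> 's \<Rightarrow> complex) \<Rightarrow> ('s \<Rightarrow> 's \<Rightarrow> complex) \<Rightarrow> bool" where
  "is_moore_penrose X Y M P \<longleftrightarrow>
     (\<forall>t s. P t s \<noteq> 0 \<longrightarrow> t \<in> Y \<and> s \<in> X) \<and>
     (\<forall>s\<in>X. \<forall>t\<in>Y. mcomp X M (mcomp Y P M) s t = M s t) \<and>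
     (\<forall>t\<in>Y. \<forall>s\<in>X. mcomp Y P (mcomp X M P) t s = P t s) \<and>
     (\<forall>t\<in>Y. \<forall>t'\<in>Y. mcomp X M P t t' = cnj (mcomp X M P t' t)) \<and>
     (\<forall>s\<in>X. \<forall>s'\<in>X. mcomp Y P M s s' = cnj (mcomp Y P M s' s))"

definition moore_penrose ::
  "'s set \<Rightarrow> 's set \<Rightarrow> ('s \<Rightarrow> 's \<Rightarrow> complex) \<Rightarrow> 's \<Rightarrow> 's \<Rightarrow> complex" where
  "moore_penrose X Y M = (THE P. is_moore_penrose X Y M P)"

text \<open>The coordinate subspace \<open>\<complex>{B}\<close>, and the linear map \<open>\<complex>X \<rightarrow> \<complex>Y\<close> with matrix \<open>M\<close>.\<close>

definition coord_space :: "'s set \<Rightarrow> ('s \<Rightarrow> complex) set" where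
  "coord_space B = {v. \<forall>s. s \<notin> B \<longrightarrow> v s = 0}"

definition linmap :: "'s set \<Rightarrow> 's set \<Rightarrow> ('s \<Rightarrow> 's \<Rightarrow> complex) \<Rightarrow> ('s \<Rightarrow> complex) \<Rightarrow> 's \<Rightarrow> complex" where
  "linmap X Y M v = (\<lambda>t. if t \<in> Y then \<Sum>s\<in>X. v s * M s t else 0)"

definition image_space :: "'s set \<Rightarrow> 's set \<Rightarrow> ('s \<Rightarrow> 's \<Rightarrow> complex) \<Rightarrow> ('s \<Rightarrow> complex) set" where
  "image_space X Y M = linmap X Y M ` coord_space X"

definition hedges :: "'s set \<Rightarrow> 's set \<Rightarrow> ('s \<Rightarrow> 's \<Rightarrow> complex) \<Rightarrow> ('s set \<times> 's set) set" where
  "hedges X Y M =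
     {(A, B). A \<subseteq> Y \<and> B \<subseteq> X \<and>
        card A = fun_vs.dim (image_space X Y M) \<and> card B = fun_vs.dim (image_space X Y M) \<and>
        bij_betw (linmap X Y M) (coord_space B) (image_space X Y M) \<and>
        bij_betw (\<lambda>w s. if s \<in> A then w s else 0) (image_space X Y M) (coord_space A)}"

text \<open>Subsets are ordered by their positions in the list \<open>cs\<close>.  Positions start at 0, which does
  not affect the parity of a sum of two positions.\<close>

definition in_order :: "'s list \<Rightarrow> 's set \<Rightarrow> 's list" where
  "in_order cs A = filter (\<lambda>s. s \<in> A) cs"

definition pos :: "'s list \<Rightarrow> 's set \<Rightarrow> 's \<Rightarrow> nat" where
  "pos cs A s = (THE i. i < length (in_order cs A) \<and> in_order cs A ! i = s)"

definition minor :: "'s list \<Rightarrow> ('s \<Rightarrow> 's \<Rightarrow> complex) \<Rightarrow> 's set \<Rightarrow> 's set \<Rightarrow> complex" where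
  "minor cs M A B =
     det (mat (card A) (card B) (\<lambda>(i, j). M (in_order cs B ! j) (in_order cs A ! i)))"

definition hedge_formula ::
  "'s list \<Rightarrow> 's set \<Rightarrow> 's set \<Rightarrow> ('s \<Rightarrow> 's \<Rightarrow> complex) \<Rightarrow> 's \<Rightarrow> 's \<Rightarrow> complex" where
  "hedge_formula cs X Y M s t =
     1 / (\<Sum>(A, B)\<in>hedges X Y M. (minor cs M A B)\<^sup>2) *
     (\<Sum>(A, B)\<in>{(A, B)\<in>hedges X Y M. t \<in> A \<and> s \<in> B}.
        (- 1) ^ (pos cs B s + pos cs A t) * minor cs M A B * minor cs M (A - {t}) (B - {s}))"


section \<open>The toric data and the choices made for the HHL complex\<close>

type_synonym 'm cell = "('m \<Rightarrow> real) set"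

text \<open>A stratum is a set of points of \<open>T = \<Lambda>\<^sup>*\<^sub>\<real> / \<Lambda>\<^sup>*\<close>, and a point of \<open>T\<close> is a coset of \<open>\<Lambda>\<^sup>*\<close>.\<close>

type_synonym 'm stratum = "('m \<Rightarrow> real) set set"

type_synonym sect = "(nat \<Rightarrow> complex) \<Rightarrow> complex"

text \<open>\<open>Xi\<close> records a cone spanned by the \<open>v\<^sub>j\<close>, \<open>j \<in> I\<close>, as \<open>I\<close>.  \<open>orient D \<sigma>\<close> is the set of
  positively oriented ordered bases of the tangent space of \<open>\<sigma>\<close>; \<open>ordering D\<close> lists the strata in
  the chosen ordering.\<close>

record ('l, 'm, 'g) hhl_data =
  rankL :: nat
  basisL :: "nat \<Rightarrow> 'l"
  psi :: "'l \<Rightarrow> 'm"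
  Xi :: "nat set set"
  grp :: "'g monoid"
  atlas :: "'g chart set"
  phi :: "'g \<Rightarrow> nat \<Rightarrow> complex"
  lift :: "'m stratum \<Rightarrow> 'm cell"
  orient :: "'m stratum \<Rightarrow> ('m \<Rightarrow> real) list set"
  ordering :: "'m stratum list"

text \<open>The kernel of \<open>L \<otimes> \<complex>\<^sup>* \<rightarrow> \<Lambda> \<otimes> \<complex>\<^sup>*\<close>: the basis identifies \<open>L \<otimes> \<complex>\<^sup>*\<close> with \<open>(\<complex>\<^sup>*)\<^sup>n\<close>, and
  \<open>\<Lambda> \<otimes> \<complex>\<^sup>*\<close> is \<open>Hom(\<Lambda>\<^sup>*, \<complex>\<^sup>*)\<close>.\<close>

definition torus_kernel :: "('l, 'm::ab_group_add, 'g) hhl_data \<Rightarrow> (nat \<Rightarrow> complex) set" where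
  "torus_kernel D =
     {t \<in> affsp (rankL D). (\<forall>j<rankL D. t j \<noteq> 0) \<and>
        (\<forall>f :: 'm \<Rightarrow> int. additive f \<longrightarrow> (\<Prod>j<rankL D. t j powi f (psi D (basisL D j))) = 1)}"

definition toric_setting :: "('l::ab_group_add, 'm::ab_group_add, 'g) hhl_data \<Rightarrow> bool" where
  "toric_setting D \<longleftrightarrow>
     lattice_basis (rankL D) (basisL D) \<and>
     (\<exists>k. \<exists>b :: nat \<Rightarrow> 'm. lattice_basis k b) \<and>
     additive (psi D) \<and> finite (UNIV // {(x, y). x - y \<in> range (psi D)}) \<and>
     Xi D \<subseteq> Pow {..<rankL D} \<and> {} \<in> Xi D \<and> (\<forall>I\<in>Xi D. \<forall>J\<subseteq>I. J \<in> Xi D) \<and>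
     algebraic_group (grp D) (atlas D) \<and>
     phi D ` carrier (grp D) \<subseteq> torus_kernel D \<and>
     (\<forall>g\<in>carrier (grp D). \<forall>g'\<in>carrier (grp D). phi D (g \<otimes>\<^bsub>grp D\<^esub> g') = phi D g * phi D g') \<and>
     morphism (atlas D) {(affsp (rankL D), rankL D, \<lambda>x. x)} (phi D)"


section \<open>Line bundles on the quotient stack\<close>

definition U_Xi :: "('l, 'm, 'g) hhl_data \<Rightarrow> (nat \<Rightarrow> complex) set" where
  "U_Xi D = {x \<in> affsp (rankL D). {j. j < rankL D \<and> x j = 0} \<in> Xi D}"

text \<open>\<open>\<O>(a)\<close> is the trivial line bundle on \<open>U\<^sub>\<Xi>\<close> linearized by the character \<open>a\<close> of \<open>(\<complex>\<^sup>*)\<^sup>n\<close>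
  restricted along \<^const>\<open>phi\<close>, normalized so that \<open>x\<^sub>j\<close> is an invariant section of \<open>\<O>(D\<^sub>j)\<close>.
  Morphisms are thus semi-invariant regular functions and compose by multiplication.  They are
  extended by 0 outside \<open>U\<^sub>\<Xi>\<close> in order to be determined by their values on \<open>U\<^sub>\<Xi>\<close>.\<close>

definition hom_O :: "('l, 'm, 'g) hhl_data \<Rightarrow> (nat \<Rightarrow> int) \<Rightarrow> (nat \<Rightarrow> int) \<Rightarrow> sect set" where
  "hom_O D a b =
     {f. regular_on (rankL D) (U_Xi D) f \<and> (\<forall>x. x \<notin> U_Xi D \<longrightarrow> f x = 0) \<and>
         (\<forall>g\<in>carrier (grp D). \<forall>x\<in>U_Xi D.
            f (phi D g * x) = (\<Prod>j<rankL D. phi D g j powi (b j - a j)) * f x)}"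

definition cst :: "('l, 'm, 'g) hhl_data \<Rightarrow> complex \<Rightarrow> sect" where
  "cst D c = (\<lambda>x. if x \<in> U_Xi D then c else 0)"

definition iso_O :: "('l, 'm, 'g) hhl_data \<Rightarrow> (nat \<Rightarrow> int) \<Rightarrow> (nat \<Rightarrow> int) \<Rightarrow> bool" where
  "iso_O D a b \<longleftrightarrow> (\<exists>f\<in>hom_O D a b. \<exists>f'\<in>hom_O D b a. f * f' = cst D 1)"

definition iso_class :: "('l, 'm, 'g) hhl_data \<Rightarrow> (nat \<Rightarrow> int) \<Rightarrow> (nat \<Rightarrow> int) set" where
  "iso_class D a = {b \<in> Zvec (rankL D). iso_O D a b}"


section \<open>The Bondal stratification\<close>

definition H :: "('l, 'm, 'g) hhl_data \<Rightarrow> nat \<Rightarrow> ('m \<Rightarrow> real) \<Rightarrow> real" where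
  "H D j f = f (psi D (basisL D j))"

definition cell_of :: "('l, 'm::ab_group_add, 'g) hhl_data \<Rightarrow> ('m \<Rightarrow> real) \<Rightarrow> 'm cell" where
  "cell_of D f =
     {g \<in> dualR. \<forall>j<rankL D. \<forall>m::int. sgn (H D j g - of_int m) = sgn (H D j f - of_int m)}"

definition cells :: "('l, 'm::ab_group_add, 'g) hhl_data \<Rightarrow> 'm cell set" where
  "cells D = cell_of D ` dualR"

definition lat_rel :: "(('m::ab_group_add \<Rightarrow> real) \<times> ('m \<Rightarrow> real)) set" where
  "lat_rel = {(f, g). f \<in> dualR \<and> g \<in> dualR \<and> range (g - f) \<subseteq> \<int>}"

text \<open>\<open>c // lat_rel\<close> is the image of the cell \<open>c\<close> in \<open>T = dualR // lat_rel\<close>.\<close>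

definition strata :: "('l, 'm::ab_group_add, 'g) hhl_data \<Rightarrow> 'm stratum set" where
  "strata D = {c // lat_rel | c. c \<in> cells D}"

definition lifts :: "('l, 'm::ab_group_add, 'g) hhl_data \<Rightarrow> 'm stratum \<Rightarrow> 'm cell set" where
  "lifts D \<sigma> = {c \<in> cells D. c // lat_rel = \<sigma>}"

definition direction :: "'m cell \<Rightarrow> ('m \<Rightarrow> real) set" where
  "direction c = fun_vs.span {g - f | f g. f \<in> c \<and> g \<in> c}"

definition sdim :: "('l, 'm, 'g) hhl_data \<Rightarrow> 'm stratum \<Rightarrow> nat" where
  "sdim D \<sigma> = fun_vs.dim (direction (lift D \<sigma>))"

definition ceil_H :: "('l, 'm, 'g) hhl_data \<Rightarrow> nat \<Rightarrow> 'm cell \<Rightarrow> int" where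
  "ceil_H D j c = (THE m. \<forall>f\<in>c. \<lceil>H D j f\<rceil> = m)"

definition O_exp :: "('l, 'm, 'g) hhl_data \<Rightarrow> 'm stratum \<Rightarrow> nat \<Rightarrow> int" where
  "O_exp D \<sigma> = (\<lambda>j. if j < rankL D then - ceil_H D j (lift D \<sigma>) else 0)"

definition O_class :: "('l, 'm, 'g) hhl_data \<Rightarrow> 'm stratum \<Rightarrow> (nat \<Rightarrow> int) set" where
  "O_class D \<sigma> = iso_class D (O_exp D \<sigma>)"

definition BT :: "('l, 'm::ab_group_add, 'g) hhl_data \<Rightarrow> (nat \<Rightarrow> int) set set" where
  "BT D = O_class D ` strata D"

definition BT_le :: "('l, 'm::ab_group_add, 'g) hhl_data \<Rightarrow> ((nat \<Rightarrow> int) set \<times> (nat \<Rightarrow> int) set) set" where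
  "BT_le D = {(O_class D \<tau>, O_class D \<sigma>) | \<sigma> \<tau>.
     \<sigma> \<in> strata D \<and> \<tau> \<in> strata D \<and> hom_O D (O_exp D \<sigma>) (O_exp D \<tau>) \<noteq> {0}}"


section \<open>Orientations and the HHL differential\<close>

definition ordered_basis :: "('m \<Rightarrow> real) set \<Rightarrow> ('m \<Rightarrow> real) list \<Rightarrow> bool" where
  "ordered_basis V ws \<longleftrightarrow>
     distinct ws \<and> \<not> fun_vs.dependent (set ws) \<and> fun_vs.span (set ws) = V"

text \<open>In dimension 0 this leaves the choice whether the empty basis is positive.\<close>

definition is_orientation :: "('m \<Rightarrow> real) set \<Rightarrow> ('m \<Rightarrow> real) list set \<Rightarrow> bool" where
  "is_orientation V P \<longleftrightarrow>
     (\<forall>ws ws' M. ordered_basis V ws \<and> ordered_basis V ws' \<and>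
        M \<in> carrier_mat (length ws) (length ws) \<and>
        (\<forall>i<length ws. ws' ! i = (\<Sum>j<length ws. fscale (M $$ (i, j)) (ws ! j))) \<longrightarrow>
        ((ws' \<in> P \<longleftrightarrow> ws \<in> P) \<longleftrightarrow> 0 < det M))"

definition HHL_choices :: "('l, 'm::ab_group_add, 'g) hhl_data \<Rightarrow> bool" where
  "HHL_choices D \<longleftrightarrow>
     (\<forall>\<sigma>\<in>strata D. lift D \<sigma> \<in> lifts D \<sigma>) \<and>
     (\<forall>\<sigma>\<in>strata D. is_orientation (direction (lift D \<sigma>)) (orient D \<sigma>)) \<and>
     distinct (ordering D) \<and> set (ordering D) = strata D"

text \<open>The facets over \<open>\<tau>\<close> of the chosen lift of \<open>\<sigma>\<close>.\<close>

definition facets_over :: "('l, 'm::ab_group_add, 'g) hhl_data \<Rightarrow> 'm stratum \<Rightarrow> 'm stratum \<Rightarrow> 'm cell set" where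
  "facets_over D \<sigma> \<tau> =
     {c \<in> lifts D \<tau>. c \<subseteq> closure (lift D \<sigma>) \<and>
        fun_vs.dim (direction (lift D \<sigma>)) = fun_vs.dim (direction c) + 1}"

text \<open>Boundary orientation, outward normal first: \<open>g - f\<close> points from \<open>\<sigma>\<close> out through the facet.\<close>

definition incidence_sgn :: "('l, 'm, 'g) hhl_data \<Rightarrow> 'm stratum \<Rightarrow> 'm stratum \<Rightarrow> 'm cell \<Rightarrow> int" where
  "incidence_sgn D \<sigma> \<tau> c =
     (if \<exists>f\<in>lift D \<sigma>. \<exists>g\<in>c. \<exists>ws. ordered_basis (direction c) ws \<and>
           ((g - f) # ws \<in> orient D \<sigma> \<longleftrightarrow> ws \<in> orient D \<tau>)
      then 1 else - 1)"

definition HHL :: "('l, 'm::ab_group_add, 'g) hhl_data \<Rightarrow> 'm stratum \<Rightarrow> 'm stratum \<Rightarrow> sect" where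
  "HHL D \<sigma> \<tau> = (\<lambda>x. if x \<in> U_Xi D then
     \<Sum>c\<in>facets_over D \<sigma> \<tau>. of_int (incidence_sgn D \<sigma> \<tau> c) *
        (\<Prod>j<rankL D. x j powi (ceil_H D j (lift D \<sigma>) - ceil_H D j c)) else 0)"

definition d_HHL :: "('l, 'm::ab_group_add, 'g) hhl_data \<Rightarrow> 'm stratum \<Rightarrow> 'm stratum \<Rightarrow> sect" where
  "d_HHL D \<sigma> \<tau> =
     (if \<sigma> \<in> strata D \<and> \<tau> \<in> strata D \<and> sdim D \<sigma> = sdim D \<tau> + 1 then HHL D \<sigma> \<tau> else 0)"

text \<open>The standing conventions on the partial order.\<close>

definition BT_conventions :: "('l, 'm::ab_group_add, 'g) hhl_data \<Rightarrow> bool" where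
  "BT_conventions D \<longleftrightarrow>
     partial_order_on (BT D) (BT_le D) \<and>
     (\<forall>\<sigma>\<in>strata D. \<forall>\<tau>\<in>strata D.
        sdim D \<sigma> = sdim D \<tau> + 1 \<and> iso_O D (O_exp D \<sigma>) (O_exp D \<tau>) \<longrightarrow>
        (\<forall>c\<in>facets_over D \<sigma> \<tau>. \<forall>j<rankL D. ceil_H D j (lift D \<sigma>) - ceil_H D j c = 0))"


section \<open>The morphism \<open>\<Phi>\<close>\<close>

definition class_cells :: "('l, 'm::ab_group_add, 'g) hhl_data \<Rightarrow> (nat \<Rightarrow> int) set \<Rightarrow> nat \<Rightarrow> 'm stratum set" where
  "class_cells D A q = {\<sigma> \<in> strata D. O_class D \<sigma> = A \<and> sdim D \<sigma> = q}"

text \<open>The entries of all \<open>\<partial>\<^sub>[\<^sub>a\<^sub>]\<close>.\<close>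

definition incidence :: "('l, 'm::ab_group_add, 'g) hhl_data \<Rightarrow> 'm stratum \<Rightarrow> 'm stratum \<Rightarrow> complex" where
  "incidence D \<sigma> \<tau> = (\<Sum>c\<in>facets_over D \<sigma> \<tau>. of_int (incidence_sgn D \<sigma> \<tau> c))"

text \<open>For \<open>A = [a]\<close>: the Moore-Penrose inverse of \<open>\<partial>\<^sub>[\<^sub>a\<^sub>] : C\<^sub>q\<^sub>+\<^sub>1 \<rightarrow> C\<^sub>q\<close>.  In degree 0 the target
  is 0 and there is nothing to invert.\<close>

definition bd_plus ::
  "('l, 'm::ab_group_add, 'g) hhl_data \<Rightarrow> (nat \<Rightarrow> int) set \<Rightarrow> nat \<Rightarrow> 'm stratum \<Rightarrow> 'm stratum \<Rightarrow> complex" where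
  "bd_plus D A q =
     moore_penrose (class_cells D A (q + 1)) (class_cells D A q) (incidence D)"

text \<open>All \<open>\<O>(\<sigma>)\<close>, \<open>\<sigma> \<in> S\<^sub>[\<^sub>a\<^sub>]\<close>, have the trivial bundle on \<open>U\<^sub>\<Xi>\<close> as underlying sheaf, and
  \<open>id\<close> of \<open>\<O>(a)\<close> is the constant function 1.  Under the standing conventions \<open>\<partial>\<^sub>[\<^sub>a\<^sub>]\<close>, and
  hence its Moore-Penrose inverse, only connects strata whose bundles have the same character of the
  group, so these constants are morphisms.\<close>

definition gr_diff :: "('l, 'm::ab_group_add, 'g) hhl_data \<Rightarrow> 'm stratum \<Rightarrow> 'm stratum \<Rightarrow> sect" where
  "gr_diff D \<sigma> \<tau> =
     (if \<sigma> \<in> strata D \<and> \<tau> \<in> strata D \<and> sdim D \<sigma> = sdim D \<tau> + 1 \<and> O_class D \<sigma> = O_class D \<tau>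
      then cst D (incidence D \<sigma> \<tau>) else 0)"

definition hmap :: "('l, 'm::ab_group_add, 'g) hhl_data \<Rightarrow> 'm stratum \<Rightarrow> 'm stratum \<Rightarrow> sect" where
  "hmap D \<tau> \<sigma> =
     (if \<sigma> \<in> strata D \<and> \<tau> \<in> strata D \<and> sdim D \<sigma> = sdim D \<tau> + 1 \<and> O_class D \<sigma> = O_class D \<tau>
      then cst D (- bd_plus D (O_class D \<tau>) (sdim D \<tau>) \<tau> \<sigma>) else 0)"

definition delta :: "('l, 'm::ab_group_add, 'g) hhl_data \<Rightarrow> 'm stratum \<Rightarrow> 'm stratum \<Rightarrow> sect" where
  "delta D = d_HHL D - gr_diff D"

text \<open>\<open>\<delta>(h\<delta>)\<^sup>j\<close>\<close>

definition Phi_term :: "('l, 'm::ab_group_add, 'g) hhl_data \<Rightarrow> nat \<Rightarrow> 'm stratum \<Rightarrow> 'm stratum \<Rightarrow> sect" where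
  "Phi_term D j =
     ((\<lambda>N. mcomp (strata D) N (mcomp (strata D) (hmap D) (delta D))) ^^ j) (delta D)"

definition Phi :: "('l, 'm::ab_group_add, 'g) hhl_data \<Rightarrow> 'm stratum \<Rightarrow> 'm stratum \<Rightarrow> sect" where
  "Phi D = Sum_any (Phi_term D)"


section \<open>Paths and weights\<close>

definition type_I :: "('l, 'm::ab_group_add, 'g) hhl_data \<Rightarrow> 'm stratum \<Rightarrow> 'm stratum \<Rightarrow> bool" where
  "type_I D \<sigma> \<tau> \<longleftrightarrow> \<sigma> \<in> strata D \<and> \<tau> \<in> strata D \<and> sdim D \<sigma> = sdim D \<tau> + 1 \<and>
     (O_class D \<tau>, O_class D \<sigma>) \<in> BT_le D \<and> O_class D \<sigma> \<noteq> O_class D \<tau>"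

definition type_II :: "('l, 'm::ab_group_add, 'g) hhl_data \<Rightarrow> 'm stratum \<Rightarrow> 'm stratum \<Rightarrow> bool" where
  "type_II D \<sigma> \<tau> \<longleftrightarrow> \<sigma> \<in> strata D \<and> \<tau> \<in> strata D \<and> sdim D \<sigma> = sdim D \<tau> + 1 \<and>
     O_class D \<sigma> = O_class D \<tau>"

text \<open>A path \<open>\<sigma>\<^sub>0, \<tau>\<^sub>0, \<dots>, \<sigma>\<^sub>m, \<tau>\<^sub>m\<close> is the list of the pairs \<open>(\<sigma>\<^sub>j, \<tau>\<^sub>j)\<close>.\<close>

definition paths ::
  "('l, 'm::ab_group_add, 'g) hhl_data \<Rightarrow> 'm stratum \<Rightarrow> 'm stratum \<Rightarrow> ('m stratum \<times> 'm stratum) list set" where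
  "paths D \<sigma> \<tau> =
     {p. p \<noteq> [] \<and> fst (hd p) = \<sigma> \<and> snd (last p) = \<tau> \<and>
         (\<forall>j<length p. type_I D (fst (p ! j)) (snd (p ! j))) \<and>
         (\<forall>j<length p - 1. type_II D (fst (p ! (j + 1))) (snd (p ! j)))}"

definition plength :: "('m stratum \<times> 'm stratum) list \<Rightarrow> nat" where
  "plength p = length p - 1"

definition MP :: "('l, 'm::ab_group_add, 'g) hhl_data \<Rightarrow> 'm stratum \<Rightarrow> 'm stratum \<Rightarrow> complex" where
  "MP D \<sigma> \<tau> =
     hedge_formula (ordering D) (class_cells D (O_class D \<tau>) (sdim D \<sigma>))
       (class_cells D (O_class D \<tau>) (sdim D \<tau>)) (incidence D) \<sigma> \<tau>"

definition weight :: "('l, 'm::ab_group_add, 'g) hhl_data \<Rightarrow> ('m stratum \<times> 'm stratum) list \<Rightarrow> sect" where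
  "weight D p =
     (\<Prod>j\<le>plength p. HHL D (fst (p ! j)) (snd (p ! j))) *
     (\<Prod>j<plength p. cst D (MP D (fst (p ! (j + 1))) (snd (p ! j))))"

definition Phi_path :: "('l, 'm::ab_group_add, 'g) hhl_data \<Rightarrow> 'm stratum \<Rightarrow> 'm stratum \<Rightarrow> sect" where
  "Phi_path D \<sigma> \<tau> = (\<Sum>p\<in>paths D \<sigma> \<tau>. (- 1) ^ plength p * weight D p)"

end

theory Submission
  imports Defs
begin

text \<open>The component \<open>\<O>(\<sigma>) \<rightarrow> \<O>(\<tau>)\<close> of
\<open>\<delta>(h\<delta>)\<^sup>j\<close> is, by the definition of a matrix product, a sum over
sequences \<open>\<sigma> = \<sigma>\<^sub>0, \<tau>\<^sub>0, \<dots>, \<sigma>\<^sub>j,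
\<tau>\<^sub>j = \<tau>\<close> of strata of products of entries of \<open>\<delta>\<close> and
\<open>h\<close>. The theorem follows once these entries are identified with the factors of the
weight of a path.

\<^item> An entry of \<open>\<delta>\<close> is \<open>HHL\<close> on a pair of type I and 0
  otherwise (\<open>delta_eq\<close>). Within a class of \<open>BT\<close> the monomials of
  \<open>d\<close> are constant by the standing conventions, so \<open>d\<close> and \<open>gr
  d\<close> agree there; and where \<open>\<O>(\<tau>) \<le> \<O>(\<sigma>)\<close> fails there are
  no nonzero morphisms, while the entries of \<open>d\<close> are morphisms
  (\<open>HHL_in_hom_O\<close>).
\<^item> An entry of \<open>h\<close> is minus the hedge sum on a pair of type II and 0 otherwise
  (\<open>hmap_eq\<close>). This is the formula of Berg for the Moore-Penrose inverse
  (\<open>moore_penrose_eq_hedge_formula\<close>).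

The sequences that remain are the paths with \<open>j\<close> type II pairs, each of which
contributes a sign. Along a path a type I pair strictly lowers the class in \<open>BT\<close> and a
type II pair keeps it, so the length of a path is less than the number of classes
(\<open>plength_less\<close>), and all sums are finite.

The hedge formula for a real matrix \<open>M\<close> of rank \<open>r\<close> rests on an averaging
argument. A nonsingular \<open>r \<times> r\<close> submatrix, inverted and extended by zero, is a
generalized inverse of \<open>M\<close>; the hedge sum is the average \<open>P\<close> of these with
weights the squared minors. The Penrose conditions are checked on sums over \<open>r\<close>-tuples
of rows and columns, where repetitions may be allowed because they give zero minors, and where no
orderings or signs occur. By Cramer's rule an entry of \<open>M P\<close> is a sum of products of
two minors that differ in one row, and exchanging these rows shows that \<open>M P\<close> is
symmetric; likewise for \<open>P M\<close>. The equation \<open>M P M = M\<close> holds since the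
columns through a nonzero \<open>r \<times> r\<close> minor span the image of \<open>M\<close>.
Finally \<open>P\<close> vanishes on the kernel of the transpose of \<open>M\<close>, by a case of
the Cauchy-Binet formula (\<open>sum_det_mult_det_eq_0\<close>), and this gives \<open>P M P =
P\<close>.

That each \<open>w\<^sub>\<lambda>\<close> is a morphism requires one more observation. Isomorphic
bundles \<open>\<O>(\<sigma>)\<close>, \<open>\<O>(\<tau>)\<close> may carry different characters of
the group, as \<open>U\<^sub>\<Xi>\<close> may have nonconstant units, and a constant is then not a
morphism between them. But \<open>\<partial>\<^sub>[\<^sub>a\<^sub>]\<close> only connects strata
with equal characters, and the Moore-Penrose inverse of a block diagonal matrix has the same blocks
(\<open>moore_penrose_block_diagonal\<close>).\<close>

section \<open>Minors indexed by tuples\<close>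

definition tuples :: "nat \<Rightarrow> 's set \<Rightarrow> (nat \<Rightarrow> 's) set" where
  "tuples r Y = PiE {..<r} (\<lambda>_. Y)"

text \<open>Row and column indices may repeat and come in any order, which makes every index sum
  below a sum over a full product set.\<close>

definition tmat :: "nat \<Rightarrow> ('x \<Rightarrow> 'y \<Rightarrow> 'a) \<Rightarrow> (nat \<Rightarrow> 'y) \<Rightarrow> (nat \<Rightarrow> 'x) \<Rightarrow> 'a mat" where
  "tmat r M f g = mat r r (\<lambda>(i, j). M (g j) (f i))"

lemma tmat_carrier [simp]: "tmat r M f g \<in> carrier_mat r r"
  by (simp add: tmat_def)

lemma tmat_index [simp]: "i < r \<Longrightarrow> j < r \<Longrightarrow> tmat r M f g $$ (i, j) = M (g j) (f i)"
  by (simp add: tmat_def)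

lemma tmat_cong:
  "(\<And>i. i < r \<Longrightarrow> f i = f' i) \<Longrightarrow> (\<And>i. i < r \<Longrightarrow> g i = g' i) \<Longrightarrow> tmat r M f g = tmat r M f' g'"
  by (auto simp: tmat_def intro!: eq_matI)

lemma finite_tuples [simp]: "finite Y \<Longrightarrow> finite (tuples r Y)"
  by (simp add: tuples_def finite_PiE)

lemma tuples_mem: "f \<in> tuples r Y \<Longrightarrow> i < r \<Longrightarrow> f i \<in> Y"
  by (auto simp: tuples_def)

lemma tuples_upd: "f \<in> tuples r Y \<Longrightarrow> i < r \<Longrightarrow> t \<in> Y \<Longrightarrow> f(i := t) \<in> tuples r Y"
  by (auto simp: tuples_def PiE_def extensional_def)

text \<open>The cofactors along a row do not involve that row, so the entries of the row may be
  exchanged for arbitrary coefficients.\<close>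

lemma cofactor_row_expansion:
  fixes A :: "'a::comm_ring_1 mat"
  assumes "A \<in> carrier_mat r r" "i < r"
  shows "(\<Sum>j<r. v j * cofactor A i j) = det (mat r r (\<lambda>(a, b). if a = i then v b else A $$ (a, b)))"
    (is "_ = det ?B")
proof -
  have "det ?B = (\<Sum>j<r. ?B $$ (i, j) * cofactor ?B i j)"
    using assms by (intro laplace_expansion_row) auto
  also have "\<dots> = (\<Sum>j<r. v j * cofactor A i j)"
  proof (rule sum.cong)
    fix j assume "j \<in> {..<r}"
    moreover have "mat_delete ?B i j = mat_delete A i j"
      using assms by (auto simp: mat_delete_def intro!: eq_matI)
    ultimately show "?B $$ (i, j) * cofactor ?B i j = v j * cofactor A i j"
      using assms by (simp add: cofactor_def)
  qed simp
  finally show ?thesis by simp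
qed

lemma cofactor_column_expansion:
  fixes A :: "'a::comm_ring_1 mat"
  assumes "A \<in> carrier_mat r r" "j < r"
  shows "(\<Sum>i<r. v i * cofactor A i j) = det (mat r r (\<lambda>(a, b). if b = j then v a else A $$ (a, b)))"
    (is "_ = det ?B")
proof -
  have "det ?B = (\<Sum>i<r. ?B $$ (i, j) * cofactor ?B i j)"
    using assms by (intro laplace_expansion_column) auto
  also have "\<dots> = (\<Sum>i<r. v i * cofactor A i j)"
  proof (rule sum.cong)
    fix i assume "i \<in> {..<r}"
    moreover have "mat_delete ?B i j = mat_delete A i j"
      using assms by (auto simp: mat_delete_def intro!: eq_matI)
    ultimately show "?B $$ (i, j) * cofactor ?B i j = v i * cofactor A i j"
      using assms by (simp add: cofactor_def)
  qed simp
  finally show ?thesis by simp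
qed

lemma cofactor_orthogonality:
  fixes A :: "'a::comm_ring_1 mat"
  assumes A: "A \<in> carrier_mat r r" and "i < r" "k < r"
  shows "(\<Sum>j<r. A $$ (k, j) * cofactor A i j) = (if k = i then det A else 0)"
    and "(\<Sum>j<r. A $$ (j, k) * cofactor A j i) = (if k = i then det A else 0)"
proof -
  have "(A * adj_mat A) $$ (k, i) = (\<Sum>j<r. A $$ (k, j) * cofactor A i j)"
    using assms by (simp add: adj_mat_def scalar_prod_def atLeast0LessThan)
  from this[symmetric] show "(\<Sum>j<r. A $$ (k, j) * cofactor A i j) = (if k = i then det A else 0)"
    using assms by (auto simp: adj_mat(2)[OF A])
  have "(adj_mat A * A) $$ (i, k) = (\<Sum>j<r. A $$ (j, k) * cofactor A j i)"
    using assms by (simp add: adj_mat_def scalar_prod_def atLeast0LessThan mult.commute)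
  from this[symmetric] show "(\<Sum>j<r. A $$ (j, k) * cofactor A j i) = (if k = i then det A else 0)"
    using assms by (auto simp: adj_mat(3)[OF A])
qed

lemma tmat_row_expansion:
  fixes M :: "'x \<Rightarrow> 'y \<Rightarrow> 'a::comm_ring_1"
  assumes "i < r"
  shows "(\<Sum>j<r. M (g j) t * cofactor (tmat r M f g) i j) = det (tmat r M (f(i := t)) g)"
  unfolding cofactor_row_expansion[OF tmat_carrier assms]
  by (rule arg_cong[of _ _ det]) (auto simp: tmat_def intro!: eq_matI)

lemma tmat_column_expansion:
  fixes M :: "'x \<Rightarrow> 'y \<Rightarrow> 'a::comm_ring_1"
  assumes "j < r"
  shows "(\<Sum>i<r. M s (f i) * cofactor (tmat r M f g) i j) = det (tmat r M f (g(j := s)))"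
  unfolding cofactor_column_expansion[OF tmat_carrier assms]
  by (rule arg_cong[of _ _ det]) (auto simp: tmat_def intro!: eq_matI)

text \<open>By the Leibniz formula the summand is a sum over pairs of permutations \<open>p\<close>,
  \<open>q\<close> of products over the entries of the tuple. The sum over all tuples therefore
  factors into \<open>\<Sum>t. U (p i) t * V (q i) t\<close>, one factor for each \<open>i\<close>,
  and the factor with \<open>q i = j\<close> vanishes. In terms of the Cauchy-Binet formula, column
  \<open>j\<close> of the product of the transpose of \<open>U\<close> with \<open>V\<close> is
  zero.\<close>

lemma sum_det_mult_det_eq_0:
  fixes U V :: "nat \<Rightarrow> 'y \<Rightarrow> 'a::comm_ring_1"
  assumes "finite Y" "j < r" and orth: "\<And>k. k < r \<Longrightarrow> (\<Sum>t\<in>Y. U k t * V j t) = 0"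
  shows "(\<Sum>f\<in>tuples r Y. det (mat r r (\<lambda>(i, k). U k (f i))) * det (mat r r (\<lambda>(i, k). V k (f i)))) = 0"
proof -
  let ?P = "{p. p permutes {0..<r}}"
  have "(\<Sum>f\<in>tuples r Y. det (mat r r (\<lambda>(i, k). U k (f i))) * det (mat r r (\<lambda>(i, k). V k (f i)))) =
      (\<Sum>f\<in>tuples r Y. \<Sum>p\<in>?P. \<Sum>q\<in>?P. signof p * signof q * (\<Prod>i<r. U (p i) (f i) * V (q i) (f i)))"
  proof (rule sum.cong)
    fix f
    have *: "det (mat r r (\<lambda>(i, k). W k (f i))) = (\<Sum>p\<in>?P. signof p * (\<Prod>i<r. W (p i) (f i)))"
      for W :: "nat \<Rightarrow> 'y \<Rightarrow> 'a"
      by (subst det_def'[of _ r])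
        (auto intro!: sum.cong prod.cong simp: atLeast0LessThan permutes_in_image
          dest: permutes_in_image)
    show "det (mat r r (\<lambda>(i, k). U k (f i))) * det (mat r r (\<lambda>(i, k). V k (f i))) =
      (\<Sum>p\<in>?P. \<Sum>q\<in>?P. signof p * signof q * (\<Prod>i<r. U (p i) (f i) * V (q i) (f i)))"
      unfolding * sum_product by (simp add: prod.distrib mult_ac)
  qed simp
  also have "\<dots> = (\<Sum>p\<in>?P. \<Sum>q\<in>?P. signof p * signof q *
      (\<Sum>f\<in>tuples r Y. \<Prod>i<r. U (p i) (f i) * V (q i) (f i)))"
    by (subst sum.swap, rule sum.cong[OF refl], subst sum.swap, simp add: sum_distrib_left)
  also have "\<dots> = 0"
  proof (intro sum.neutral ballI)
    fix p q assume pq: "p \<in> ?P" "q \<in> ?P"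
    have "(\<Sum>f\<in>tuples r Y. \<Prod>i<r. U (p i) (f i) * V (q i) (f i)) =
        (\<Prod>i<r. \<Sum>t\<in>Y. U (p i) t * V (q i) t)"
      unfolding tuples_def using \<open>finite Y\<close> by (subst prod_sum_PiE) auto
    also have "\<dots> = 0"
    proof (rule prod_zero)
      obtain i where i: "q i = j" using pq permutes_surj by (metis mem_Collect_eq surjD)
      then have "i < r" using pq \<open>j < r\<close> permutes_in_image[of q "{0..<r}" i] by simp
      moreover have "p i < r" using pq \<open>i < r\<close> permutes_in_image[of p "{0..<r}" i] by simp
      ultimately show "\<exists>i\<in>{..<r}. (\<Sum>t\<in>Y. U (p i) t * V (q i) t) = 0"
        using orth i by blast
    qed simp
    finally show "signof p * signof q *
      (\<Sum>f\<in>tuples r Y. \<Prod>i<r. U (p i) (f i) * V (q i) (f i)) = 0" by simp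
  qed
  finally show ?thesis .
qed

text \<open>Induction on the number of columns. Border a nonzero minor by the next column and by a
  row \<open>t\<close>, and expand along this row: if the result is 0 for all \<open>t\<close>, then
  the cofactors, which do not depend on \<open>t\<close>, are the coefficients of a linear relation
  between the columns. Its last coefficient is the minor that was bordered.\<close>

lemma exists_nonzero_minor:
  fixes M :: "'x \<Rightarrow> 'y \<Rightarrow> 'a::idom"
  assumes "\<And>c. (\<forall>t\<in>Y. (\<Sum>j<k. c j * M (g j) t) = 0) \<Longrightarrow> \<forall>j<k. c j = 0"
  shows "\<exists>f\<in>tuples k Y. det (tmat k M f g) \<noteq> 0"
  using assms
proof (induction k)
  case 0
  then show ?case by (simp add: tuples_def tmat_def)
next
  case (Suc k)
  have "\<exists>f\<in>tuples k Y. det (tmat k M f g) \<noteq> 0"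
  proof (rule Suc.IH)
    fix c assume *: "\<forall>t\<in>Y. (\<Sum>j<k. c j * M (g j) t) = 0"
    have "(\<Sum>j<Suc k. (if j < k then c j else 0) * M (g j) t) = (\<Sum>j<k. c j * M (g j) t)" for t
      by (simp add: lessThan_Suc)
    then have "\<forall>j<Suc k. (if j < k then c j else 0) = 0"
      using * by (intro Suc.prems) simp
    then show "\<forall>j<k. c j = 0"
      by (metis less_Suc_eq)
  qed
  then obtain f where f: "f \<in> tuples k Y" and nz: "det (tmat k M f g) \<noteq> 0" by blast
  show ?case
  proof (rule ccontr)
    assume none: "\<not> ?thesis"
    define c where "c j = cofactor (tmat (Suc k) M f g) k j" for j
    have "det (tmat (Suc k) M (f(k := t)) g) = 0" if "t \<in> Y" for t
    proof -
      have "f(k := t) \<in> tuples (Suc k) Y"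
        using f that by (auto simp: tuples_def PiE_def extensional_def less_Suc_eq)
      then show ?thesis using none by auto
    qed
    then have "\<forall>t\<in>Y. (\<Sum>j<Suc k. c j * M (g j) t) = 0"
      unfolding c_def mult.commute[of "cofactor _ _ _"] by (simp only: tmat_row_expansion lessI) simp
    then have "c k = 0" using Suc.prems by blast
    moreover have "mat_delete (tmat (Suc k) M f g) k k = tmat k M f g"
      by (auto simp: mat_delete_def tmat_def intro!: eq_matI)
    ultimately show False using nz by (simp add: c_def cofactor_def)
  qed
qed

text \<open>Pairing the relation with the cofactors of column \<open>k\<close> isolates \<open>c k *
  det\<close>.\<close>

lemma minor_nonzero_independent:
  fixes M :: "'x \<Rightarrow> 'y \<Rightarrow> 'a::idom"
  assumes nz: "det (tmat r M f g) \<noteq> 0"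
    and 0: "\<And>i. i < r \<Longrightarrow> (\<Sum>j<r. c j * M (g j) (f i)) = 0" and "k < r"
  shows "c k = 0"
proof -
  let ?A = "tmat r M f g"
  have "0 = (\<Sum>i<r. (\<Sum>j<r. c j * M (g j) (f i)) * cofactor ?A i k)"
    using 0 by simp
  also have "\<dots> = (\<Sum>i<r. \<Sum>j<r. c j * (M (g j) (f i) * cofactor ?A i k))"
    by (simp add: sum_distrib_right mult.assoc)
  also have "\<dots> = (\<Sum>j<r. c j * (\<Sum>i<r. ?A $$ (i, j) * cofactor ?A i k))"
    by (subst sum.swap) (simp add: sum_distrib_left)
  also have "\<dots> = (\<Sum>j<r. c j * (if j = k then det ?A else 0))"
    using \<open>k < r\<close> by (intro sum.cong refl arg_cong2[of _ _ _ _ "(*)"] cofactor_orthogonality) auto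
  also have "\<dots> = c k * det ?A" using \<open>k < r\<close> by (simp add: sum.delta' if_distrib cong: if_cong)
  finally show ?thesis using nz by simp
qed

section \<open>Moore-Penrose inverses\<close>

lemma sum_fun_at: "(\<Sum>a\<in>A. F a) x = (\<Sum>a\<in>A. F a x)"
  for F :: "'b \<Rightarrow> 'x \<Rightarrow> 'a::comm_monoid_add"
  by (induction A rule: infinite_finite_induct) auto

lemma mcomp_assoc: "mcomp Z (mcomp W N' N) M = mcomp W N' (mcomp Z N M)"
proof (intro ext)
  fix s t
  have "mcomp Z (mcomp W N' N) M s t = (\<Sum>z\<in>Z. \<Sum>w\<in>W. M s z * N z w * N' w t)"
    by (simp add: mcomp_def sum_distrib_left mult.assoc)
  also have "\<dots> = mcomp W N' (mcomp Z N M) s t"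
    by (subst sum.swap) (simp add: mcomp_def sum_distrib_right)
  finally show "mcomp Z (mcomp W N' N) M s t = mcomp W N' (mcomp Z N M) s t" .
qed

text \<open>Taking adjoints in \<open>B = B A\<close> (as products of matrices over
  \<open>Y\<close>) gives \<open>B = A B\<close>, which is \<open>A\<close>.\<close>

lemma hermitian_idempotents_eq:
  fixes A B :: "'s \<Rightarrow> 's \<Rightarrow> complex"
  assumes "\<And>t t'. t \<in> Y \<Longrightarrow> t' \<in> Y \<Longrightarrow> A t t' = (\<Sum>z\<in>Y. A t z * B z t')"
    and B: "\<And>t t'. t \<in> Y \<Longrightarrow> t' \<in> Y \<Longrightarrow> B t t' = (\<Sum>z\<in>Y. B t z * A z t')"
    and hA: "\<And>t t'. t \<in> Y \<Longrightarrow> t' \<in> Y \<Longrightarrow> A t t' = cnj (A t' t)"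
    and hB: "\<And>t t'. t \<in> Y \<Longrightarrow> t' \<in> Y \<Longrightarrow> B t t' = cnj (B t' t)"
    and t: "t \<in> Y" "t' \<in> Y"
  shows "A t t' = B t t'"
proof -
  have "B t t' = cnj (\<Sum>z\<in>Y. B t' z * A z t)"
    unfolding hB[OF t] by (subst B[OF t(2,1)]) simp
  also have "\<dots> = (\<Sum>z\<in>Y. A t z * B z t')"
    unfolding cnj_sum
  proof (rule sum.cong)
    fix z assume z: "z \<in> Y"
    show "cnj (B t' z * A z t) = A t z * B z t'"
      using hA[OF t(1) z] hB[OF z t(2)] by simp
  qed simp
  finally show ?thesis using assms(1) t by simp
qed

text \<open>\<open>M P\<close> and \<open>M Q\<close> are both the orthogonal projection onto the
  image of \<open>M\<close>.\<close>

lemma range_projection_unique: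
  assumes MPM: "\<And>s t. s \<in> X \<Longrightarrow> t \<in> Y \<Longrightarrow> mcomp X M (mcomp Y P M) s t = M s t"
    and MQM: "\<And>s t. s \<in> X \<Longrightarrow> t \<in> Y \<Longrightarrow> mcomp X M (mcomp Y Q M) s t = M s t"
    and "\<And>t t'. t \<in> Y \<Longrightarrow> t' \<in> Y \<Longrightarrow> mcomp X M P t t' = cnj (mcomp X M P t' t)"
    and "\<And>t t'. t \<in> Y \<Longrightarrow> t' \<in> Y \<Longrightarrow> mcomp X M Q t t' = cnj (mcomp X M Q t' t)"
    and "t \<in> Y" "t' \<in> Y"
  shows "mcomp X M P t t' = mcomp X M Q t t'"
proof (rule hermitian_idempotents_eq[OF _ _ assms(3-6)])
  fix t t' assume tt: "t \<in> Y" "t' \<in> Y"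
  have *: "mcomp X M P' t t' = (\<Sum>z\<in>Y. mcomp X M P' t z * mcomp X M Q' z t')"
    if "\<And>s t. s \<in> X \<Longrightarrow> t \<in> Y \<Longrightarrow> mcomp X M (mcomp Y Q' M) s t = M s t" for P' Q'
  proof -
    have "mcomp X M P' t t' = mcomp X (mcomp X M (mcomp Y Q' M)) P' t t'"
      unfolding mcomp_def[of X _ P'] using that tt by (intro sum.cong) auto
    also have "\<dots> = mcomp Y (mcomp X M Q') (mcomp X M P') t t'" by (simp add: mcomp_assoc)
    finally show ?thesis by (simp add: mcomp_def[of Y])
  qed
  from *[OF MQM, of P] *[OF MPM, of Q]
  show "mcomp X M P t t' = (\<Sum>z\<in>Y. mcomp X M P t z * mcomp X M Q z t')"
    "mcomp X M Q t t' = (\<Sum>z\<in>Y. mcomp X M Q t z * mcomp X M P z t')" by blast+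
qed

text \<open>\<open>P M\<close> and \<open>Q M\<close> are both the orthogonal projection onto the
  complement of the kernel of \<open>M\<close>. Here \<open>M = M Q M\<close> gives \<open>P M = (P
  M) (Q M)\<close>; the order of the factors is opposite to that in
  \<open>hermitian_idempotents_eq\<close>, whence the transposition of indices.\<close>

lemma coimage_projection_unique:
  assumes MPM: "\<And>s t. s \<in> X \<Longrightarrow> t \<in> Y \<Longrightarrow> mcomp X M (mcomp Y P M) s t = M s t"
    and MQM: "\<And>s t. s \<in> X \<Longrightarrow> t \<in> Y \<Longrightarrow> mcomp X M (mcomp Y Q M) s t = M s t"
    and hP: "\<And>s s'. s \<in> X \<Longrightarrow> s' \<in> X \<Longrightarrow> mcomp Y P M s s' = cnj (mcomp Y P M s' s)"
    and hQ: "\<And>s s'. s \<in> X \<Longrightarrow> s' \<in> X \<Longrightarrow> mcomp Y Q M s s' = cnj (mcomp Y Q M s' s)"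
    and s: "s \<in> X" "s' \<in> X"
  shows "mcomp Y P M s s' = mcomp Y Q M s s'"
proof (rule hermitian_idempotents_eq[where A = "\<lambda>s s'. mcomp Y P M s' s"
      and B = "\<lambda>s s'. mcomp Y Q M s' s", OF _ _ hP hQ s(2,1)])
  fix s' s assume ss: "s' \<in> X" "s \<in> X"
  have *: "mcomp Y P' M s s' = (\<Sum>z\<in>X. mcomp Y P' M z s' * mcomp Y Q' M s z)"
    if "\<And>s t. s \<in> X \<Longrightarrow> t \<in> Y \<Longrightarrow> mcomp X M (mcomp Y Q' M) s t = M s t" for P' Q'
  proof -
    have "mcomp Y P' M s s' = mcomp Y P' (mcomp X M (mcomp Y Q' M)) s s'"
      unfolding mcomp_def[of Y P'] using that ss by (intro sum.cong) auto
    also have "\<dots> = mcomp X (mcomp Y P' M) (mcomp Y Q' M) s s'" by (simp add: mcomp_assoc)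
    finally show ?thesis by (simp add: mcomp_def[of X] mult.commute)
  qed
  from *[OF MQM, of P] *[OF MPM, of Q]
  show "mcomp Y P M s s' = (\<Sum>z\<in>X. mcomp Y P M z s' * mcomp Y Q M s z)"
    "mcomp Y Q M s s' = (\<Sum>z\<in>X. mcomp Y Q M z s' * mcomp Y P M s z)" by blast+
qed

text \<open>With the two projections independent of the choice of generalized inverse, \<open>P = P
  M P = P M Q = Q M Q\<close>. As the condition \<open>Q M Q = Q\<close> is not among the
  hypotheses, this applies to matrices \<open>Q\<close> for which it is not yet known.\<close>

lemma moore_penrose_eq_sandwich:
  assumes P: "is_moore_penrose X Y M P"
    and Q: "\<And>s t. s \<in> X \<Longrightarrow> t \<in> Y \<Longrightarrow> mcomp X M (mcomp Y Q M) s t = M s t"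
      "\<And>t t'. t \<in> Y \<Longrightarrow> t' \<in> Y \<Longrightarrow> mcomp X M Q t t' = cnj (mcomp X M Q t' t)"
      "\<And>s s'. s \<in> X \<Longrightarrow> s' \<in> X \<Longrightarrow> mcomp Y Q M s s' = cnj (mcomp Y Q M s' s)"
    and t: "t \<in> Y" and s: "s \<in> X"
  shows "P t s = mcomp Y Q (mcomp X M Q) t s"
proof -
  note D = is_moore_penrose_def
  have P': "\<And>s t. s \<in> X \<Longrightarrow> t \<in> Y \<Longrightarrow> mcomp X M (mcomp Y P M) s t = M s t"
      "\<And>t t'. t \<in> Y \<Longrightarrow> t' \<in> Y \<Longrightarrow> mcomp X M P t t' = cnj (mcomp X M P t' t)"
      "\<And>s s'. s \<in> X \<Longrightarrow> s' \<in> X \<Longrightarrow> mcomp Y P M s s' = cnj (mcomp Y P M s' s)"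
    using P unfolding D by blast+
  have "P t s = mcomp Y P (mcomp X M P) t s" using P t s unfolding D by simp
  also have "\<dots> = mcomp Y P (mcomp X M Q) t s"
    unfolding mcomp_def[of Y]
    using range_projection_unique[OF P'(1) Q(1) P'(2) Q(2)] t by (intro sum.cong) auto
  also have "\<dots> = mcomp X (mcomp Y P M) Q t s" by (simp add: mcomp_assoc)
  also have "\<dots> = mcomp X (mcomp Y Q M) Q t s"
    unfolding mcomp_def[of X _ Q]
    using coimage_projection_unique[OF P'(1) Q(1) P'(3) Q(3)] s by (intro sum.cong) auto
  finally show ?thesis by (simp add: mcomp_assoc)
qed

lemma moore_penrose_unique:
  assumes P: "is_moore_penrose X Y M P" and Q: "is_moore_penrose X Y M Q"
  shows "P = Q"
proof (intro ext)
  fix t s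
  note D = is_moore_penrose_def
  show "P t s = Q t s"
  proof (cases "t \<in> Y \<and> s \<in> X")
    case False
    then have "P t s = 0" "Q t s = 0" using P Q unfolding D by blast+
    then show ?thesis by simp
  next
    case True
    have Q': "\<And>s t. s \<in> X \<Longrightarrow> t \<in> Y \<Longrightarrow> mcomp X M (mcomp Y Q M) s t = M s t"
      "\<And>t t'. t \<in> Y \<Longrightarrow> t' \<in> Y \<Longrightarrow> mcomp X M Q t t' = cnj (mcomp X M Q t' t)"
      "\<And>s s'. s \<in> X \<Longrightarrow> s' \<in> X \<Longrightarrow> mcomp Y Q M s s' = cnj (mcomp Y Q M s' s)"
      using Q unfolding D by blast+
    have "P t s = mcomp Y Q (mcomp X M Q) t s"
      using moore_penrose_eq_sandwich[OF P Q'] True by blast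
    then show ?thesis using Q True unfolding D by simp
  qed
qed

text \<open>Let \<open>k\<close> label the blocks of \<open>M\<close>, and let \<open>Q\<close> be
  the part of \<open>P\<close> inside the blocks. Passing to this part commutes with composition
  with \<open>M\<close>, so \<open>Q\<close> inherits from \<open>P\<close> the Penrose conditions
  on \<open>M Q\<close>, \<open>Q M\<close> and \<open>M Q M\<close>. Hence \<open>P = Q M
  Q\<close>, a product of block diagonal matrices.\<close>

lemma moore_penrose_block_diagonal:
  assumes P: "is_moore_penrose X Y M P"
    and M: "\<And>s t. s \<in> X \<Longrightarrow> t \<in> Y \<Longrightarrow> M s t \<noteq> 0 \<Longrightarrow> k s = k t"
    and "k t \<noteq> k s"
  shows "P t s = 0"
proof (cases "t \<in> Y \<and> s \<in> X")
  case False
  then show ?thesis using P unfolding is_moore_penrose_def by blast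
next
  case True
  define Q where "Q t s = (if k t = k s then P t s else 0)" for t s
  have MQ: "mcomp X M Q a b = (if k a = k b then mcomp X M P a b else 0)" if "b \<in> Y" for a b
  proof -
    have "mcomp X M Q a b = (\<Sum>z\<in>X. if k a = k b then P a z * M z b else 0)"
      unfolding mcomp_def Q_def
    proof (rule sum.cong[OF refl])
      fix z assume "z \<in> X"
      then show "(if k a = k z then P a z else 0) * M z b = (if k a = k b then P a z * M z b else 0)"
        using M[OF _ that, of z] by (cases "M z b = 0") auto
    qed
    then show ?thesis by (simp add: mcomp_def)
  qed
  have QM: "mcomp Y Q M a b = (if k a = k b then mcomp Y P M a b else 0)" if "a \<in> X" for a b
  proof -
    have "mcomp Y Q M a b = (\<Sum>z\<in>Y. if k a = k b then M a z * P z b else 0)"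
      unfolding mcomp_def Q_def
    proof (rule sum.cong[OF refl])
      fix z assume "z \<in> Y"
      then show "M a z * (if k z = k b then P z b else 0) = (if k a = k b then M a z * P z b else 0)"
        using M[OF that, of z] by (cases "M a z = 0") auto
    qed
    then show ?thesis by (simp add: mcomp_def)
  qed
  have "P t s = mcomp Y Q (mcomp X M Q) t s"
  proof (rule moore_penrose_eq_sandwich[OF P])
    fix a b assume ab: "a \<in> X" "b \<in> Y"
    have "mcomp X M (mcomp Y Q M) a b = (\<Sum>z\<in>X. if k a = k b then mcomp Y P M a z * M z b else 0)"
      unfolding mcomp_def[of X] QM[OF ab(1)]
    proof (rule sum.cong[OF refl])
      fix z assume "z \<in> X"
      then show "(if k a = k z then mcomp Y P M a z else 0) * M z b =
          (if k a = k b then mcomp Y P M a z * M z b else 0)"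
        using M[OF _ ab(2), of z] by (cases "M z b = 0") auto
    qed
    also have "\<dots> = (if k a = k b then mcomp X M (mcomp Y P M) a b else 0)"
      by (simp add: mcomp_def[of X])
    also have "\<dots> = (if k a = k b then M a b else 0)"
      using P ab unfolding is_moore_penrose_def by simp
    finally show "mcomp X M (mcomp Y Q M) a b = M a b" using M[OF ab] by auto
  next
    fix a b assume "a \<in> Y" "b \<in> Y"
    moreover from this have "mcomp X M P a b = cnj (mcomp X M P b a)"
      using P unfolding is_moore_penrose_def by blast
    ultimately show "mcomp X M Q a b = cnj (mcomp X M Q b a)" by (simp add: MQ)
  next
    fix a b assume "a \<in> X" "b \<in> X"
    moreover from this have "mcomp Y P M a b = cnj (mcomp Y P M b a)"
      using P unfolding is_moore_penrose_def by blast
    ultimately show "mcomp Y Q M a b = cnj (mcomp Y Q M b a)" by (simp add: QM)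
  qed (use True in auto)
  also have "\<dots> = 0"
    unfolding mcomp_def[of Y] by (intro sum.neutral ballI) (use assms(3) in \<open>auto simp: MQ Q_def\<close>)
  finally show ?thesis .
qed

lemma moore_penrose_eqI: "is_moore_penrose X Y M P \<Longrightarrow> moore_penrose X Y M = P"
  unfolding moore_penrose_def by (blast intro: moore_penrose_unique)

section \<open>Rank and nonzero minors\<close>

text \<open>Extended by zero outside \<open>Y\<close>, as all elements of \<open>image_space\<close>
  are.\<close>

definition mcol :: "'s set \<Rightarrow> ('s \<Rightarrow> 's \<Rightarrow> complex) \<Rightarrow> 's \<Rightarrow> 's \<Rightarrow> complex" where
  "mcol Y M s = (\<lambda>t. if t \<in> Y then M s t else 0)"

lemma linmap_eq_sum_columns: "linmap X Y M v = (\<Sum>s\<in>X. fscale (v s) (mcol Y M s))"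
  by (auto simp: linmap_def mcol_def fscale_def fun_eq_iff sum_fun_at)

lemma image_space_eq_span:
  assumes "finite X"
  shows "image_space X Y M = fun_vs.span (mcol Y M ` X)"
proof
  show "image_space X Y M \<subseteq> fun_vs.span (mcol Y M ` X)"
    unfolding image_space_def linmap_eq_sum_columns image_subset_iff
    by (intro ballI fun_vs.span_sum fun_vs.span_scale) (rule fun_vs.span_base, blast)
  show "fun_vs.span (mcol Y M ` X) \<subseteq> image_space X Y M"
  proof (rule fun_vs.span_minimal)
    show "mcol Y M ` X \<subseteq> image_space X Y M"
    proof
      fix w assume "w \<in> mcol Y M ` X"
      then obtain s where s: "s \<in> X" "w = mcol Y M s" by blast
      have "(\<Sum>s'\<in>X. (if s' = s then 1 else 0) * M s' t) = M s t" for t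
        using s assms by (simp add: if_distrib if_distribR sum.delta cong: if_cong)
      then have "w = linmap X Y M (\<lambda>s'. if s' = s then 1 else 0)"
        by (auto simp: s linmap_def mcol_def)
      then show "w \<in> image_space X Y M"
        using s by (auto simp: image_space_def coord_space_def)
    qed
    have zero: "linmap X Y M 0 = 0" by (auto simp: linmap_def)
    have add: "linmap X Y M (v + w) = linmap X Y M v + linmap X Y M w" for v w
      by (auto simp: linmap_def fun_eq_iff sum.distrib algebra_simps)
    have scale: "linmap X Y M (fscale c v) = fscale c (linmap X Y M v)" for c v
      by (auto simp: linmap_def fscale_def fun_eq_iff sum_distrib_left algebra_simps)
    show "fun_vs.subspace (image_space X Y M)"
      unfolding fun_vs.subspace_def image_space_def
    proof (intro conjI ballI allI)
      show "0 \<in> linmap X Y M ` coord_space X"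
        using zero by (intro image_eqI[of _ _ 0]) (auto simp: coord_space_def)
      fix x c assume "x \<in> linmap X Y M ` coord_space X"
      then obtain v where v: "x = linmap X Y M v" "v \<in> coord_space X" by blast
      show "fscale c x \<in> linmap X Y M ` coord_space X"
        using v by (intro image_eqI[of _ _ "fscale c v"]) (auto simp: scale, simp add: coord_space_def fscale_def)
      fix y assume "y \<in> linmap X Y M ` coord_space X"
      then obtain w where w: "y = linmap X Y M w" "w \<in> coord_space X" by blast
      show "x + y \<in> linmap X Y M ` coord_space X"
        using v w by (intro image_eqI[of _ _ "v + w"]) (auto simp: add coord_space_def)
    qed
  qed
qed

locale finite_matrix =
  fixes X Y :: "'s set" and M :: "'s \<Rightarrow> 's \<Rightarrow> complex"
  assumes finite_X: "finite X" and finite_Y: "finite Y"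
begin

definition r :: nat where "r = fun_vs.dim (image_space X Y M)"

abbreviation T :: "(nat \<Rightarrow> 's) \<Rightarrow> (nat \<Rightarrow> 's) \<Rightarrow> complex mat" where "T \<equiv> tmat r M"

text \<open>The \<open>r\<close> columns through a nonzero minor are linearly independent, and the
  image has dimension \<open>r\<close>.\<close>

lemma columns_span_image:
  assumes f: "f \<in> tuples r Y" and g: "g \<in> tuples r X" and nz: "det (T f g) \<noteq> 0" and s: "s \<in> X"
  obtains c where "\<And>t. t \<in> Y \<Longrightarrow> M s t = (\<Sum>j<r. c j * M (g j) t)"
proof -
  let ?col = "mcol Y M"
  have indep: "c k = 0" if "(\<Sum>j<r. fscale (c j) (?col (g j))) = 0" "k < r" for c k
  proof (rule minor_nonzero_independent[OF nz _ \<open>k < r\<close>])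
    fix i assume i: "i < r"
    have "(\<Sum>j<r. c j * M (g j) (f i)) = (\<Sum>j<r. fscale (c j) (?col (g j))) (f i)"
      using tuples_mem[OF f i] by (simp add: sum_fun_at fscale_def mcol_def)
    then show "(\<Sum>j<r. c j * M (g j) (f i)) = 0" using that by simp
  qed
  have inj: "inj_on (\<lambda>j. ?col (g j)) {..<r}"
  proof (rule inj_onI, rule ccontr)
    fix a b assume ab: "a \<in> {..<r}" "b \<in> {..<r}" "?col (g a) = ?col (g b)" "a \<noteq> b"
    define c :: "nat \<Rightarrow> complex" where "c j = (if j = a then 1 else if j = b then - 1 else 0)" for j
    have "(\<Sum>j<r. fscale (c j) (?col (g j))) x = 0" for x
    proof -
      have "(\<Sum>j<r. fscale (c j) (?col (g j))) x = (\<Sum>j<r. c j * ?col (g j) x)"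
        by (simp add: sum_fun_at fscale_def)
      also have "\<dots> = (\<Sum>j\<in>{a, b}. c j * ?col (g j) x)"
        using ab(1,2) by (intro sum.mono_neutral_right) (auto simp: c_def)
      also have "\<dots> = 0" using ab(3,4) by (simp add: c_def)
      finally show ?thesis .
    qed
    then have "c a = 0" using ab(1) by (intro indep ext) auto
    then have False by (simp add: c_def)
    then show False .
  qed
  define S where "S = (\<lambda>j. ?col (g j)) ` {..<r}"
  have finS: "finite S" and cardS: "card S = r"
    using inj by (auto simp: S_def card_image)
  have S_sub: "S \<subseteq> ?col ` X" using tuples_mem[OF g] by (auto simp: S_def)
  have reidx: "(\<Sum>v\<in>S. fscale (u v) v) = (\<Sum>j<r. fscale (u (?col (g j))) (?col (g j)))" for u
    unfolding S_def by (subst sum.reindex[OF inj]) simp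
  have indS: "fun_vs.independent S"
  proof (rule fun_vs.independent_if_scalars_zero[OF finS])
    fix u x assume "(\<Sum>v\<in>S. fscale (u v) v) = 0" "x \<in> S"
    then have "u (?col (g j)) = 0" if "j < r" for j
      using indep[OF _ that, of "\<lambda>j. u (?col (g j))"] by (simp only: reidx)
    then show "u x = 0" using \<open>x \<in> S\<close> by (auto simp: S_def)
  qed
  have "?col s \<in> fun_vs.span S"
  proof (rule ccontr)
    assume no: "?col s \<notin> fun_vs.span S"
    obtain B where B: "B \<subseteq> ?col ` X" "fun_vs.independent B" "?col ` X \<subseteq> fun_vs.span B"
      "card B = fun_vs.dim (?col ` X)" using fun_vs.basis_exists .
    have "finite B" using B(1) finite_X finite_subset by blast
    have "card B = r" unfolding r_def image_space_eq_span[OF finite_X] fun_vs.dim_span by (rule B(4))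
    have "fun_vs.independent (insert (?col s) S)"
      using no indS by (rule fun_vs.independent_insertI)
    moreover have "insert (?col s) S \<subseteq> fun_vs.span B" using S_sub B(3) s by blast
    ultimately have "card (insert (?col s) S) \<le> card B"
      by (rule fun_vs.independent_span_bound[OF \<open>finite B\<close>, THEN conjunct2])
    moreover have "?col s \<notin> S" using no fun_vs.span_base by blast
    ultimately show False using finS cardS \<open>card B = r\<close> by simp
  qed
  then obtain u where u: "?col s = (\<Sum>v\<in>S. fscale (u v) v)"
    unfolding fun_vs.span_finite[OF finS] by blast
  have "M s t = (\<Sum>j<r. u (?col (g j)) * M (g j) t)" if "t \<in> Y" for t
  proof -
    have "M s t = ?col s t" using that by (simp add: mcol_def)
    also have "\<dots> = (\<Sum>j<r. u (?col (g j)) * ?col (g j) t)"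
      unfolding u reidx by (simp add: sum_fun_at fscale_def)
    finally show ?thesis using that by (simp add: mcol_def)
  qed
  then show thesis by (rule that)
qed

lemma exists_rank_minor: "\<exists>f\<in>tuples r Y. \<exists>g\<in>tuples r X. det (T f g) \<noteq> 0"
proof -
  let ?col = "mcol Y M"
  obtain B where B: "B \<subseteq> ?col ` X" "fun_vs.independent B" "?col ` X \<subseteq> fun_vs.span B"
    "card B = fun_vs.dim (?col ` X)" using fun_vs.basis_exists .
  have "finite B" using B(1) finite_X finite_subset by blast
  have "card B = r" unfolding r_def image_space_eq_span[OF finite_X] fun_vs.dim_span by (rule B(4))
  then obtain h where h: "bij_betw h {..<r} B"
    using ex_bij_betw_nat_finite[OF \<open>finite B\<close>] by (auto simp: atLeast0LessThan)
  have "\<forall>j\<in>{..<r}. \<exists>s\<in>X. ?col s = h j"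
  proof
    fix j assume "j \<in> {..<r}"
    then have "h j \<in> ?col ` X" using B(1) bij_betwE[OF h] by blast
    then show "\<exists>s\<in>X. ?col s = h j" by auto
  qed
  then obtain g0 where g0: "\<And>j. j < r \<Longrightarrow> g0 j \<in> X \<and> ?col (g0 j) = h j"
    unfolding Bex_def bchoice_iff by auto
  define g where "g = restrict g0 {..<r}"
  have g: "g \<in> tuples r X" using g0 by (auto simp: g_def tuples_def)
  have gh: "?col (g j) = h j" if "j < r" for j using g0 that by (simp add: g_def)
  have "\<exists>f\<in>tuples r Y. det (T f g) \<noteq> 0"
  proof (rule exists_nonzero_minor, intro allI impI)
    fix c k assume c: "\<forall>t\<in>Y. (\<Sum>j<r. c j * M (g j) t) = 0" and k: "k < r"
    let ?u = "\<lambda>v. c (inv_into {..<r} h v)"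
    have "(\<Sum>v\<in>B. fscale (?u v) v) = (\<Sum>j<r. fscale (?u (h j)) (h j))"
      using h by (intro sum.reindex_bij_betw[symmetric])
    also have "\<dots> = (\<Sum>j<r. fscale (c j) (?col (g j)))"
      using h by (intro sum.cong) (auto simp: gh bij_betw_def)
    also have "\<dots> = 0"
    proof
      fix t
      show "(\<Sum>j<r. fscale (c j) (?col (g j))) t = 0 t"
        using c by (cases "t \<in> Y") (simp_all add: sum_fun_at fscale_def mcol_def)
    qed
    finally have "?u (h k) = 0"
      by (rule fun_vs.independentD[OF B(2) \<open>finite B\<close> subset_refl]) (use h k in \<open>auto simp: bij_betw_def\<close>)
    then show "c k = 0" using h k by (simp add: bij_betw_def)
  qed
  then show ?thesis using g by blast
qed

end

section \<open>The mean of the inverses of the nonsingular submatrices\<close>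

lemma det_cnj:
  assumes "A \<in> carrier_mat n n" and "\<And>i j. i < n \<Longrightarrow> j < n \<Longrightarrow> cnj (A $$ (i, j)) = A $$ (i, j)"
  shows "cnj (det A) = det A"
  unfolding det_def'[OF assms(1)] cnj_sum
proof (rule sum.cong)
  fix p assume "p \<in> {p. p permutes {0..<n}}"
  then have "p i < n" if "i < n" for i using that permutes_in_image[of p "{0..<n}" i] by simp
  then show "cnj (signof p * (\<Prod>i = 0..<n. A $$ (i, p i))) = signof p * (\<Prod>i = 0..<n. A $$ (i, p i))"
    using assms(2) by (simp add: cnj_prod)
qed simp

context finite_matrix
begin

definition Delta :: complex where
  "Delta = (\<Sum>f\<in>tuples r Y. \<Sum>g\<in>tuples r X. (det (T f g))\<^sup>2)"

text \<open>The term of \<open>f\<close> and \<open>g\<close> is \<open>(det (T f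
  g))\<^sup>2\<close> times the entry of the inverse of \<open>T f g\<close>, extended by zero from
  the rows \<open>f\<close> and columns \<open>g\<close>; in the form with cofactors it makes sense
  for singular \<open>T f g\<close> too.\<close>

definition cofactor_sum :: "'s \<Rightarrow> 's \<Rightarrow> complex" where
  "cofactor_sum t s = (\<Sum>f\<in>tuples r Y. \<Sum>g\<in>tuples r X. det (T f g) *
     (\<Sum>i<r. \<Sum>j<r. if f i = t \<and> g j = s then cofactor (T f g) i j else 0))"

definition cofactor_mean :: "'s \<Rightarrow> 's \<Rightarrow> complex" where "cofactor_mean t s = cofactor_sum t s / Delta"

lemma sum_cofactor_sum_mult:
  "(\<Sum>s\<in>X. cofactor_sum t s * u s) = (\<Sum>f\<in>tuples r Y. \<Sum>g\<in>tuples r X. det (T f g) *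
     (\<Sum>i<r. if f i = t then \<Sum>j<r. u (g j) * cofactor (T f g) i j else 0))"
proof -
  let ?K = "\<lambda>f g i j s. if f i = t \<and> g j = s then cofactor (T f g) i j else 0"
  have "(\<Sum>s\<in>X. cofactor_sum t s * u s) = (\<Sum>s\<in>X. \<Sum>f\<in>tuples r Y. \<Sum>g\<in>tuples r X. det (T f g) *
      (\<Sum>i<r. \<Sum>j<r. ?K f g i j s * u s))"
    by (simp only: cofactor_sum_def sum_distrib_right mult.assoc)
  also have "\<dots> = (\<Sum>f\<in>tuples r Y. \<Sum>g\<in>tuples r X. \<Sum>s\<in>X. det (T f g) *
      (\<Sum>i<r. \<Sum>j<r. ?K f g i j s * u s))"
    by (subst sum.swap, rule sum.cong[OF refl], rule sum.swap)
  also have "\<dots> = (\<Sum>f\<in>tuples r Y. \<Sum>g\<in>tuples r X. det (T f g) *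
     (\<Sum>i<r. if f i = t then \<Sum>j<r. u (g j) * cofactor (T f g) i j else 0))"
  proof (intro sum.cong refl)
    fix f g assume g: "g \<in> tuples r X"
    have "(\<Sum>s\<in>X. \<Sum>i<r. \<Sum>j<r. ?K f g i j s * u s) = (\<Sum>i<r. \<Sum>j<r. \<Sum>s\<in>X. ?K f g i j s * u s)"
      by (subst sum.swap, rule sum.cong[OF refl], rule sum.swap)
    also have "\<dots> = (\<Sum>i<r. \<Sum>j<r. if f i = t then u (g j) * cofactor (T f g) i j else 0)"
    proof (intro sum.cong refl)
      fix i j assume "j \<in> {..<r}"
      then have "g j \<in> X" using tuples_mem[OF g] by simp
      have "(\<Sum>s\<in>X. ?K f g i j s * u s) =
          (\<Sum>s\<in>X. if s = g j then (if f i = t then u (g j) * cofactor (T f g) i j else 0) else 0)"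
        by (intro sum.cong) auto
      then show "(\<Sum>s\<in>X. ?K f g i j s * u s) = (if f i = t then u (g j) * cofactor (T f g) i j else 0)"
        using \<open>g j \<in> X\<close> finite_X by (simp add: sum.delta)
    qed
    also have "\<dots> = (\<Sum>i<r. if f i = t then \<Sum>j<r. u (g j) * cofactor (T f g) i j else 0)"
      by (intro sum.cong) auto
    finally show "(\<Sum>s\<in>X. det (T f g) * (\<Sum>i<r. \<Sum>j<r. ?K f g i j s * u s)) = det (T f g) *
        (\<Sum>i<r. if f i = t then \<Sum>j<r. u (g j) * cofactor (T f g) i j else 0)"
      by (simp only: sum_distrib_left[symmetric])
  qed
  finally show ?thesis .
qed

lemma sum_mult_cofactor_sum:
  "(\<Sum>t\<in>Y. y t * cofactor_sum t s) = (\<Sum>f\<in>tuples r Y. \<Sum>g\<in>tuples r X. det (T f g) *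
     (\<Sum>j<r. if g j = s then \<Sum>i<r. y (f i) * cofactor (T f g) i j else 0))"
proof -
  let ?K = "\<lambda>f g i j t. if f i = t \<and> g j = s then cofactor (T f g) i j else 0"
  have "(\<Sum>t\<in>Y. y t * cofactor_sum t s) = (\<Sum>t\<in>Y. \<Sum>f\<in>tuples r Y. \<Sum>g\<in>tuples r X. det (T f g) *
      (\<Sum>i<r. \<Sum>j<r. y t * ?K f g i j t))"
    by (simp only: cofactor_sum_def sum_distrib_left mult.left_commute)
  also have "\<dots> = (\<Sum>f\<in>tuples r Y. \<Sum>g\<in>tuples r X. \<Sum>t\<in>Y. det (T f g) *
      (\<Sum>i<r. \<Sum>j<r. y t * ?K f g i j t))"
    by (subst sum.swap, rule sum.cong[OF refl], rule sum.swap)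
  also have "\<dots> = (\<Sum>f\<in>tuples r Y. \<Sum>g\<in>tuples r X. det (T f g) *
     (\<Sum>j<r. if g j = s then \<Sum>i<r. y (f i) * cofactor (T f g) i j else 0))"
  proof (intro sum.cong refl)
    fix f g assume f: "f \<in> tuples r Y"
    have "(\<Sum>t\<in>Y. \<Sum>i<r. \<Sum>j<r. y t * ?K f g i j t) = (\<Sum>i<r. \<Sum>j<r. \<Sum>t\<in>Y. y t * ?K f g i j t)"
      by (subst sum.swap, rule sum.cong[OF refl], rule sum.swap)
    also have "\<dots> = (\<Sum>i<r. \<Sum>j<r. if g j = s then y (f i) * cofactor (T f g) i j else 0)"
    proof (intro sum.cong refl)
      fix i j assume "i \<in> {..<r}"
      then have "f i \<in> Y" using tuples_mem[OF f] by simp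
      have "(\<Sum>t\<in>Y. y t * ?K f g i j t) =
          (\<Sum>t\<in>Y. if t = f i then (if g j = s then y (f i) * cofactor (T f g) i j else 0) else 0)"
        by (intro sum.cong) auto
      then show "(\<Sum>t\<in>Y. y t * ?K f g i j t) = (if g j = s then y (f i) * cofactor (T f g) i j else 0)"
        using \<open>f i \<in> Y\<close> finite_Y by (simp add: sum.delta)
    qed
    also have "\<dots> = (\<Sum>j<r. if g j = s then \<Sum>i<r. y (f i) * cofactor (T f g) i j else 0)"
      by (subst sum.swap) (intro sum.cong; auto)
    finally show "(\<Sum>t\<in>Y. det (T f g) * (\<Sum>i<r. \<Sum>j<r. y t * ?K f g i j t)) = det (T f g) *
        (\<Sum>j<r. if g j = s then \<Sum>i<r. y (f i) * cofactor (T f g) i j else 0)"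
      by (simp only: sum_distrib_left[symmetric])
  qed
  finally show ?thesis .
qed

text \<open>Cramer: composition with \<open>M\<close> replaces the row \<open>t\<close> of a minor
  by the row \<open>t'\<close>.\<close>

lemma M_after_cofactor_sum: "mcomp X M cofactor_sum t t' = (\<Sum>f\<in>tuples r Y. \<Sum>g\<in>tuples r X. det (T f g) *
    (\<Sum>i<r. if f i = t then det (T (f(i := t')) g) else 0))"
  unfolding mcomp_def sum_cofactor_sum_mult
  by (intro sum.cong refl arg_cong2[of _ _ _ _ "(*)"]) (simp add: tmat_row_expansion)

lemma cofactor_sum_after_M: "mcomp Y cofactor_sum M s s' = (\<Sum>f\<in>tuples r Y. \<Sum>g\<in>tuples r X. det (T f g) *
    (\<Sum>j<r. if g j = s' then det (T f (g(j := s))) else 0))"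
  unfolding mcomp_def sum_mult_cofactor_sum
  by (intro sum.cong refl arg_cong2[of _ _ _ _ "(*)"]) (simp add: tmat_column_expansion)

text \<open>The two minors in a summand differ in row \<open>i\<close> only, and \<open>f \<mapsto>
  f(i := t')\<close> matches the summands of the two sides.\<close>

lemma M_after_cofactor_sum_symmetric:
  assumes "t \<in> Y" "t' \<in> Y"
  shows "mcomp X M cofactor_sum t t' = mcomp X M cofactor_sum t' t"
proof -
  have *: "mcomp X M cofactor_sum a b = (\<Sum>g\<in>tuples r X. \<Sum>i<r. \<Sum>f\<in>{f \<in> tuples r Y. f i = a}.
      det (T f g) * det (T (f(i := b)) g))" for a b
  proof -
    have "mcomp X M cofactor_sum a b = (\<Sum>g\<in>tuples r X. \<Sum>f\<in>tuples r Y. \<Sum>i<r.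
        if f i = a then det (T f g) * det (T (f(i := b)) g) else 0)"
      unfolding M_after_cofactor_sum sum_distrib_left
      by (subst sum.swap) (intro sum.cong; simp)
    also have "\<dots> = (\<Sum>g\<in>tuples r X. \<Sum>i<r. \<Sum>f\<in>tuples r Y.
        if f i = a then det (T f g) * det (T (f(i := b)) g) else 0)"
      by (rule sum.cong[OF refl], rule sum.swap)
    finally show ?thesis
      using finite_Y by (simp add: sum.If_cases Collect_conj_eq[symmetric] Int_def)
  qed
  show ?thesis unfolding *
    by (intro sum.cong refl sum.reindex_bij_witness[of _ "\<lambda>f. f(_ := t)" "\<lambda>f. f(_ := t')"])
      (use assms in \<open>auto simp: tuples_upd\<close>)
qed

lemma cofactor_sum_after_M_symmetric:
  assumes "s \<in> X" "s' \<in> X"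
  shows "mcomp Y cofactor_sum M s s' = mcomp Y cofactor_sum M s' s"
proof -
  have *: "mcomp Y cofactor_sum M b a = (\<Sum>f\<in>tuples r Y. \<Sum>j<r. \<Sum>g\<in>{g \<in> tuples r X. g j = a}.
      det (T f g) * det (T f (g(j := b))))" for a b
  proof -
    have "mcomp Y cofactor_sum M b a = (\<Sum>f\<in>tuples r Y. \<Sum>g\<in>tuples r X. \<Sum>j<r.
        if g j = a then det (T f g) * det (T f (g(j := b))) else 0)"
      unfolding cofactor_sum_after_M sum_distrib_left by (intro sum.cong; simp)
    also have "\<dots> = (\<Sum>f\<in>tuples r Y. \<Sum>j<r. \<Sum>g\<in>tuples r X.
        if g j = a then det (T f g) * det (T f (g(j := b))) else 0)"
      by (rule sum.cong[OF refl], rule sum.swap)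
    finally show ?thesis
      using finite_X by (simp add: sum.If_cases Collect_conj_eq[symmetric] Int_def)
  qed
  show ?thesis unfolding *
    by (intro sum.cong refl sum.reindex_bij_witness[of _ "\<lambda>f. f(_ := s')" "\<lambda>f. f(_ := s)"])
      (use assms in \<open>auto simp: tuples_upd\<close>)
qed

text \<open>By Cramer's rule the minors with one column replaced by \<open>s\<close>, divided by
  \<open>det (T f g)\<close>, are the coordinates of column \<open>s\<close> with respect to the
  columns \<open>g\<close>, and these span the image whenever \<open>det (T f g) \<noteq> 0\<close>.
  So every pair of tuples contributes \<open>(det (T f g))\<^sup>2 * M s t\<close>.\<close>

lemma M_after_cofactor_sum_after_M:
  assumes s: "s \<in> X" and t: "t \<in> Y"
  shows "mcomp X M (mcomp Y cofactor_sum M) s t = Delta * M s t"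
proof -
  have "mcomp X M (mcomp Y cofactor_sum M) s t = (\<Sum>s'\<in>X. (\<Sum>f\<in>tuples r Y. \<Sum>g\<in>tuples r X. det (T f g) *
    (\<Sum>j<r. if g j = s' then det (T f (g(j := s))) * M s' t else 0)))"
    unfolding mcomp_def[of X] cofactor_sum_after_M sum_distrib_right mult.assoc
    by (intro sum.cong refl arg_cong2[of _ _ _ _ "(*)"]) auto
  also have "\<dots> = (\<Sum>f\<in>tuples r Y. \<Sum>g\<in>tuples r X. det (T f g) *
     (\<Sum>j<r. \<Sum>s'\<in>X. if g j = s' then det (T f (g(j := s))) * M s' t else 0))"
    by (subst sum.swap, rule sum.cong[OF refl], subst sum.swap, rule sum.cong[OF refl],
        subst sum_distrib_left[symmetric], subst sum.swap) (rule refl)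
  also have "\<dots> = (\<Sum>f\<in>tuples r Y. \<Sum>g\<in>tuples r X. (det (T f g))\<^sup>2 * M s t)"
  proof (intro sum.cong refl)
    fix f g assume f: "f \<in> tuples r Y" and g: "g \<in> tuples r X"
    have "(\<Sum>j<r. \<Sum>s'\<in>X. if g j = s' then det (T f (g(j := s))) * M s' t else 0) =
        (\<Sum>j<r. det (T f (g(j := s))) * M (g j) t)"
    proof (rule sum.cong[OF refl])
      fix j assume "j \<in> {..<r}"
      then have "g j \<in> X" using tuples_mem[OF g] by simp
      then show "(\<Sum>s'\<in>X. if g j = s' then det (T f (g(j := s))) * M s' t else 0) =
          det (T f (g(j := s))) * M (g j) t"
        using finite_X by (simp add: sum.delta')
    qed
    moreover have "(\<Sum>j<r. det (T f (g(j := s))) * M (g j) t) = det (T f g) * M s t"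
      if nz: "det (T f g) \<noteq> 0"
    proof -
      obtain c where c: "\<And>t. t \<in> Y \<Longrightarrow> M s t = (\<Sum>j<r. c j * M (g j) t)"
        using columns_span_image[OF f g nz s] by blast
      have "det (T f (g(j := s))) = c j * det (T f g)" if "j < r" for j
      proof -
        have "det (T f (g(j := s))) = (\<Sum>i<r. M s (f i) * cofactor (T f g) i j)"
          using that by (simp add: tmat_column_expansion)
        also have "\<dots> = (\<Sum>i<r. \<Sum>k<r. c k * (T f g $$ (i, k) * cofactor (T f g) i j))"
          using c tuples_mem[OF f] by (intro sum.cong refl) (simp add: sum_distrib_right mult.assoc)
        also have "\<dots> = (\<Sum>k<r. c k * (\<Sum>i<r. T f g $$ (i, k) * cofactor (T f g) i j))"
          by (subst sum.swap) (simp add: sum_distrib_left)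
        also have "\<dots> = (\<Sum>k<r. c k * (if k = j then det (T f g) else 0))"
          using that by (intro sum.cong refl arg_cong2[of _ _ _ _ "(*)"] cofactor_orthogonality) auto
        finally show ?thesis using that by (simp add: if_distrib cong: if_cong)
      qed
      then have "(\<Sum>j<r. det (T f (g(j := s))) * M (g j) t) = (\<Sum>j<r. det (T f g) * (c j * M (g j) t))"
        by (intro sum.cong) auto
      then show ?thesis using c[OF t] by (simp add: sum_distrib_left)
    qed
    ultimately show "det (T f g) * (\<Sum>j<r. \<Sum>s'\<in>X. if g j = s' then det (T f (g(j := s))) * M s' t else 0) =
      (det (T f g))\<^sup>2 * M s t"
      by (cases "det (T f g) = 0") (simp_all add: power2_eq_square)
  qed
  also have "\<dots> = Delta * M s t" by (simp add: Delta_def sum_distrib_right)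
  finally show ?thesis .
qed

text \<open>The expansion along column \<open>j\<close> is a minor in which \<open>y\<close>
  replaces this column, and \<open>y\<close> is orthogonal to all columns of \<open>M\<close>, so
  \<open>sum_det_mult_det_eq_0\<close> applies to the sum over the row tuples.\<close>

lemma cofactor_sum_kills_cokernel:
  assumes y: "\<And>s. s \<in> X \<Longrightarrow> (\<Sum>t\<in>Y. M s t * y t) = 0"
  shows "(\<Sum>t\<in>Y. y t * cofactor_sum t s) = 0"
proof -
  let ?V = "\<lambda>g j k t. if k = j then y t else M (g k) t"
  have "(\<Sum>t\<in>Y. y t * cofactor_sum t s) = (\<Sum>g\<in>tuples r X. \<Sum>f\<in>tuples r Y. \<Sum>j<r.
      det (T f g) * (if g j = s then \<Sum>i<r. y (f i) * cofactor (T f g) i j else 0))"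
    unfolding sum_mult_cofactor_sum sum_distrib_left by (rule sum.swap)
  also have "\<dots> = (\<Sum>g\<in>tuples r X. \<Sum>f\<in>tuples r Y. \<Sum>j<r. if g j = s then
      det (mat r r (\<lambda>(i, k). M (g k) (f i))) * det (mat r r (\<lambda>(i, k). ?V g j k (f i))) else 0)"
  proof (intro sum.cong refl)
    fix f g j assume "j \<in> {..<r}"
    then have "(\<Sum>i<r. y (f i) * cofactor (T f g) i j) = det (mat r r (\<lambda>(i, k). ?V g j k (f i)))"
      by (subst cofactor_column_expansion[where r = r])
        (auto intro!: arg_cong[of _ _ det] eq_matI)
    then show "det (T f g) * (if g j = s then \<Sum>i<r. y (f i) * cofactor (T f g) i j else 0) =
       (if g j = s then det (mat r r (\<lambda>(i, k). M (g k) (f i))) * det (mat r r (\<lambda>(i, k). ?V g j k (f i))) else 0)"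
      by (simp add: tmat_def)
  qed
  also have "\<dots> = (\<Sum>g\<in>tuples r X. \<Sum>j<r. if g j = s then (\<Sum>f\<in>tuples r Y.
      det (mat r r (\<lambda>(i, k). M (g k) (f i))) * det (mat r r (\<lambda>(i, k). ?V g j k (f i)))) else 0)"
    by (rule sum.cong[OF refl], subst sum.swap) (intro sum.cong; simp)
  also have "\<dots> = 0"
  proof (intro sum.neutral ballI)
    fix g j assume g: "g \<in> tuples r X" and j: "j \<in> {..<r}"
    have "(\<Sum>f\<in>tuples r Y. det (mat r r (\<lambda>(i, k). M (g k) (f i))) *
        det (mat r r (\<lambda>(i, k). ?V g j k (f i)))) = 0"
      by (rule sum_det_mult_det_eq_0[where j = j and U = "\<lambda>k. M (g k)" and V = "?V g j"])
        (use finite_Y j y tuples_mem[OF g] in auto)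
    then show "(if g j = s then (\<Sum>f\<in>tuples r Y. det (mat r r (\<lambda>(i, k). M (g k) (f i))) *
        det (mat r r (\<lambda>(i, k). ?V g j k (f i)))) else 0) = 0" by simp
  qed
  finally show ?thesis .
qed

end

text \<open>Without this condition the squares of minors in \<open>Delta\<close> could cancel, and
  symmetry would not amount to the Hermitian conditions of Penrose.\<close>

locale real_finite_matrix = finite_matrix +
  assumes real: "\<And>s t. s \<in> X \<Longrightarrow> t \<in> Y \<Longrightarrow> cnj (M s t) = M s t"
begin

lemma cnj_minor: "f \<in> tuples r Y \<Longrightarrow> g \<in> tuples r X \<Longrightarrow> cnj (det (T f g)) = det (T f g)"
  by (rule det_cnj[of _ r]) (auto intro: real dest: tuples_mem)

lemma minor_square:
  assumes "f \<in> tuples r Y" "g \<in> tuples r X"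
  shows "(det (T f g))\<^sup>2 = of_real ((Re (det (T f g)))\<^sup>2)"
proof -
  have "det (T f g) \<in> \<real>" using cnj_minor[OF assms] by (simp add: Reals_cnj_iff)
  then show ?thesis by (metis of_real_Re of_real_power)
qed

lemma Delta_eq: "Delta = of_real (\<Sum>f\<in>tuples r Y. \<Sum>g\<in>tuples r X. (Re (det (T f g)))\<^sup>2)"
  unfolding Delta_def of_real_sum by (intro sum.cong refl minor_square)

lemma Delta_nonzero: "Delta \<noteq> 0"
proof -
  obtain f g where fg: "f \<in> tuples r Y" "g \<in> tuples r X" "det (T f g) \<noteq> 0"
    using exists_rank_minor by blast
  have "0 < (Re (det (T f g)))\<^sup>2"
    using fg minor_square[OF fg(1,2)] by fastforce
  also have "\<dots> \<le> (\<Sum>g\<in>tuples r X. (Re (det (T f g)))\<^sup>2)"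
    using fg finite_X by (intro member_le_sum) auto
  also have "\<dots> \<le> (\<Sum>f\<in>tuples r Y. \<Sum>g\<in>tuples r X. (Re (det (T f g)))\<^sup>2)"
    using fg finite_Y by (intro member_le_sum[where f = "\<lambda>f. \<Sum>g\<in>tuples r X. (Re (det (T f g)))\<^sup>2"] sum_nonneg) auto
  finally show ?thesis unfolding Delta_eq by (metis less_irrefl of_real_eq_0_iff)
qed

lemma cofactor_mean_moore_penrose: "is_moore_penrose X Y M cofactor_mean"
proof -
  have MP: "mcomp X M cofactor_mean t t' = mcomp X M cofactor_sum t t' / Delta" for t t'
    by (simp add: mcomp_def cofactor_mean_def sum_divide_distrib)
  have PM: "mcomp Y cofactor_mean M s s' = mcomp Y cofactor_sum M s s' / Delta" for s s'
    by (simp add: mcomp_def cofactor_mean_def sum_divide_distrib)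
  have cD: "cnj Delta = Delta" by (simp add: Delta_eq)
  have MPM: "mcomp X M (mcomp Y cofactor_mean M) s t = M s t" if "s \<in> X" "t \<in> Y" for s t
  proof -
    have "mcomp X M (mcomp Y cofactor_mean M) s t = mcomp X M (mcomp Y cofactor_sum M) s t / Delta"
      by (simp add: mcomp_def[of X] PM sum_divide_distrib)
    then show ?thesis using M_after_cofactor_sum_after_M[OF that] Delta_nonzero by simp
  qed
  show ?thesis
    unfolding is_moore_penrose_def
  proof (intro conjI allI ballI impI)
    fix t s assume nz: "cofactor_mean t s \<noteq> 0"
    show "t \<in> Y"
    proof (rule ccontr)
      assume "t \<notin> Y"
      then have "cofactor_sum t s = 0"
        unfolding cofactor_sum_def by (intro sum.neutral ballI) (auto dest: tuples_mem intro!: sum.neutral)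
      then show False using nz by (simp add: cofactor_mean_def)
    qed
    show "s \<in> X"
    proof (rule ccontr)
      assume "s \<notin> X"
      then have "cofactor_sum t s = 0"
        unfolding cofactor_sum_def by (intro sum.neutral ballI) (auto dest: tuples_mem intro!: sum.neutral)
      then show False using nz by (simp add: cofactor_mean_def)
    qed
  next
    fix s t assume "s \<in> X" "t \<in> Y"
    then show "mcomp X M (mcomp Y cofactor_mean M) s t = M s t" by (rule MPM)
  next
    fix t t' assume t: "t \<in> Y" "t' \<in> Y"
    have "cnj (mcomp X M cofactor_sum t' t) = mcomp X M cofactor_sum t' t"
      unfolding M_after_cofactor_sum cnj_sum
      by (intro sum.cong refl) (use t in \<open>auto simp: cnj_minor tuples_upd intro!: sum.cong\<close>)
    then show "mcomp X M cofactor_mean t t' = cnj (mcomp X M cofactor_mean t' t)"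
      using M_after_cofactor_sum_symmetric[OF t] by (simp add: MP cD)
  next
    fix s s' assume s: "s \<in> X" "s' \<in> X"
    have "cnj (mcomp Y cofactor_sum M s' s) = mcomp Y cofactor_sum M s' s"
      unfolding cofactor_sum_after_M cnj_sum
      by (intro sum.cong refl) (use s in \<open>auto simp: cnj_minor tuples_upd intro!: sum.cong\<close>)
    then show "mcomp Y cofactor_mean M s s' = cnj (mcomp Y cofactor_mean M s' s)"
      using cofactor_sum_after_M_symmetric[OF s] by (simp add: PM cD)
  next
    fix t s assume t: "t \<in> Y" and s: "s \<in> X"
    \<comment> \<open>The deviation of \<open>M P\<close> from the identity at \<open>t\<close>; it is
      orthogonal to the columns of \<open>M\<close> because \<open>M P M = M\<close> and \<open>M
      P\<close> is symmetric.\<close>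
    define y where "y z = mcomp X M cofactor_mean t z - (if z = t then 1 else 0)" for z
    have "(\<Sum>z\<in>Y. M s' z * y z) = 0" if s': "s' \<in> X" for s'
    proof -
      have "(\<Sum>z\<in>Y. M s' z * y z) = (\<Sum>z\<in>Y. M s' z * mcomp X M cofactor_mean z t) - (\<Sum>z\<in>Y. if z = t then M s' z else 0)"
        unfolding sum_subtractf[symmetric] y_def
        using M_after_cofactor_sum_symmetric[OF t] by (intro sum.cong) (auto simp: MP algebra_simps)
      also have "(\<Sum>z\<in>Y. M s' z * mcomp X M cofactor_mean z t) = mcomp Y (mcomp X M cofactor_mean) M s' t"
        by (simp add: mcomp_def[of Y])
      also have "\<dots> = M s' t" using MPM[OF s' t] by (simp add: mcomp_assoc)
      finally show ?thesis using t finite_Y by (simp add: sum.delta)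
    qed
    then have "0 = (\<Sum>z\<in>Y. y z * cofactor_sum z s) / Delta" by (simp add: cofactor_sum_kills_cokernel)
    also have "\<dots> = (\<Sum>z\<in>Y. y z * cofactor_mean z s)" by (simp add: cofactor_mean_def sum_divide_distrib)
    also have "\<dots> = mcomp Y cofactor_mean (mcomp X M cofactor_mean) t s - (\<Sum>z\<in>Y. if z = t then cofactor_mean z s else 0)"
      unfolding sum_subtractf[symmetric] mcomp_def[of Y] y_def
      by (intro sum.cong) (auto simp: algebra_simps)
    finally show "mcomp Y cofactor_mean (mcomp X M cofactor_mean) t s = cofactor_mean t s" using t finite_Y by (simp add: sum.delta)
  qed
qed

end

section \<open>From tuples to hedges\<close>

lemma det_tmat_eq_0_row:
  assumes "\<not> inj_on f {..<r}"
  shows "det (tmat r M f g) = 0"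
proof -
  obtain a b where ab: "a < r" "b < r" "a \<noteq> b" "f a = f b" using assms by (auto simp: inj_on_def)
  show ?thesis
    by (rule det_identical_rows[OF tmat_carrier ab(3,1,2)])
      (use ab in \<open>auto simp: tmat_def intro!: eq_vecI\<close>)
qed

lemma det_tmat_eq_0_column:
  assumes "\<not> inj_on g {..<r}"
  shows "det (tmat r M f g) = 0"
proof -
  obtain a b where ab: "a < r" "b < r" "a \<noteq> b" "g a = g b" using assms by (auto simp: inj_on_def)
  show ?thesis
    by (rule det_identical_columns[OF tmat_carrier ab(3,1,2)])
      (use ab in \<open>auto simp: tmat_def intro!: eq_vecI\<close>)
qed

lemma tmat_transpose: "transpose_mat (tmat r M f g) = tmat r (\<lambda>s t. M t s) g f"
  by (auto simp: tmat_def intro!: eq_matI)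

lemma cofactor_transpose:
  assumes "A \<in> carrier_mat r r" "i < r" "j < r"
  shows "cofactor (transpose_mat A) j i = cofactor A i j"
proof -
  have "mat_delete (transpose_mat A) j i = transpose_mat (mat_delete A i j)"
    using assms by (auto simp: mat_delete_def intro!: eq_matI)
  moreover have "mat_delete A i j \<in> carrier_mat (r - 1) (r - 1)"
    by (rule mat_delete_carrier[OF assms(1)])
  ultimately show ?thesis by (simp add: cofactor_def det_transpose add.commute)
qed

lemma det_tmat_permute_row:
  assumes "p permutes {..<r}"
  shows "det (tmat r M (f \<circ> p) g) = signof p * det (tmat r M f g)"
proof -
  have p: "p permutes {0..<r}" using assms by (simp add: atLeast0LessThan)
  have lt: "p a < r \<longleftrightarrow> a < r" for a using permutes_in_image[OF p, of a] by simp
  have eq: "tmat r M (f \<circ> p) g = mat r r (\<lambda>(i, j). tmat r M f g $$ (p i, j))"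
    by (auto simp: tmat_def lt intro!: eq_matI)
  show ?thesis unfolding eq by (rule det_permute_rows[OF tmat_carrier p])
qed

text \<open>A cofactor is the determinant of the matrix whose row \<open>i\<close> is replaced by
  the unit vector \<open>j\<close>, and determinants are known to change by the sign under a
  permutation of rows.\<close>

lemma cofactor_tmat_permute_row:
  fixes M :: "'x \<Rightarrow> 'y \<Rightarrow> 'a::comm_ring_1"
  assumes "p permutes {..<r}" "i < r" "j < r"
  shows "cofactor (tmat r M (f \<circ> p) g) i j = signof p * cofactor (tmat r M f g) (p i) j"
proof -
  have p: "p permutes {0..<r}" using assms by (simp add: atLeast0LessThan)
  have lt: "p a < r \<longleftrightarrow> a < r" for a using permutes_in_image[OF p, of a] by simp
  have pi: "p i < r" using lt assms(2) by simp
  have pe: "p a = p i \<longleftrightarrow> a = i" for a using permutes_inj[OF p] by (simp add: inj_eq)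
  let ?v = "\<lambda>b. if b = j then 1 else (0::'a)"
  let ?B = "mat r r (\<lambda>(a, b). if a = p i then ?v b else tmat r M f g $$ (a, b))"
  have unit: "(\<Sum>b<r. ?v b * c b) = c j" for c :: "nat \<Rightarrow> 'a"
    using assms(3) by (simp add: if_distribR if_distrib cong: if_cong)
  have "cofactor (tmat r M (f \<circ> p) g) i j =
      det (mat r r (\<lambda>(a, b). if a = i then ?v b else tmat r M (f \<circ> p) g $$ (a, b)))"
    using cofactor_row_expansion[OF tmat_carrier assms(2), where v = ?v] by (simp only: unit)
  also have "mat r r (\<lambda>(a, b). if a = i then ?v b else tmat r M (f \<circ> p) g $$ (a, b)) =
      mat r r (\<lambda>(a, b). ?B $$ (p a, b))"
    by (auto simp: lt pe intro!: eq_matI)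
  also have "det \<dots> = signof p * det ?B"
    by (rule det_permute_rows[OF _ p]) simp
  also have "det ?B = cofactor (tmat r M f g) (p i) j"
    using cofactor_row_expansion[OF tmat_carrier[of r M f g] pi, where v = ?v] by (simp only: unit)
  finally show ?thesis .
qed

lemma det_tmat_permute_column:
  assumes "p permutes {..<r}"
  shows "det (tmat r M f (g \<circ> p)) = signof p * det (tmat r M f g)"
  unfolding det_transpose[OF tmat_carrier, of r M, symmetric] tmat_transpose
  by (rule det_tmat_permute_row[OF assms])

lemma cofactor_tmat_permute_column:
  assumes "p permutes {..<r}" "i < r" "j < r"
  shows "cofactor (tmat r M f (g \<circ> p)) i j = signof p * cofactor (tmat r M f g) i (p j)"
proof -
  have "p j < r" using permutes_in_image[OF assms(1), of j] assms(3) by simp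
  then show ?thesis
    using cofactor_tmat_permute_row[OF assms(1,3,2), of "\<lambda>s t. M t s" g f]
      cofactor_transpose[OF tmat_carrier assms(2,3), of M f "g \<circ> p"]
      cofactor_transpose[OF tmat_carrier assms(2) \<open>p j < r\<close>, of M f g]
    by (simp only: tmat_transpose)
qed

lemma in_order_props:
  assumes "distinct cs" "A \<subseteq> set cs"
  shows "distinct (in_order cs A)" "set (in_order cs A) = A" "length (in_order cs A) = card A"
proof -
  show 1: "distinct (in_order cs A)" using assms by (simp add: in_order_def)
  show 2: "set (in_order cs A) = A" using assms by (auto simp: in_order_def)
  show "length (in_order cs A) = card A" using distinct_card[OF 1] 2 by simp
qed

lemma bij_betw_in_order:
  assumes "distinct cs" "A \<subseteq> set cs"
  shows "bij_betw ((!) (in_order cs A)) {..<card A} A"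
  using in_order_props[OF assms] bij_betw_nth[of "in_order cs A" "{..<card A}" A] by simp

text \<open>A tuple without repetitions is the ordered list of its entries, permuted in a unique
  way, so that every set of size \<open>r\<close> comes from \<open>r!\<close> tuples.\<close>

lemma sum_tuples_eq_sum_subsets:
  fixes F :: "(nat \<Rightarrow> 's) \<Rightarrow> 'a::comm_semiring_1"
  assumes cs: "distinct cs" "Y \<subseteq> set cs"
    and cong: "\<And>f f'. (\<And>i. i < r \<Longrightarrow> f i = f' i) \<Longrightarrow> F f = F f'"
    and zero: "\<And>f. \<not> inj_on f {..<r} \<Longrightarrow> F f = 0"
    and perm: "\<And>f p. p permutes {..<r} \<Longrightarrow> F (f \<circ> p) = F f"
  shows "(\<Sum>f\<in>tuples r Y. F f) = of_nat (fact r) * (\<Sum>A | A \<subseteq> Y \<and> card A = r. F ((!) (in_order cs A)))"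
proof -
  let ?S = "{A. A \<subseteq> Y \<and> card A = r}" and ?P = "{p. p permutes {..<r}}"
  let ?e = "\<lambda>A. (!) (in_order cs A)"
  have finY: "finite Y" using cs(2) finite_subset by blast
  have e: "bij_betw (?e A) {..<r} A" if "A \<in> ?S" for A
    using bij_betw_in_order[OF cs(1), of A] that cs(2) by auto
  have "(\<Sum>f\<in>tuples r Y. F f) = (\<Sum>f\<in>{f \<in> tuples r Y. inj_on f {..<r}}. F f)"
    using finY zero by (intro sum.mono_neutral_right) auto
  also have "\<dots> = (\<Sum>(A, p)\<in>?S \<times> ?P. F (?e A))"
  proof (rule sum.reindex_bij_witness[where
        i = "\<lambda>(A, p). restrict (?e A \<circ> p) {..<r}" and
        j = "\<lambda>f. (f ` {..<r}, \<lambda>i. if i < r then inv_into {..<r} (?e (f ` {..<r})) (f i) else i)"])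
    fix f assume "f \<in> {f \<in> tuples r Y. inj_on f {..<r}}"
    then have f: "f \<in> tuples r Y" "inj_on f {..<r}" by auto
    define A where "A = f ` {..<r}"
    define p where "p = (\<lambda>i. if i < r then inv_into {..<r} (?e A) (f i) else i)"
    have A: "A \<in> ?S" using f tuples_mem[OF f(1)] by (auto simp: A_def card_image)
    note eA = e[OF A]
    have bij: "bij_betw (\<lambda>i. inv_into {..<r} (?e A) (f i)) {..<r} {..<r}"
      using bij_betw_trans[OF inj_on_imp_bij_betw[OF f(2), folded A_def] bij_betw_inv_into[OF eA]]
      by (simp add: comp_def)
    have p: "p permutes {..<r}"
    proof (rule bij_imp_permutes)
      show "bij_betw p {..<r} {..<r}"
        using bij by (subst bij_betw_cong[where g = "\<lambda>i. inv_into {..<r} (?e A) (f i)"]) (auto simp: p_def)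
    qed (simp add: p_def)
    have ep: "?e A (p i) = f i" if "i < r" for i
      using that eA by (auto simp: p_def A_def bij_betw_def f_inv_into_f)
    have "restrict (?e A \<circ> p) {..<r} = f"
      using f(1) ep by (auto simp: tuples_def PiE_def extensional_def fun_eq_iff)
    then show "(case (f ` {..<r}, \<lambda>i. if i < r then inv_into {..<r} (?e (f ` {..<r})) (f i) else i) of
        (A, p) \<Rightarrow> restrict (?e A \<circ> p) {..<r}) = f"
      unfolding A_def[symmetric] p_def[symmetric] prod.case .
    show "(f ` {..<r}, \<lambda>i. if i < r then inv_into {..<r} (?e (f ` {..<r})) (f i) else i) \<in> ?S \<times> ?P"
      unfolding A_def[symmetric] p_def[symmetric] using A p by blast
    have "F f = F (?e A \<circ> p)" using ep by (intro cong) simp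
    also have "\<dots> = F (?e A)" by (rule perm[OF p])
    finally show "(case (f ` {..<r}, \<lambda>i. if i < r then inv_into {..<r} (?e (f ` {..<r})) (f i) else i) of
        (A, p) \<Rightarrow> F (?e A)) = F f"
      by (simp add: A_def)
  next
    fix b assume "b \<in> ?S \<times> ?P"
    then obtain A p where b: "b = (A, p)" and A: "A \<in> ?S" and p: "p permutes {..<r}" by auto
    note eA = e[OF A]
    let ?f = "restrict (?e A \<circ> p) {..<r}"
    have lt: "p i < r \<longleftrightarrow> i < r" for i using permutes_in_image[OF p, of i] by simp
    have bij: "bij_betw ?f {..<r} A"
      using bij_betw_trans[OF permutes_imp_bij[OF p] eA]
      by (subst bij_betw_cong[where g = "?e A \<circ> p"]) auto
    have img: "?f ` {..<r} = A" using bij by (rule bij_betw_imp_surj_on)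
    have q: "(\<lambda>i. if i < r then inv_into {..<r} (?e A) (?f i) else i) = p"
    proof
      fix i show "(if i < r then inv_into {..<r} (?e A) (?f i) else i) = p i"
      proof (cases "i < r")
        case True
        then show ?thesis using eA lt by (simp add: bij_betw_def)
      next
        case False
        then show ?thesis using permutes_not_in[OF p, of i] by simp
      qed
    qed
    show "(\<lambda>f. (f ` {..<r}, \<lambda>i. if i < r then inv_into {..<r} (?e (f ` {..<r})) (f i) else i))
        (case b of (A, p) \<Rightarrow> restrict (?e A \<circ> p) {..<r}) = b"
      unfolding b prod.case img q by (rule refl)
    show "(case b of (A, p) \<Rightarrow> restrict (?e A \<circ> p) {..<r}) \<in> {f \<in> tuples r Y. inj_on f {..<r}}"
      using bij A unfolding b by (auto simp: tuples_def bij_betw_def)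
  qed
  also have "\<dots> = (\<Sum>A\<in>?S. of_nat (fact r) * F (?e A))"
    by (simp add: sum.cartesian_product[symmetric] card_permutations[of "{..<r}" r])
  finally show ?thesis by (simp add: sum_distrib_left)
qed

lemma pos_props:
  assumes "distinct cs" "A \<subseteq> set cs" "t \<in> A"
  shows "pos cs A t < card A" and "in_order cs A ! pos cs A t = t"
    and "i < card A \<Longrightarrow> in_order cs A ! i = t \<longleftrightarrow> i = pos cs A t"
proof -
  note io = in_order_props[OF assms(1,2)]
  have ex1: "\<exists>!i. i < length (in_order cs A) \<and> in_order cs A ! i = t"
    using io assms(3) by (metis in_set_conv_nth nth_eq_iff_index_eq)
  from theI'[OF ex1] show 1: "pos cs A t < card A" "in_order cs A ! pos cs A t = t"
    by (simp_all add: pos_def io)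
  show "i < card A \<Longrightarrow> in_order cs A ! i = t \<longleftrightarrow> i = pos cs A t"
    using 1 io by (metis nth_eq_iff_index_eq)
qed

lemma in_order_remove_nth:
  assumes "distinct cs" "A \<subseteq> set cs" "t \<in> A" "i < card A - 1"
  shows "in_order cs (A - {t}) ! i = in_order cs A ! (if i < pos cs A t then i else Suc i)"
proof -
  let ?xs = "in_order cs A" and ?k = "pos cs A t"
  note io = in_order_props[OF assms(1,2)] and k = pos_props[OF assms(1-3)]
  have klen: "?k < length ?xs" using io k by simp
  have split: "?xs = take ?k ?xs @ t # drop (Suc ?k) ?xs"
    using id_take_nth_drop[OF klen] k(2) by simp
  have "in_order cs (A - {t}) = filter (\<lambda>s. s \<noteq> t) ?xs"
    by (auto simp: in_order_def intro!: filter_cong)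
  also have "\<dots> = take ?k ?xs @ drop (Suc ?k) ?xs"
  proof -
    have "t \<notin> set (take ?k ?xs @ drop (Suc ?k) ?xs)"
      using io(1) by (subst (asm) split) auto
    moreover have "filter (\<lambda>s. s \<noteq> t) ys = ys" if "t \<notin> set ys" for ys
      using that by (induction ys) auto
    ultimately have "filter (\<lambda>s. s \<noteq> t) (take ?k ?xs @ t # drop (Suc ?k) ?xs) = take ?k ?xs @ drop (Suc ?k) ?xs"
      by simp
    then show ?thesis using split by simp
  qed
  finally show ?thesis using klen assms(4) io(3) by (auto simp: nth_append)
qed

lemma minor_eq_det_tmat:
  "card A = n \<Longrightarrow> card B = n \<Longrightarrow>
    minor cs M A B = det (tmat n M ((!) (in_order cs A)) ((!) (in_order cs B)))"
  by (simp add: minor_def tmat_def)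

text \<open>Deleting the row and column at the positions of \<open>t\<close> and \<open>s\<close> is
  the same as deleting \<open>t\<close> and \<open>s\<close> from the index sets.\<close>

lemma cofactor_in_order:
  assumes cs: "distinct cs" and A: "A \<subseteq> set cs" "card A = n" "t \<in> A"
    and B: "B \<subseteq> set cs" "card B = n" "s \<in> B"
  shows "cofactor (tmat n M ((!) (in_order cs A)) ((!) (in_order cs B))) (pos cs A t) (pos cs B s) =
    (- 1) ^ (pos cs B s + pos cs A t) * minor cs M (A - {t}) (B - {s})"
proof -
  have c: "card (A - {t}) = n - 1" "card (B - {s}) = n - 1" using A B by simp_all
  have "mat_delete (tmat n M ((!) (in_order cs A)) ((!) (in_order cs B))) (pos cs A t) (pos cs B s) =
      tmat (n - 1) M ((!) (in_order cs (A - {t}))) ((!) (in_order cs (B - {s})))"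
    using in_order_remove_nth[OF cs A(1,3)] in_order_remove_nth[OF cs B(1,3)] A(2) B(2)
    by (auto simp: mat_delete_def tmat_def intro!: eq_matI)
  then show ?thesis by (simp add: cofactor_def minor_eq_det_tmat[OF c] add.commute)
qed

context finite_matrix
begin

lemma linmap_coord_space:
  assumes g: "bij_betw g {..<r} B" and B: "B \<subseteq> X" and v: "v \<in> coord_space B" and t: "t \<in> Y"
  shows "linmap X Y M v t = (\<Sum>j<r. v (g j) * M (g j) t)"
proof -
  have "linmap X Y M v t = (\<Sum>s\<in>B. v s * M s t)"
    using v t B finite_X unfolding linmap_def coord_space_def
    by (simp, intro sum.mono_neutral_right) auto
  then show ?thesis using sum.reindex_bij_betw[OF g, of "\<lambda>s. v s * M s t"] by simp
qed

text \<open>The columns \<open>B\<close> form a basis of the image of \<open>M\<close>, which gives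
  the first bijection. In terms of this basis the projection to the coordinates \<open>A\<close> has
  the matrix \<open>T f g\<close>, and the adjugate solves for a given projection.\<close>

lemma hedge_of_nonzero_minor:
  assumes A: "A \<subseteq> Y" "card A = r" and B: "B \<subseteq> X" "card B = r"
    and f: "bij_betw f {..<r} A" and g: "bij_betw g {..<r} B" and nz: "det (T f g) \<noteq> 0"
  shows "(A, B) \<in> hedges X Y M"
proof -
  let ?L = "linmap X Y M" and ?R = "\<lambda>w s. if s \<in> A then w s else (0::complex)"
  have fA: "f i \<in> A" if "i < r" for i using bij_betwE[OF f] that by auto
  have gB: "g i \<in> B" if "i < r" for i using bij_betwE[OF g] that by auto
  define f' g' where "f' = restrict f {..<r}" and "g' = restrict g {..<r}"
  have f'g': "f' \<in> tuples r Y" "g' \<in> tuples r X" "T f' g' = T f g"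
    using fA gB A B by (auto simp: f'_def g'_def tuples_def intro!: tmat_cong)
  have inA: "v = v'" if v: "v \<in> coord_space B" "v' \<in> coord_space B"
    and eq: "\<And>t. t \<in> A \<Longrightarrow> ?L v t = ?L v' t" for v v'
  proof
    fix s
    have z: "v (g k) - v' (g k) = 0" if "k < r" for k
    proof (rule minor_nonzero_independent[OF nz _ that])
      fix i assume "i < r"
      then have "f i \<in> A" "f i \<in> Y" using fA A(1) by auto
      have "(\<Sum>j<r. (v (g j) - v' (g j)) * M (g j) (f i)) = ?L v (f i) - ?L v' (f i)"
        using linmap_coord_space[OF g B(1) _ \<open>f i \<in> Y\<close>] v
        by (simp add: left_diff_distrib sum_subtractf)
      then show "(\<Sum>j<r. (v (g j) - v' (g j)) * M (g j) (f i)) = 0" using eq[OF \<open>f i \<in> A\<close>] by simp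
    qed
    show "v s = v' s"
    proof (cases "s \<in> B")
      case True
      then obtain k where "k < r" "s = g k" using bij_betw_imp_surj_on[OF g] by blast
      then show ?thesis using z by simp
    next
      case False
      then show ?thesis using v by (simp add: coord_space_def)
    qed
  qed
  have coords: "\<exists>v\<in>coord_space B. \<forall>j<r. v (g j) = c j" for c
  proof
    show "(\<lambda>s. if s \<in> B then c (inv_into {..<r} g s) else 0) \<in> coord_space B"
      by (simp add: coord_space_def)
    show "\<forall>j<r. (if g j \<in> B then c (inv_into {..<r} g (g j)) else 0) = c j"
      using gB g by (auto simp: bij_betw_def)
  qed
  have im: "?L ` coord_space B = image_space X Y M"
  proof
    show "?L ` coord_space B \<subseteq> image_space X Y M"
      using B(1) unfolding image_space_def by (intro image_mono) (auto simp: coord_space_def)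
    show "image_space X Y M \<subseteq> ?L ` coord_space B"
    proof
      fix w assume "w \<in> image_space X Y M"
      then obtain v where v: "v \<in> coord_space X" "w = ?L v" by (auto simp: image_space_def)
      have "\<exists>c. \<forall>t\<in>Y. M s t = (\<Sum>j<r. c j * M (g j) t)" if s: "s \<in> X" for s
      proof -
        have nz': "det (T f' g') \<noteq> 0" using nz f'g' by simp
        obtain c where "\<And>t. t \<in> Y \<Longrightarrow> M s t = (\<Sum>j<r. c j * M (g' j) t)"
          using columns_span_image[OF f'g'(1,2) nz' s] by blast
        then show ?thesis by (intro exI[of _ c]) (simp add: g'_def)
      qed
      then obtain c where c: "\<And>s t. s \<in> X \<Longrightarrow> t \<in> Y \<Longrightarrow> M s t = (\<Sum>j<r. c s j * M (g j) t)"
        by metis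
      obtain u where u: "u \<in> coord_space B" "\<forall>j<r. u (g j) = (\<Sum>s\<in>X. v s * c s j)"
        using coords[of "\<lambda>j. \<Sum>s\<in>X. v s * c s j"] by blast
      have "w t = ?L u t" for t
      proof (cases "t \<in> Y")
        case True
        have "w t = (\<Sum>s\<in>X. \<Sum>j<r. v s * c s j * M (g j) t)"
          using True c by (simp add: v linmap_def sum_distrib_left mult.assoc)
        also have "\<dots> = (\<Sum>j<r. u (g j) * M (g j) t)"
          using u(2) by (subst sum.swap) (simp add: sum_distrib_right)
        finally show ?thesis using linmap_coord_space[OF g B(1) u(1) True] by simp
      qed (simp add: v linmap_def)
      then show "w \<in> ?L ` coord_space B" using u(1) by blast
    qed
  qed
  have "bij_betw ?L (coord_space B) (image_space X Y M)"
    using inA im by (auto simp: bij_betw_def inj_on_def)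
  moreover have "bij_betw ?R (image_space X Y M) (coord_space A)"
    unfolding bij_betw_def
  proof
    show "inj_on ?R (image_space X Y M)"
    proof (rule inj_onI)
      fix w w' assume ww: "w \<in> image_space X Y M" "w' \<in> image_space X Y M" "?R w = ?R w'"
      obtain v v' where v: "v \<in> coord_space B" "v' \<in> coord_space B" "w = ?L v" "w' = ?L v'"
        using ww(1,2) unfolding im[symmetric] by blast
      have "?L v t = ?L v' t" if "t \<in> A" for t
        using fun_cong[OF ww(3), of t] that v by simp
      then show "w = w'" using inA[OF v(1,2)] v by simp
    qed
    show "?R ` image_space X Y M = coord_space A"
    proof
      show "?R ` image_space X Y M \<subseteq> coord_space A" by (auto simp: coord_space_def)
      show "coord_space A \<subseteq> ?R ` image_space X Y M"
      proof
        fix u assume u: "u \<in> coord_space A"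
        obtain v where v: "v \<in> coord_space B"
          "\<forall>j<r. v (g j) = (\<Sum>i<r. u (f i) * cofactor (T f g) i j) / det (T f g)"
          using coords[of "\<lambda>j. (\<Sum>i<r. u (f i) * cofactor (T f g) i j) / det (T f g)"] by blast
        have "?L v (f k) = u (f k)" if k: "k < r" for k
        proof -
          have "f k \<in> Y" using fA[OF k] A by blast
          have "?L v (f k) = (\<Sum>j<r. \<Sum>i<r. u (f i) * (T f g $$ (k, j) * cofactor (T f g) i j)) / det (T f g)"
            using v(2) k unfolding linmap_coord_space[OF g B(1) v(1) \<open>f k \<in> Y\<close>] sum_divide_distrib
            by (intro sum.cong refl) (simp add: sum_distrib_left sum_distrib_right sum_divide_distrib mult_ac)
          also have "\<dots> = (\<Sum>i<r. u (f i) * (\<Sum>j<r. T f g $$ (k, j) * cofactor (T f g) i j)) / det (T f g)"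
            by (subst sum.swap) (simp add: sum_distrib_left)
          also have "\<dots> = (\<Sum>i<r. u (f i) * (if k = i then det (T f g) else 0)) / det (T f g)"
            using k by (intro sum.cong refl arg_cong2[of _ _ _ _ "(*)"] arg_cong2[of _ _ _ _ "(/)"]
                cofactor_orthogonality) auto
          also have "\<dots> = u (f k)" using k nz by (simp add: if_distrib cong: if_cong)
          finally show ?thesis .
        qed
        then have "?L v t = u t" if "t \<in> A" for t
          using that bij_betw_imp_surj_on[OF f] by blast
        then have "u = ?R (?L v)" using u by (auto simp: coord_space_def fun_eq_iff)
        then show "u \<in> ?R ` image_space X Y M" using v(1) unfolding im[symmetric] by blast
      qed
    qed
  qed
  ultimately show ?thesis using A B by (simp add: hedges_def r_def)
qed

end

lemma signof_square: "signof p * (signof p * x) = (x::'a::comm_ring_1)"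
  by (simp add: sign_def)

context finite_matrix
begin

text \<open>As \<open>E\<close> and the minor change by the same sign under permutations of
  \<open>f\<close> or \<open>g\<close>, their product depends only on the sets of rows and
  columns.\<close>

lemma sum_tuples_det_mult:
  assumes cs: "distinct cs" "X \<subseteq> set cs" "Y \<subseteq> set cs"
    and cong: "\<And>f f' g g'. (\<And>i. i < r \<Longrightarrow> f i = f' i) \<Longrightarrow> (\<And>i. i < r \<Longrightarrow> g i = g' i) \<Longrightarrow> E f g = E f' g'"
    and row: "\<And>f g p. p permutes {..<r} \<Longrightarrow> E (f \<circ> p) g = signof p * E f g"
    and col: "\<And>f g p. p permutes {..<r} \<Longrightarrow> E f (g \<circ> p) = signof p * E f g"
  shows "(\<Sum>f\<in>tuples r Y. \<Sum>g\<in>tuples r X. det (T f g) * E f g) = (of_nat (fact r))\<^sup>2 *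
     (\<Sum>(A, B)\<in>{A. A \<subseteq> Y \<and> card A = r} \<times> {B. B \<subseteq> X \<and> card B = r}.
        minor cs M A B * E ((!) (in_order cs A)) ((!) (in_order cs B)))"
proof -
  let ?e = "\<lambda>A. (!) (in_order cs A)" and ?S = "\<lambda>Y. {A. A \<subseteq> Y \<and> card A = r}"
  have "(\<Sum>f\<in>tuples r Y. \<Sum>g\<in>tuples r X. det (T f g) * E f g) =
      of_nat (fact r) * (\<Sum>A\<in>?S Y. \<Sum>g\<in>tuples r X. det (T (?e A) g) * E (?e A) g)"
  proof (rule sum_tuples_eq_sum_subsets[OF cs(1,3)])
    fix f f' :: "nat \<Rightarrow> 's" assume "\<And>i. i < r \<Longrightarrow> f i = f' i"
    then have "T f g = T f' g" "E f g = E f' g" for g by (auto intro!: tmat_cong cong)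
    then show "(\<Sum>g\<in>tuples r X. det (T f g) * E f g) = (\<Sum>g\<in>tuples r X. det (T f' g) * E f' g)" by simp
  next
    fix f :: "nat \<Rightarrow> 's" assume "\<not> inj_on f {..<r}"
    then show "(\<Sum>g\<in>tuples r X. det (T f g) * E f g) = 0" by (simp add: det_tmat_eq_0_row)
  next
    fix f :: "nat \<Rightarrow> 's" and p assume "p permutes {..<r}"
    then show "(\<Sum>g\<in>tuples r X. det (T (f \<circ> p) g) * E (f \<circ> p) g) = (\<Sum>g\<in>tuples r X. det (T f g) * E f g)"
      by (intro sum.cong refl)
        (simp only: det_tmat_permute_row row mult.assoc mult.left_commute[of "det _"] signof_square)
  qed
  also have "\<dots> = of_nat (fact r) * (\<Sum>A\<in>?S Y. of_nat (fact r) * (\<Sum>B\<in>?S X. det (T (?e A) (?e B)) * E (?e A) (?e B)))"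
  proof (rule arg_cong[where f = "(*) _"], rule sum.cong[OF refl], rule sum_tuples_eq_sum_subsets[OF cs(1,2)])
    fix A and g g' :: "nat \<Rightarrow> 's" assume "\<And>i. i < r \<Longrightarrow> g i = g' i"
    then have "T (?e A) g = T (?e A) g'" "E (?e A) g = E (?e A) g'" by (auto intro!: tmat_cong cong)
    then show "det (T (?e A) g) * E (?e A) g = det (T (?e A) g') * E (?e A) g'" by simp
  next
    fix A and g :: "nat \<Rightarrow> 's" assume "\<not> inj_on g {..<r}"
    then show "det (T (?e A) g) * E (?e A) g = 0" by (simp add: det_tmat_eq_0_column)
  next
    fix A and g :: "nat \<Rightarrow> 's" and p assume "p permutes {..<r}"
    then show "det (T (?e A) (g \<circ> p)) * E (?e A) (g \<circ> p) = det (T (?e A) g) * E (?e A) g"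
      by (simp only: det_tmat_permute_column col mult.assoc mult.left_commute[of "det _"] signof_square)
  qed
  also have "\<dots> = (of_nat (fact r))\<^sup>2 * (\<Sum>A\<in>?S Y. \<Sum>B\<in>?S X. minor cs M A B * E (?e A) (?e B))"
    by (simp add: sum_distrib_left[symmetric] power2_eq_square mult.assoc minor_eq_det_tmat)
  finally show ?thesis by (simp add: sum.cartesian_product)
qed

text \<open>Pairs \<open>(A, B)\<close> of size \<open>r\<close> that are not hedges have zero
  minors, so the sums over hedges extend to all such pairs, and the factor
  \<open>(r!)\<^sup>2\<close> between sums over tuples and sums over sets cancels in the
  quotient.\<close>

lemma hedge_formula_eq_cofactor_mean:
  assumes cs: "distinct cs" "X \<subseteq> set cs" "Y \<subseteq> set cs"
  shows "hedge_formula cs X Y M s t = cofactor_mean t s"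
proof -
  let ?e = "\<lambda>A. (!) (in_order cs A)" and ?S = "\<lambda>Y. {A. A \<subseteq> Y \<and> card A = r}"
  let ?m = "minor cs M"
  have fin: "finite (?S Y \<times> ?S X)" using finite_X finite_Y by simp
  have sub: "hedges X Y M \<subseteq> ?S Y \<times> ?S X" by (auto simp: hedges_def r_def)
  have zero: "?m A B = 0" if "A \<in> ?S Y" "B \<in> ?S X" "(A, B) \<notin> hedges X Y M" for A B
  proof (rule ccontr)
    assume "?m A B \<noteq> 0"
    then have "det (T (?e A) (?e B)) \<noteq> 0" using that by (simp add: minor_eq_det_tmat)
    moreover have "bij_betw (?e A) {..<r} A" "bij_betw (?e B) {..<r} B"
      using bij_betw_in_order[OF cs(1), of A] bij_betw_in_order[OF cs(1), of B] that cs by auto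
    ultimately show False using hedge_of_nonzero_minor that by blast
  qed
  have Delta_hedges: "Delta = (of_nat (fact r))\<^sup>2 * (\<Sum>(A, B)\<in>hedges X Y M. (?m A B)\<^sup>2)"
  proof -
    have "Delta = (of_nat (fact r))\<^sup>2 * (\<Sum>(A, B)\<in>?S Y \<times> ?S X. ?m A B * det (T (?e A) (?e B)))"
      unfolding Delta_def power2_eq_square[of "det _"]
      by (rule sum_tuples_det_mult[OF cs arg_cong[of _ _ det, OF tmat_cong]
          det_tmat_permute_row det_tmat_permute_column])
    also have "(\<Sum>(A, B)\<in>?S Y \<times> ?S X. ?m A B * det (T (?e A) (?e B))) =
        (\<Sum>(A, B)\<in>?S Y \<times> ?S X. (?m A B)\<^sup>2)"
      by (intro sum.cong) (auto simp: power2_eq_square minor_eq_det_tmat)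
    also have "\<dots> = (\<Sum>(A, B)\<in>hedges X Y M. (?m A B)\<^sup>2)"
      using zero by (intro sum.mono_neutral_right fin sub) auto
    finally show ?thesis .
  qed
  define E where "E f g = (\<Sum>i<r. \<Sum>j<r. if f i = t \<and> g j = s then cofactor (T f g) i j else 0)" for f g
  have E: "E (?e A) (?e B) = (if t \<in> A \<and> s \<in> B
      then (- 1) ^ (pos cs B s + pos cs A t) * ?m (A - {t}) (B - {s}) else 0)"
    if A: "A \<in> ?S Y" and B: "B \<in> ?S X" for A B
  proof (cases "t \<in> A \<and> s \<in> B")
    case True
    have Ac: "A \<subseteq> set cs" "card A = r" and Bc: "B \<subseteq> set cs" "card B = r" using A B cs by auto
    note pA = pos_props[OF cs(1) Ac(1), of t] and pB = pos_props[OF cs(1) Bc(1), of s]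
    have "E (?e A) (?e B) = (\<Sum>i<r. \<Sum>j<r. if j = pos cs B s then
        (if i = pos cs A t then cofactor (T (?e A) (?e B)) i j else 0) else 0)"
      unfolding E_def using True pA(3) pB(3) Ac(2) Bc(2) by (intro sum.cong refl) auto
    also have "\<dots> = cofactor (T (?e A) (?e B)) (pos cs A t) (pos cs B s)"
      using True pA(1) pB(1) Ac(2) Bc(2) by (simp add: sum.delta)
    also have "\<dots> = (- 1) ^ (pos cs B s + pos cs A t) * ?m (A - {t}) (B - {s})"
      using True by (intro cofactor_in_order cs Ac Bc) auto
    finally show ?thesis using True by simp
  next
    case False
    have "\<not> (?e A i = t \<and> ?e B j = s)" if "i < r" "j < r" for i j
    proof -
      have "?e A i \<in> A" "?e B j \<in> B"
        using that A B cs bij_betwE[OF bij_betw_in_order[OF cs(1), of A]]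
          bij_betwE[OF bij_betw_in_order[OF cs(1), of B]] by auto
      then show ?thesis using False by blast
    qed
    then show ?thesis unfolding E_def if_not_P[OF False] by (intro sum.neutral ballI) auto
  qed
  have "cofactor_sum t s = (\<Sum>f\<in>tuples r Y. \<Sum>g\<in>tuples r X. det (T f g) * E f g)" by (simp add: cofactor_sum_def E_def)
  also have "\<dots> = (of_nat (fact r))\<^sup>2 * (\<Sum>(A, B)\<in>?S Y \<times> ?S X. ?m A B * E (?e A) (?e B))"
  proof (rule sum_tuples_det_mult[OF cs])
    fix f f' g g' :: "nat \<Rightarrow> 's"
    assume eq: "\<And>i. i < r \<Longrightarrow> f i = f' i" "\<And>i. i < r \<Longrightarrow> g i = g' i"
    then have "T f g = T f' g'" by (rule tmat_cong)
    then show "E f g = E f' g'" unfolding E_def using eq by (intro sum.cong refl) auto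
  next
    fix f g :: "nat \<Rightarrow> 's" and p assume p: "p permutes {..<r}"
    have "E (f \<circ> p) g = (\<Sum>i<r. \<Sum>j<r. signof p * (if f (p i) = t \<and> g j = s then cofactor (T f g) (p i) j else 0))"
      unfolding E_def using p by (intro sum.cong refl) (auto simp: cofactor_tmat_permute_row)
    also have "\<dots> = (\<Sum>i<r. \<Sum>j<r. signof p * (if f i = t \<and> g j = s then cofactor (T f g) i j else 0))"
      using sum.permute[OF p, of "\<lambda>i. \<Sum>j<r. signof p * (if f i = t \<and> g j = s then cofactor (T f g) i j else 0)"]
      by (simp add: comp_def)
    finally show "E (f \<circ> p) g = signof p * E f g" by (simp only: E_def sum_distrib_left)
    have "E f (g \<circ> p) = (\<Sum>i<r. \<Sum>j<r. signof p * (if f i = t \<and> g (p j) = s then cofactor (T f g) i (p j) else 0))"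
      unfolding E_def using p by (intro sum.cong refl) (auto simp: cofactor_tmat_permute_column)
    also have "\<dots> = (\<Sum>i<r. \<Sum>j<r. signof p * (if f i = t \<and> g j = s then cofactor (T f g) i j else 0))"
    proof (rule sum.cong[OF refl])
      fix i
      show "(\<Sum>j<r. signof p * (if f i = t \<and> g (p j) = s then cofactor (T f g) i (p j) else 0)) =
          (\<Sum>j<r. signof p * (if f i = t \<and> g j = s then cofactor (T f g) i j else 0))"
        using sum.permute[OF p, of "\<lambda>j. signof p * (if f i = t \<and> g j = s then cofactor (T f g) i j else 0)"]
        by (simp add: comp_def)
    qed
    finally show "E f (g \<circ> p) = signof p * E f g" by (simp only: E_def sum_distrib_left)
  qed
  also have "(\<Sum>(A, B)\<in>?S Y \<times> ?S X. ?m A B * E (?e A) (?e B)) =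
      (\<Sum>(A, B)\<in>{(A, B) \<in> hedges X Y M. t \<in> A \<and> s \<in> B}.
        (- 1) ^ (pos cs B s + pos cs A t) * ?m A B * ?m (A - {t}) (B - {s}))"
  proof (rule sum.mono_neutral_cong_right[OF fin])
    show "{(A, B) \<in> hedges X Y M. t \<in> A \<and> s \<in> B} \<subseteq> ?S Y \<times> ?S X" using sub by blast
    show "\<forall>i\<in>?S Y \<times> ?S X - {(A, B) \<in> hedges X Y M. t \<in> A \<and> s \<in> B}.
        (case i of (A, B) \<Rightarrow> ?m A B * E (?e A) (?e B)) = 0"
    proof (rule ballI)
      fix i assume "i \<in> ?S Y \<times> ?S X - {(A, B) \<in> hedges X Y M. t \<in> A \<and> s \<in> B}"
      then obtain A B where i: "i = (A, B)" "A \<in> ?S Y" "B \<in> ?S X"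
        "(A, B) \<notin> hedges X Y M \<or> \<not> (t \<in> A \<and> s \<in> B)" by blast
      then show "(case i of (A, B) \<Rightarrow> ?m A B * E (?e A) (?e B)) = 0"
        using zero E[OF i(2,3)] by auto
    qed
    fix i assume "i \<in> {(A, B) \<in> hedges X Y M. t \<in> A \<and> s \<in> B}"
    then obtain A B where i: "i = (A, B)" "A \<in> ?S Y" "B \<in> ?S X" "t \<in> A \<and> s \<in> B" using sub by blast
    then show "(case i of (A, B) \<Rightarrow> ?m A B * E (?e A) (?e B)) = (case i of (A, B) \<Rightarrow>
        (- 1) ^ (pos cs B s + pos cs A t) * ?m A B * ?m (A - {t}) (B - {s}))"
      using E[OF i(2,3)] by simp
  qed
  finally have sum_hedges: "cofactor_sum t s = (of_nat (fact r))\<^sup>2 * (\<Sum>(A, B)\<in>{(A, B) \<in> hedges X Y M. t \<in> A \<and> s \<in> B}.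
        (- 1) ^ (pos cs B s + pos cs A t) * ?m A B * ?m (A - {t}) (B - {s}))" .
  have "(of_nat (fact r) :: complex)\<^sup>2 \<noteq> 0" by simp
  then show ?thesis unfolding cofactor_mean_def sum_hedges Delta_hedges hedge_formula_def by simp
qed

end

theorem moore_penrose_eq_hedge_formula:
  assumes "finite X" "finite Y" and "\<And>s t. s \<in> X \<Longrightarrow> t \<in> Y \<Longrightarrow> cnj (M s t) = M s t"
    and "distinct cs" "X \<subseteq> set cs" "Y \<subseteq> set cs"
  shows "is_moore_penrose X Y M (\<lambda>t s. hedge_formula cs X Y M s t)"
    and "moore_penrose X Y M t s = hedge_formula cs X Y M s t"
proof -
  interpret real_finite_matrix X Y M using assms(1-3) by unfold_locales
  show *: "is_moore_penrose X Y M (\<lambda>t s. hedge_formula cs X Y M s t)"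
    unfolding hedge_formula_eq_cofactor_mean[OF assms(4-6)] by (rule cofactor_mean_moore_penrose)
  show "moore_penrose X Y M t s = hedge_formula cs X Y M s t"
    by (simp add: moore_penrose_eqI[OF *])
qed

section \<open>Semi-invariant regular functions\<close>

lemma poly_fun_prod: "finite A \<Longrightarrow> (\<And>a. a \<in> A \<Longrightarrow> p a \<in> poly_fun m) \<Longrightarrow> (\<lambda>x. \<Prod>a\<in>A. p a x) \<in> poly_fun m"
  by (induction A rule: finite_induct) (auto intro: poly_fun.intros)

lemma poly_fun_power: "p \<in> poly_fun m \<Longrightarrow> (\<lambda>x. p x ^ k) \<in> poly_fun m"
  by (induction k) (auto intro: poly_fun.intros)

lemma regular_on_poly:
  assumes "p \<in> poly_fun m" and "\<And>x. x \<in> U \<Longrightarrow> f x = p x"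
  shows "regular_on m U f"
  unfolding regular_on_def
  by (intro ballI bexI[of _ p] bexI[of _ "\<lambda>_. 1"]) (use assms in \<open>auto intro: poly_fun.intros\<close>)

lemma regular_on_mult:
  assumes "regular_on m U f" "regular_on m U f'"
  shows "regular_on m U (f * f')"
  unfolding regular_on_def
proof
  fix p assume p: "p \<in> U"
  obtain g h where gh: "g \<in> poly_fun m" "h \<in> poly_fun m" "h p \<noteq> 0"
    "\<forall>x\<in>U. h x \<noteq> 0 \<longrightarrow> f x = g x / h x"
    using assms(1) p unfolding regular_on_def by blast
  obtain g' h' where gh': "g' \<in> poly_fun m" "h' \<in> poly_fun m" "h' p \<noteq> 0"
    "\<forall>x\<in>U. h' x \<noteq> 0 \<longrightarrow> f' x = g' x / h' x"
    using assms(2) p unfolding regular_on_def by blast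
  show "\<exists>g\<in>poly_fun m. \<exists>h\<in>poly_fun m. h p \<noteq> 0 \<and> (\<forall>x\<in>U. h x \<noteq> 0 \<longrightarrow> (f * f') x = g x / h x)"
    by (intro bexI[of _ "\<lambda>x. g x * g' x"] bexI[of _ "\<lambda>x. h x * h' x"] poly_fun.mult)
      (use gh gh' in auto)
qed

lemma regular_on_add:
  assumes "regular_on m U f" "regular_on m U f'"
  shows "regular_on m U (f + f')"
  unfolding regular_on_def
proof
  fix p assume p: "p \<in> U"
  obtain g h where gh: "g \<in> poly_fun m" "h \<in> poly_fun m" "h p \<noteq> 0"
    "\<forall>x\<in>U. h x \<noteq> 0 \<longrightarrow> f x = g x / h x"
    using assms(1) p unfolding regular_on_def by blast
  obtain g' h' where gh': "g' \<in> poly_fun m" "h' \<in> poly_fun m" "h' p \<noteq> 0"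
    "\<forall>x\<in>U. h' x \<noteq> 0 \<longrightarrow> f' x = g' x / h' x"
    using assms(2) p unfolding regular_on_def by blast
  show "\<exists>g\<in>poly_fun m. \<exists>h\<in>poly_fun m. h p \<noteq> 0 \<and> (\<forall>x\<in>U. h x \<noteq> 0 \<longrightarrow> (f + f') x = g x / h x)"
    by (intro bexI[of _ "\<lambda>x. g x * h' x + g' x * h x"] bexI[of _ "\<lambda>x. h x * h' x"] poly_fun.mult poly_fun.add)
      (use gh gh' in \<open>auto simp: field_simps\<close>)
qed

text \<open>The character by which an element of the group scales the fibre of
  \<open>\<O>(a)\<close>.\<close>

definition character :: "('l, 'm, 'g) hhl_data \<Rightarrow> (nat \<Rightarrow> int) \<Rightarrow> 'g \<Rightarrow> complex" where
  "character D a g = (\<Prod>j<rankL D. phi D g j powi a j)"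

lemma toric_settingD:
  assumes "toric_setting D" "g \<in> carrier (grp D)"
  shows "j < rankL D \<Longrightarrow> phi D g j \<noteq> 0" and "phi D g \<in> affsp (rankL D)"
    and "additive f \<Longrightarrow> character D (\<lambda>j. f (psi D (basisL D j))) g = 1"
proof -
  have "phi D g \<in> torus_kernel D" using assms unfolding toric_setting_def by blast
  then show "j < rankL D \<Longrightarrow> phi D g j \<noteq> 0" "phi D g \<in> affsp (rankL D)"
    "additive f \<Longrightarrow> character D (\<lambda>j. f (psi D (basisL D j))) g = 1"
    by (auto simp: torus_kernel_def character_def)
qed

lemma character_nonzero: "toric_setting D \<Longrightarrow> g \<in> carrier (grp D) \<Longrightarrow> character D a g \<noteq> 0"
  by (auto simp: character_def toric_settingD power_int_eq_0_iff)

lemma character_diff: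
  "toric_setting D \<Longrightarrow> g \<in> carrier (grp D) \<Longrightarrow> character D (\<lambda>j. b j - a j) g = character D b g / character D a g"
  by (simp add: character_def toric_settingD power_int_diff prod_dividef)

lemma character_add:
  "toric_setting D \<Longrightarrow> g \<in> carrier (grp D) \<Longrightarrow> character D (\<lambda>j. a j + b j) g = character D a g * character D b g"
  by (simp add: character_def toric_settingD power_int_add prod.distrib)

lemma character_minus: "character D (\<lambda>j. - a j) g = inverse (character D a g)"
  by (simp add: character_def power_int_minus prod_inversef[symmetric] comp_def)

lemma character_cong: "(\<And>j. j < rankL D \<Longrightarrow> a j = b j) \<Longrightarrow> character D a g = character D b g"
  by (simp add: character_def)

text \<open>Written as a quotient, the factor of semi-invariance telescopes under
  composition.\<close>

lemma hom_O_iff: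
  assumes "toric_setting D"
  shows "f \<in> hom_O D a b \<longleftrightarrow> regular_on (rankL D) (U_Xi D) f \<and> (\<forall>x. x \<notin> U_Xi D \<longrightarrow> f x = 0) \<and>
    (\<forall>g\<in>carrier (grp D). \<forall>x\<in>U_Xi D. f (phi D g * x) = character D b g / character D a g * f x)"
proof -
  have "(\<Prod>j<rankL D. phi D g j powi (b j - a j)) = character D b g / character D a g" if "g \<in> carrier (grp D)" for g
    using character_diff[OF assms that, of b a] by (simp add: character_def)
  then show ?thesis by (auto simp: hom_O_def)
qed

lemma U_Xi_invariant:
  assumes "toric_setting D" "g \<in> carrier (grp D)" "x \<in> U_Xi D"
  shows "phi D g * x \<in> U_Xi D"
proof -
  have "{j. j < rankL D \<and> (phi D g * x) j = 0} = {j. j < rankL D \<and> x j = 0}"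
    using toric_settingD(1)[OF assms(1,2)] by auto
  then show ?thesis using assms(3) by (auto simp: U_Xi_def affsp_def)
qed

lemma hom_O_mult:
  assumes "toric_setting D" "f \<in> hom_O D a b" "f' \<in> hom_O D b c"
  shows "f * f' \<in> hom_O D a c"
  unfolding hom_O_iff[OF assms(1)]
proof (intro conjI ballI allI impI)
  fix g x assume g: "g \<in> carrier (grp D)" and x: "x \<in> U_Xi D"
  have "f (phi D g * x) = character D b g / character D a g * f x" "f' (phi D g * x) = character D c g / character D b g * f' x"
    using assms(2,3) g x unfolding hom_O_iff[OF assms(1)] by blast+
  then show "(f * f') (phi D g * x) = character D c g / character D a g * (f * f') x"
    using character_nonzero[OF assms(1) g, of b] by simp
qed (use assms(2,3) in \<open>auto simp: hom_O_iff[OF assms(1)] intro: regular_on_mult\<close>)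

lemma hom_O_add:
  assumes "toric_setting D" "f \<in> hom_O D a b" "f' \<in> hom_O D a b"
  shows "f + f' \<in> hom_O D a b"
  using assms(2,3) unfolding hom_O_iff[OF assms(1)]
  by (auto intro: regular_on_add simp: distrib_left)

lemma hom_O_cst:
  assumes "toric_setting D" "\<And>g. g \<in> carrier (grp D) \<Longrightarrow> character D a g = character D b g"
  shows "cst D r \<in> hom_O D a b"
  unfolding hom_O_iff[OF assms(1)]
proof (intro conjI ballI allI impI)
  show "regular_on (rankL D) (U_Xi D) (cst D r)"
    by (rule regular_on_poly[OF poly_fun.const[of r]]) (simp add: cst_def)
qed (use assms(2) character_nonzero[OF assms(1)] U_Xi_invariant[OF assms(1)] in \<open>auto simp: cst_def\<close>)

lemma hom_O_zero: "toric_setting D \<Longrightarrow> 0 \<in> hom_O D a b"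
  unfolding hom_O_iff using regular_on_poly[OF poly_fun.const[of 0]] by auto

lemma hom_O_sum:
  assumes "toric_setting D" "\<And>i. i \<in> I \<Longrightarrow> F i \<in> hom_O D a b"
  shows "(\<Sum>i\<in>I. F i) \<in> hom_O D a b"
  using assms(2)
  by (induction I rule: infinite_finite_induct) (auto intro: hom_O_add hom_O_zero assms(1))

lemma hom_O_uminus:
  assumes "toric_setting D" "f \<in> hom_O D a b"
  shows "- f \<in> hom_O D a b"
proof -
  have "cst D (- 1) * f = - f"
    using assms(2) by (auto simp: cst_def hom_O_def fun_eq_iff)
  then show ?thesis using hom_O_mult[OF assms(1) hom_O_cst[OF assms(1) refl] assms(2)] by metis
qed

lemma iso_O_refl: "toric_setting D \<Longrightarrow> iso_O D a a"
  unfolding iso_O_def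
  by (intro bexI[of _ "cst D 1"] hom_O_cst) (auto simp: cst_def fun_eq_iff)

lemma O_class_eq_imp_iso:
  assumes "toric_setting D" "O_class D \<sigma> = O_class D \<tau>"
  shows "iso_O D (O_exp D \<sigma>) (O_exp D \<tau>)"
proof -
  have "O_exp D \<tau> \<in> O_class D \<tau>"
    using iso_O_refl[OF assms(1)] by (auto simp: O_class_def iso_class_def Zvec_def O_exp_def)
  then show ?thesis using assms(2) by (auto simp: O_class_def iso_class_def)
qed

section \<open>Cells and the entries of the HHL differential\<close>

lemma ceiling_eq_of_sgn_eq:
  fixes x y :: real
  assumes "\<And>m::int. sgn (x - of_int m) = sgn (y - of_int m)"
  shows "\<lceil>x\<rceil> = \<lceil>y\<rceil>"
proof -
  have "x \<le> of_int m \<longleftrightarrow> y \<le> of_int m" for m :: int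
    using assms[of m] by (auto simp: sgn_if split: if_splits)
  then show ?thesis by (metis ceiling_le_iff order_antisym order_refl)
qed

lemma cells_props:
  assumes "c \<in> cells D"
  shows "c \<noteq> {}" "c \<subseteq> dualR" "f \<in> c \<Longrightarrow> j < rankL D \<Longrightarrow> ceil_H D j c = \<lceil>H D j f\<rceil>"
proof -
  obtain f0 where f0: "f0 \<in> dualR" "c = cell_of D f0" using assms by (auto simp: cells_def)
  show "c \<noteq> {}" "c \<subseteq> dualR" using f0 by (auto simp: cell_of_def)
  have *: "\<lceil>H D j g\<rceil> = \<lceil>H D j f0\<rceil>" if "g \<in> c" "j < rankL D" for g j
    using that f0 by (intro ceiling_eq_of_sgn_eq) (auto simp: cell_of_def)
  assume f: "f \<in> c" and j: "j < rankL D"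
  show "ceil_H D j c = \<lceil>H D j f\<rceil>"
    unfolding ceil_H_def
  proof (rule the_equality)
    show "\<forall>g\<in>c. \<lceil>H D j g\<rceil> = \<lceil>H D j f\<rceil>" using * f j by simp
  qed (use f in auto)
qed

text \<open>Cells with the same image in \<open>T\<close> contain points that differ by an element
  \<open>u\<close> of \<open>\<Lambda>\<^sup>*\<close>, and ceilings are constant on cells.\<close>

lemma lifts_differ_by_dual:
  assumes "c \<in> lifts D \<sigma>" "c' \<in> lifts D \<sigma>"
  obtains u :: "'m::ab_group_add \<Rightarrow> int" where "additive u"
    "\<And>j. j < rankL D \<Longrightarrow> ceil_H D j c' = ceil_H D j c + u (psi D (basisL (D :: ('l, 'm, 'g) hhl_data) j))"
proof -
  have c: "c \<in> cells D" "c' \<in> cells D" "c // lat_rel = c' // lat_rel"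
    using assms by (auto simp: lifts_def)
  obtain f where f: "f \<in> c" using cells_props(1)[OF c(1)] by blast
  have "lat_rel `` {f} \<in> c' // lat_rel" using quotientI[OF f, of lat_rel] c(3) by simp
  then obtain f' where f': "f' \<in> c'" "lat_rel `` {f} = lat_rel `` {f'}" by (auto elim: quotientE)
  have "f' \<in> dualR" using f'(1) cells_props(2)[OF c(2)] by blast
  then have "(f', f') \<in> lat_rel" by (auto simp: lat_rel_def)
  then have ff: "(f, f') \<in> lat_rel" using f'(2) by blast
  define u where "u x = \<lfloor>f' x - f x\<rfloor>" for x
  have u: "of_int (u x) = f' x - f x" for x
  proof -
    have "f' x - f x = (f' - f) x" by simp
    then have "f' x - f x \<in> \<int>" using ff unfolding lat_rel_def by (metis (no_types, lifting) case_prodD mem_Collect_eq range_subsetD)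
    then show ?thesis by (simp add: u_def of_int_floor)
  qed
  show thesis
  proof
    show "additive u"
    proof
      fix x y
      have "additive f" "additive f'" using ff by (auto simp: lat_rel_def dualR_def)
      then have "of_int (u (x + y)) = (of_int (u x + u y) :: real)"
        by (simp add: u additive.add)
      then show "u (x + y) = u x + u y" by linarith
    qed
    fix j assume j: "j < rankL D"
    have "H D j f' = H D j f + of_int (u (psi D (basisL D j)))" by (simp add: H_def u)
    then show "ceil_H D j c' = ceil_H D j c + u (psi D (basisL D j))"
      using cells_props(3)[OF c(1) f j] cells_props(3)[OF c(2) f'(1) j] by simp
  qed
qed

text \<open>Elements of \<open>\<Lambda>\<^sup>*\<close> are trivial on the kernel of \<open>L
  \<otimes> \<complex>\<^sup>* \<rightarrow> \<Lambda> \<otimes> \<complex>\<^sup>*\<close>. This is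
  why \<open>\<O>(\<sigma>)\<close> does not depend on the chosen lift.\<close>

lemma character_lifts_eq:
  assumes "toric_setting D" "g \<in> carrier (grp D)" "c \<in> lifts D \<sigma>" "c' \<in> lifts D \<sigma>"
  shows "character D (\<lambda>j. ceil_H D j c) g = character D (\<lambda>j. ceil_H D j c') g"
proof -
  obtain u where u: "additive u" "\<And>j. j < rankL D \<Longrightarrow> ceil_H D j c' = ceil_H D j c + u (psi D (basisL D j))"
    using lifts_differ_by_dual[OF assms(3,4)] by blast
  have "character D (\<lambda>j. ceil_H D j c') g = character D (\<lambda>j. ceil_H D j c + u (psi D (basisL D j))) g"
    by (rule character_cong) (rule u(2))
  then show ?thesis by (simp add: character_add assms toric_settingD(3)[OF assms(1,2) u(1)])
qed

lemma character_O_exp: "character D (O_exp D \<sigma>) g = inverse (character D (\<lambda>j. ceil_H D j (lift D \<sigma>)) g)"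
  unfolding character_minus[symmetric] by (rule character_cong) (simp add: O_exp_def)

text \<open>The condition \<open>H\<^sub>j \<le> m\<close> is closed, so ceilings can only drop on
  passing to a face. Hence the exponents in \<open>HHL\<close> are nonnegative.\<close>

lemma ceil_H_closure_le:
  assumes c: "c \<in> cells D" and c': "c' \<in> cells D" "c' \<subseteq> closure c" and j: "j < rankL D"
  shows "ceil_H D j c' \<le> ceil_H D j c"
proof -
  have "closed {f. H D j f \<le> of_int (ceil_H D j c)}"
    unfolding H_def by (intro closed_Collect_le continuous_on_product_coordinates continuous_on_const)
  moreover have "c \<subseteq> {f. H D j f \<le> of_int (ceil_H D j c)}"
    using cells_props(3)[OF c _ j] by auto
  ultimately have "closure c \<subseteq> {f. H D j f \<le> of_int (ceil_H D j c)}" by (rule closure_minimal[rotated])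
  moreover obtain f where f: "f \<in> c'" using cells_props(1)[OF c'(1)] by blast
  ultimately have "H D j f \<le> of_int (ceil_H D j c)" using c'(2) by blast
  then show ?thesis using cells_props(3)[OF c'(1) f j] by (simp add: ceiling_le_iff)
qed

text \<open>Each monomial is a polynomial and has the semi-invariance prescribed by the exponents of
  the lift \<open>c\<close>, which may be exchanged for those of the chosen lift of
  \<open>\<tau>\<close>.\<close>

lemma HHL_in_hom_O:
  assumes t: "toric_setting D" and ch: "HHL_choices D" and st: "\<sigma> \<in> strata D" "\<tau> \<in> strata D"
  shows "HHL D \<sigma> \<tau> \<in> hom_O D (O_exp D \<sigma>) (O_exp D \<tau>)"
proof -
  define e where "e c j = ceil_H D j (lift D \<sigma>) - ceil_H D j c" for c j
  define F where "F c = (\<lambda>x. if x \<in> U_Xi D then of_int (incidence_sgn D \<sigma> \<tau> c) * (\<Prod>j<rankL D. x j powi e c j) else 0)" for c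
  have lift: "lift D \<sigma> \<in> cells D" "lift D \<tau> \<in> lifts D \<tau>"
    using ch st by (auto simp: HHL_choices_def lifts_def)
  have "HHL D \<sigma> \<tau> = (\<Sum>c\<in>facets_over D \<sigma> \<tau>. F c)"
    by (auto simp: fun_eq_iff sum_fun_at HHL_def F_def e_def)
  moreover have "F c \<in> hom_O D (O_exp D \<sigma>) (O_exp D \<tau>)" if c: "c \<in> facets_over D \<sigma> \<tau>" for c
    unfolding hom_O_iff[OF t]
  proof (intro conjI ballI allI impI)
    have cl: "c \<in> lifts D \<tau>" "c \<subseteq> closure (lift D \<sigma>)" using c by (auto simp: facets_over_def)
    then have "c \<in> cells D" by (simp add: lifts_def)
    have nn: "e c j \<ge> 0" if "j < rankL D" for j
      using ceil_H_closure_le[OF lift(1) \<open>c \<in> cells D\<close> cl(2) that] by (simp add: e_def)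
    show "regular_on (rankL D) (U_Xi D) (F c)"
    proof (rule regular_on_poly)
      show "(\<lambda>x. of_int (incidence_sgn D \<sigma> \<tau> c) * (\<Prod>j<rankL D. x j ^ nat (e c j))) \<in> poly_fun (rankL D)"
        by (intro poly_fun.mult poly_fun.const poly_fun_prod poly_fun_power poly_fun.coord) auto
      show "F c x = of_int (incidence_sgn D \<sigma> \<tau> c) * (\<Prod>j<rankL D. x j ^ nat (e c j))" if "x \<in> U_Xi D" for x
        using that nn by (simp add: F_def power_int_def)
    qed
    show "F c x = 0" if "x \<notin> U_Xi D" for x using that by (simp add: F_def)
    fix g x assume g: "g \<in> carrier (grp D)" and x: "x \<in> U_Xi D"
    have "F c (phi D g * x) = character D (e c) g * F c x"
      using x U_Xi_invariant[OF t g x] by (simp add: F_def character_def power_int_mult_distrib prod.distrib)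
    also have "character D (e c) g = character D (\<lambda>j. ceil_H D j (lift D \<sigma>)) g / character D (\<lambda>j. ceil_H D j c) g"
      unfolding e_def by (rule character_diff[OF t g])
    also have "\<dots> = character D (O_exp D \<tau>) g / character D (O_exp D \<sigma>) g"
      unfolding character_O_exp character_lifts_eq[OF t g cl(1) lift(2)] by (simp add: field_simps)
    finally show "F c (phi D g * x) = character D (O_exp D \<tau>) g / character D (O_exp D \<sigma>) g * F c x" .
  qed
  ultimately show ?thesis using hom_O_sum[OF t] by metis
qed

section \<open>The entries of \<open>\<delta>\<close> and \<open>h\<close>\<close>

lemma cst_uminus: "cst D (- r) = - cst D r"
  by (auto simp: cst_def fun_eq_iff)

locale hhl =
  fixes D :: "('l::ab_group_add, 'm::ab_group_add, 'g) hhl_data"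
  assumes toric: "toric_setting D" and choices: "HHL_choices D" and conventions: "BT_conventions D"
begin

lemma finite_strata: "finite (strata D)"
  using choices unfolding HHL_choices_def by (metis List.finite_set)

lemma HHL_hom: "\<sigma> \<in> strata D \<Longrightarrow> \<tau> \<in> strata D \<Longrightarrow> HHL D \<sigma> \<tau> \<in> hom_O D (O_exp D \<sigma>) (O_exp D \<tau>)"
  by (rule HHL_in_hom_O[OF toric choices])

lemma facet_ceil_eq:
  assumes "type_II D \<sigma> \<tau>" "c \<in> facets_over D \<sigma> \<tau>" "j < rankL D"
  shows "ceil_H D j (lift D \<sigma>) = ceil_H D j c"
proof -
  have "iso_O D (O_exp D \<sigma>) (O_exp D \<tau>)"
    using assms(1) O_class_eq_imp_iso[OF toric] by (auto simp: type_II_def)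
  then have "ceil_H D j (lift D \<sigma>) - ceil_H D j c = 0"
    using conventions assms unfolding BT_conventions_def type_II_def by blast
  then show ?thesis by simp
qed

lemma HHL_type_II:
  assumes "type_II D \<sigma> \<tau>"
  shows "HHL D \<sigma> \<tau> = cst D (incidence D \<sigma> \<tau>)"
proof (rule ext)
  fix x :: "nat \<Rightarrow> complex"
  have "(\<Prod>j<rankL D. x j powi (ceil_H D j (lift D \<sigma>) - ceil_H D j c)) = 1"
    if "c \<in> facets_over D \<sigma> \<tau>" for c
    using facet_ceil_eq[OF assms that] by (intro prod.neutral) auto
  then show "HHL D \<sigma> \<tau> x = cst D (incidence D \<sigma> \<tau>) x"
    by (simp add: HHL_def cst_def incidence_def)
qed

lemma incidence_same_character:
  assumes II: "type_II D \<sigma> \<tau>" and nz: "incidence D \<sigma> \<tau> \<noteq> 0" and g: "g \<in> carrier (grp D)"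
  shows "character D (O_exp D \<sigma>) g = character D (O_exp D \<tau>) g"
proof -
  obtain c where c: "c \<in> facets_over D \<sigma> \<tau>"
    using nz unfolding incidence_def by (metis sum.neutral)
  have "lift D \<tau> \<in> lifts D \<tau>" using II choices by (auto simp: type_II_def HHL_choices_def)
  moreover have "c \<in> lifts D \<tau>" using c by (simp add: facets_over_def)
  ultimately have "character D (\<lambda>j. ceil_H D j c) g = character D (\<lambda>j. ceil_H D j (lift D \<tau>)) g"
    by (intro character_lifts_eq[OF toric g])
  moreover have "character D (\<lambda>j. ceil_H D j (lift D \<sigma>)) g = character D (\<lambda>j. ceil_H D j c) g"
    by (rule character_cong) (rule facet_ceil_eq[OF II c])
  ultimately show ?thesis by (simp add: character_O_exp)
qed

text \<open>In the same class \<open>d\<close> and \<open>gr d\<close> cancel. Where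
  \<open>\<O>(\<tau>) \<le> \<O>(\<sigma>)\<close> fails, the space of morphisms containing
  \<open>HHL\<close> is zero.\<close>

lemma delta_eq: "delta D \<sigma> \<tau> = (if type_I D \<sigma> \<tau> then HHL D \<sigma> \<tau> else 0)"
proof (cases "\<sigma> \<in> strata D \<and> \<tau> \<in> strata D \<and> sdim D \<sigma> = sdim D \<tau> + 1")
  case False
  then show ?thesis by (auto simp: delta_def d_HHL_def gr_diff_def type_I_def)
next
  case st: True
  show ?thesis
  proof (cases "O_class D \<sigma> = O_class D \<tau>")
    case True
    then have "type_II D \<sigma> \<tau>" using st by (simp add: type_II_def)
    then show ?thesis using st True
      by (simp add: delta_def d_HHL_def gr_diff_def type_I_def HHL_type_II)
  next
    case False
    have "HHL D \<sigma> \<tau> = 0" if "(O_class D \<tau>, O_class D \<sigma>) \<notin> BT_le D"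
    proof -
      have "hom_O D (O_exp D \<sigma>) (O_exp D \<tau>) = {0}"
        using that st unfolding BT_le_def by blast
      then show ?thesis using HHL_hom[of \<sigma> \<tau>] st by simp
    qed
    then show ?thesis using st False
      by (simp add: delta_def d_HHL_def gr_diff_def type_I_def)
  qed
qed

lemma incidence_real: "cnj (incidence D \<sigma> \<tau>) = incidence D \<sigma> \<tau>"
  by (simp add: incidence_def)

lemma class_cells_props:
  "class_cells D A q \<subseteq> set (ordering D)" "finite (class_cells D A q)"
  using choices finite_strata by (auto simp: class_cells_def HHL_choices_def)

lemma MP_moore_penrose:
  assumes "type_II D \<sigma> \<tau>"
  defines "X \<equiv> class_cells D (O_class D \<tau>) (sdim D \<tau> + 1)" and "Y \<equiv> class_cells D (O_class D \<tau>) (sdim D \<tau>)"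
  shows "is_moore_penrose X Y (incidence D) (\<lambda>t s. hedge_formula (ordering D) X Y (incidence D) s t)"
    and "MP D \<sigma> \<tau> = hedge_formula (ordering D) X Y (incidence D) \<sigma> \<tau>"
    and "bd_plus D (O_class D \<tau>) (sdim D \<tau>) \<tau> \<sigma> = MP D \<sigma> \<tau>"
proof -
  have "distinct (ordering D)" using choices by (simp add: HHL_choices_def)
  note mp = moore_penrose_eq_hedge_formula[OF class_cells_props(2) class_cells_props(2) incidence_real
      this class_cells_props(1) class_cells_props(1)]
  show "is_moore_penrose X Y (incidence D) (\<lambda>t s. hedge_formula (ordering D) X Y (incidence D) s t)"
    unfolding X_def Y_def by (rule mp(1))
  have dim: "sdim D \<sigma> = sdim D \<tau> + 1" using assms by (simp add: type_II_def)
  then show "MP D \<sigma> \<tau> = hedge_formula (ordering D) X Y (incidence D) \<sigma> \<tau>"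
    by (simp add: MP_def X_def Y_def)
  show "bd_plus D (O_class D \<tau>) (sdim D \<tau>) \<tau> \<sigma> = MP D \<sigma> \<tau>"
    by (simp add: MP_def bd_plus_def dim mp(2))
qed

lemma hmap_eq: "hmap D \<tau> \<sigma> = (if type_II D \<sigma> \<tau> then - cst D (MP D \<sigma> \<tau>) else 0)"
  by (auto simp: hmap_def type_II_def cst_uminus MP_moore_penrose(3)[unfolded type_II_def])

text \<open>Equality in \<open>BT\<close> does not make the characters of \<open>\<sigma>\<close>
  and \<open>\<tau>\<close> equal. They are equal if \<open>MP\<close> is not zero, because
  incidence numbers vanish between different characters, and so do the entries of the Moore-Penrose
  inverse.\<close>

lemma MP_hom:
  assumes II: "type_II D \<sigma> \<tau>"
  shows "cst D (MP D \<sigma> \<tau>) \<in> hom_O D (O_exp D \<tau>) (O_exp D \<sigma>)"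
proof (cases "MP D \<sigma> \<tau> = 0")
  case True
  then have "cst D (MP D \<sigma> \<tau>) = 0" by (auto simp: cst_def)
  then show ?thesis using hom_O_zero[OF toric] by simp
next
  case False
  \<comment> \<open>Blocks are labelled by the character of the group, cut off outside the carrier to
    make labels comparable as functions.\<close>
  define k where "k \<rho> = (\<lambda>g. if g \<in> carrier (grp D) then character D (O_exp D \<rho>) g else 0)" for \<rho>
  have "k s = k t" if "s \<in> class_cells D (O_class D \<tau>) (sdim D \<tau> + 1)"
    "t \<in> class_cells D (O_class D \<tau>) (sdim D \<tau>)" "incidence D s t \<noteq> 0" for s t
  proof -
    have "type_II D s t" using that by (auto simp: type_II_def class_cells_def)
    then show ?thesis using incidence_same_character that(3) by (auto simp: k_def)
  qed
  then have "k \<tau> = k \<sigma>"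
    using moore_penrose_block_diagonal[OF MP_moore_penrose(1)[OF II], of k \<tau> \<sigma>] False
      MP_moore_penrose(2)[OF II] by auto
  then have "character D (O_exp D \<tau>) g = character D (O_exp D \<sigma>) g" if "g \<in> carrier (grp D)" for g
    using that unfolding k_def by (metis (full_types))
  then show ?thesis by (rule hom_O_cst[OF toric])
qed

end

section \<open>Paths\<close>

definition paths_of_length :: "('l, 'm::ab_group_add, 'g) hhl_data \<Rightarrow> nat \<Rightarrow> 'm stratum \<Rightarrow> 'm stratum \<Rightarrow>
    ('m stratum \<times> 'm stratum) list set" where
  "paths_of_length D j \<sigma> \<tau> = {p \<in> paths D \<sigma> \<tau>. plength p = j}"

lemma path_Cons_iff:
  assumes "p \<noteq> []"
  shows "(a, w) # p \<in> paths D \<sigma> \<tau> \<longleftrightarrow>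
    a = \<sigma> \<and> type_I D \<sigma> w \<and> type_II D (fst (hd p)) w \<and> p \<in> paths D (fst (hd p)) \<tau>"
proof -
  have I: "(\<forall>j<length ((a, w) # p). type_I D (fst (((a, w) # p) ! j)) (snd (((a, w) # p) ! j))) \<longleftrightarrow>
      type_I D a w \<and> (\<forall>j<length p. type_I D (fst (p ! j)) (snd (p ! j)))"
    by (simp add: All_less_Suc2)
  obtain n where "length p = Suc n" using assms by (cases p) auto
  then have II: "(\<forall>j<length ((a, w) # p) - 1. type_II D (fst (((a, w) # p) ! (j + 1))) (snd (((a, w) # p) ! j))) \<longleftrightarrow>
      type_II D (fst (p ! 0)) w \<and> (\<forall>j<length p - 1. type_II D (fst (p ! (j + 1))) (snd (p ! j)))"
    by (simp add: All_less_Suc2)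
  show ?thesis
    unfolding paths_def mem_Collect_eq I II using assms by (auto simp: hd_conv_nth)
qed

lemma path_single_iff: "[(a, w)] \<in> paths D \<sigma> \<tau> \<longleftrightarrow> a = \<sigma> \<and> w = \<tau> \<and> type_I D \<sigma> \<tau>"
  by (auto simp: paths_def)

lemma weight_single: "weight D [(a, w)] = HHL D a w"
  by (simp add: weight_def plength_def)

lemma weight_Cons:
  assumes "p \<noteq> []"
  shows "weight D ((a, w) # p) = HHL D a w * cst D (MP D (fst (hd p)) w) * weight D p"
proof -
  have l: "plength ((a, w) # p) = Suc (plength p)" using assms by (simp add: plength_def)
  show ?thesis
    unfolding weight_def l prod.atMost_Suc_shift prod.lessThan_Suc_shift
    using assms by (simp add: hd_conv_nth mult_ac)
qed

lemma path_ends: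
  assumes "p \<in> paths D \<sigma> \<tau>"
  shows "p \<noteq> []" "fst (hd p) = \<sigma>" "\<sigma> \<in> strata D" "\<tau> \<in> strata D" "set p \<subseteq> strata D \<times> strata D"
proof -
  show p: "p \<noteq> []" "fst (hd p) = \<sigma>" using assms by (auto simp: paths_def)
  show s: "set p \<subseteq> strata D \<times> strata D"
    using assms by (auto simp: paths_def type_I_def in_set_conv_nth) (metis fst_conv snd_conv)+
  have "hd p \<in> strata D \<times> strata D" "last p \<in> strata D \<times> strata D"
    using s hd_in_set[OF p(1)] last_in_set[OF p(1)] by blast+
  moreover have "snd (last p) = \<tau>" using assms by (simp add: paths_def)
  ultimately show "\<sigma> \<in> strata D" "\<tau> \<in> strata D" using p(2) by (auto simp: mem_Times_iff)
qed

context hhl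
begin

lemma finite_paths_of_length: "finite (paths_of_length D j \<sigma> \<tau>)"
proof (rule finite_subset)
  show "paths_of_length D j \<sigma> \<tau> \<subseteq> {p. set p \<subseteq> strata D \<times> strata D \<and> length p = Suc j}"
  proof
    fix p assume "p \<in> paths_of_length D j \<sigma> \<tau>"
    then have "p \<in> paths D \<sigma> \<tau>" "plength p = j" by (auto simp: paths_of_length_def)
    then show "p \<in> {p. set p \<subseteq> strata D \<times> strata D \<and> length p = Suc j}"
      using path_ends(1,5)[of p D \<sigma> \<tau>] by (cases p) (auto simp: plength_def)
  qed
  show "finite {p. set p \<subseteq> strata D \<times> strata D \<and> length p = Suc j}"
    by (intro finite_lists_length_eq finite_cartesian_product finite_strata)
qed

lemma sum_paths_of_length_0:
  "(\<Sum>p\<in>paths_of_length D 0 \<sigma> \<tau>. weight D p) = (if type_I D \<sigma> \<tau> then HHL D \<sigma> \<tau> else 0)"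
proof -
  have "paths_of_length D 0 \<sigma> \<tau> = (if type_I D \<sigma> \<tau> then {[(\<sigma>, \<tau>)]} else {})"
  proof -
    have "p \<in> paths_of_length D 0 \<sigma> \<tau> \<longleftrightarrow> type_I D \<sigma> \<tau> \<and> p = [(\<sigma>, \<tau>)]" for p
    proof (cases p rule: remdups_adj.cases)
      case 1
      then show ?thesis by (auto simp: paths_of_length_def paths_def)
    next
      case (2 x)
      then show ?thesis by (cases x) (auto simp: paths_of_length_def plength_def path_single_iff)
    next
      case (3 x y xs)
      then show ?thesis by (auto simp: paths_of_length_def plength_def)
    qed
    then show ?thesis by auto
  qed
  then show ?thesis by (simp add: weight_single)
qed

text \<open>A path of positive length consists of a type I pair \<open>(\<sigma>, w)\<close>, a type
  II pair \<open>(z, w)\<close>, and a path from \<open>z\<close>.\<close>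

lemma sum_paths_of_length_Suc:
  fixes F :: "('m stratum \<times> 'm stratum) list \<Rightarrow> sect"
  shows "(\<Sum>p\<in>paths_of_length D (Suc j) \<sigma> \<tau>. F p) =
    (\<Sum>z\<in>strata D. \<Sum>w\<in>strata D. if type_I D \<sigma> w \<and> type_II D z w
       then \<Sum>p\<in>paths_of_length D j z \<tau>. F ((\<sigma>, w) # p) else 0)"
proof -
  let ?ZW = "{(z, w) \<in> strata D \<times> strata D. type_I D \<sigma> w \<and> type_II D z w}"
  have fin: "finite ?ZW" by (rule finite_subset[of _ "strata D \<times> strata D"]) (auto simp: finite_strata)
  have "(\<Sum>p\<in>paths_of_length D (Suc j) \<sigma> \<tau>. F p) =
      (\<Sum>((z, w), p)\<in>Sigma ?ZW (\<lambda>(z, w). paths_of_length D j z \<tau>). F ((\<sigma>, w) # p))"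
  proof (rule sum.reindex_bij_witness[where i = "\<lambda>((z, w), p). (\<sigma>, w) # p"
        and j = "\<lambda>p. ((fst (hd (tl p)), snd (hd p)), tl p)"])
    fix q assume q: "q \<in> paths_of_length D (Suc j) \<sigma> \<tau>"
    then have "length q = Suc (Suc j)" by (auto simp: paths_of_length_def plength_def)
    then obtain aw p where "q = aw # p" "length p = Suc j" by (cases q) auto
    moreover obtain a w where "aw = (a, w)" by (cases aw)
    ultimately have q': "q = (a, w) # p" "p \<noteq> []" "length p = Suc j" by auto
    have "(a, w) # p \<in> paths D \<sigma> \<tau>" using q q' by (simp add: paths_of_length_def)
    then have P: "a = \<sigma>" "type_I D \<sigma> w" "type_II D (fst (hd p)) w" "p \<in> paths D (fst (hd p)) \<tau>"
      unfolding path_Cons_iff[OF q'(2)] by auto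
    show "(\<lambda>((z, w), p). (\<sigma>, w) # p) ((fst (hd (tl q)), snd (hd q)), tl q) = q"
      by (simp add: q' P(1))
    show "((fst (hd (tl q)), snd (hd q)), tl q) \<in> Sigma ?ZW (\<lambda>(z, w). paths_of_length D j z \<tau>)"
      using P q' by (auto simp: paths_of_length_def plength_def type_II_def)
    show "(\<lambda>((z, w), p). F ((\<sigma>, w) # p)) ((fst (hd (tl q)), snd (hd q)), tl q) = F q"
      by (simp add: q' P(1))
  next
    fix b assume "b \<in> Sigma ?ZW (\<lambda>(z, w). paths_of_length D j z \<tau>)"
    then obtain z w p where b: "b = ((z, w), p)" "type_I D \<sigma> w" "type_II D z w" "p \<in> paths_of_length D j z \<tau>"
      by auto
    then have p: "p \<in> paths D z \<tau>" "plength p = j" by (auto simp: paths_of_length_def)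
    note e = path_ends[OF p(1)]
    have "length p = Suc j" using e(1) p(2) by (cases p) (auto simp: plength_def)
    show "(\<lambda>p. ((fst (hd (tl p)), snd (hd p)), tl p)) ((\<lambda>((z, w), p). (\<sigma>, w) # p) b) = b"
      using e by (simp add: b(1))
    show "((\<lambda>((z, w), p). (\<sigma>, w) # p) b) \<in> paths_of_length D (Suc j) \<sigma> \<tau>"
      using e p b(2,3) \<open>length p = Suc j\<close> by (simp add: b(1) paths_of_length_def path_Cons_iff plength_def)
  qed
  also have "\<dots> = (\<Sum>(z, w)\<in>?ZW. \<Sum>p\<in>paths_of_length D j z \<tau>. F ((\<sigma>, w) # p))"
    by (subst sum.Sigma[symmetric]) (use fin finite_paths_of_length in \<open>auto intro!: sum.cong\<close>)
  also have "\<dots> = (\<Sum>(z, w)\<in>strata D \<times> strata D. if type_I D \<sigma> w \<and> type_II D z w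
       then \<Sum>p\<in>paths_of_length D j z \<tau>. F ((\<sigma>, w) # p) else 0)"
    by (rule sum.mono_neutral_cong_left) (auto simp: finite_strata)
  finally show ?thesis by (simp add: sum.cartesian_product)
qed

text \<open>Both sides satisfy the same recursion in the first two steps \<open>\<sigma>
  \<rightarrow> w \<rightarrow> z\<close>; the sign comes from \<open>h = - MP\<close>.\<close>

lemma Phi_term_eq: "Phi_term D j \<sigma> \<tau> = (\<Sum>p\<in>paths_of_length D j \<sigma> \<tau>. (- 1) ^ j * weight D p)"
proof (induction j arbitrary: \<sigma>)
  case 0
  then show ?case by (simp add: Phi_term_def delta_eq sum_paths_of_length_0)
next
  case (Suc j)
  have "Phi_term D (Suc j) \<sigma> \<tau> =
      (\<Sum>z\<in>strata D. \<Sum>w\<in>strata D. delta D \<sigma> w * hmap D w z * Phi_term D j z \<tau>)"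
    by (simp add: Phi_term_def mcomp_def sum_distrib_right)
  also have "\<dots> = (\<Sum>z\<in>strata D. \<Sum>w\<in>strata D. if type_I D \<sigma> w \<and> type_II D z w
       then \<Sum>p\<in>paths_of_length D j z \<tau>. (- 1) ^ Suc j * weight D ((\<sigma>, w) # p) else 0)"
  proof (intro sum.cong refl)
    fix z w
    show "delta D \<sigma> w * hmap D w z * Phi_term D j z \<tau> = (if type_I D \<sigma> w \<and> type_II D z w
       then \<Sum>p\<in>paths_of_length D j z \<tau>. (- 1) ^ Suc j * weight D ((\<sigma>, w) # p) else 0)"
    proof (cases "type_I D \<sigma> w \<and> type_II D z w")
      case True
      have "delta D \<sigma> w * hmap D w z * Phi_term D j z \<tau> =
          (\<Sum>p\<in>paths_of_length D j z \<tau>. HHL D \<sigma> w * (- cst D (MP D z w)) * ((- 1) ^ j * weight D p))"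
        using True by (simp only: delta_eq hmap_eq Suc.IH sum_distrib_left if_True)
      also have "\<dots> = (\<Sum>p\<in>paths_of_length D j z \<tau>. (- 1) ^ Suc j * weight D ((\<sigma>, w) # p))"
      proof (rule sum.cong[OF refl])
        fix p assume "p \<in> paths_of_length D j z \<tau>"
        then have "p \<in> paths D z \<tau>" by (simp add: paths_of_length_def)
        then have "weight D ((\<sigma>, w) # p) = HHL D \<sigma> w * cst D (MP D z w) * weight D p"
          using path_ends[of p D z \<tau>] by (simp add: weight_Cons)
        then show "HHL D \<sigma> w * (- cst D (MP D z w)) * ((- 1) ^ j * weight D p) =
            (- 1) ^ Suc j * weight D ((\<sigma>, w) # p)"
          by (simp add: mult_ac)
      qed
      finally show ?thesis using True by simp
    qed (auto simp: delta_eq hmap_eq)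
  qed
  finally show ?case by (simp only: sum_paths_of_length_Suc)
qed

text \<open>A type I pair strictly lowers the class, and the type II pair that follows keeps
  it.\<close>

lemma path_classes_decrease:
  assumes p: "p \<in> paths D \<sigma> \<tau>" and "i < k" "k < length p"
  shows "(O_class D (fst (p ! k)), O_class D (fst (p ! i))) \<in> BT_le D \<and>
    O_class D (fst (p ! k)) \<noteq> O_class D (fst (p ! i))"
  using assms(2,3)
proof (induction k)
  case (Suc k)
  have po: "trans (BT_le D)" "antisym (BT_le D)"
    using conventions by (auto simp: BT_conventions_def partial_order_on_def preorder_on_def)
  have k: "k < length p" "k < length p - 1" using Suc.prems by auto
  have "type_I D (fst (p ! k)) (snd (p ! k))" "type_II D (fst (p ! (k + 1))) (snd (p ! k))"
    using p k unfolding paths_def by blast+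
  then have step: "(O_class D (fst (p ! Suc k)), O_class D (fst (p ! k))) \<in> BT_le D"
    "O_class D (fst (p ! Suc k)) \<noteq> O_class D (fst (p ! k))"
    by (auto simp: type_I_def type_II_def)
  show ?case
  proof (cases "i = k")
    case True
    then show ?thesis using step by simp
  next
    case False
    then have IH: "(O_class D (fst (p ! k)), O_class D (fst (p ! i))) \<in> BT_le D"
      "O_class D (fst (p ! k)) \<noteq> O_class D (fst (p ! i))"
      using Suc.IH Suc.prems by auto
    have "(O_class D (fst (p ! Suc k)), O_class D (fst (p ! i))) \<in> BT_le D"
      using transD[OF po(1) step(1) IH(1)] .
    moreover have "O_class D (fst (p ! Suc k)) \<noteq> O_class D (fst (p ! i))"
      using antisymD[OF po(2)] step IH(1) by metis
    ultimately show ?thesis by blast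
  qed
qed simp

text \<open>The classes of \<open>\<sigma>\<^sub>0, \<dots>, \<sigma>\<^sub>m\<close> are
  distinct.\<close>

lemma plength_less:
  assumes p: "p \<in> paths D \<sigma> \<tau>"
  shows "plength p < card (BT D)"
proof -
  have "inj_on (\<lambda>i. O_class D (fst (p ! i))) {..<length p}"
    using path_classes_decrease[OF p] unfolding inj_on_def by (metis lessThan_iff linorder_neqE_nat)
  moreover have "(\<lambda>i. O_class D (fst (p ! i))) ` {..<length p} \<subseteq> BT D"
    using path_ends(5)[OF p] nth_mem[of _ p] by (fastforce simp: BT_def)
  moreover have "finite (BT D)" by (simp add: BT_def finite_strata)
  ultimately have "length p \<le> card (BT D)" by (metis card_inj_on_le card_lessThan)
  then show ?thesis using path_ends(1)[OF p] by (cases p) (auto simp: plength_def)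
qed

lemma paths_eq_UN: "paths D \<sigma> \<tau> = (\<Union>j<card (BT D). paths_of_length D j \<sigma> \<tau>)"
  using plength_less by (auto simp: paths_of_length_def)

lemma Phi_term_eq_0: "j \<ge> card (BT D) \<Longrightarrow> Phi_term D j = 0"
proof (intro ext)
  fix \<sigma> \<tau> x assume "j \<ge> card (BT D)"
  then have "paths_of_length D j \<sigma> \<tau> = {}" using plength_less by (fastforce simp: paths_of_length_def)
  then show "Phi_term D j \<sigma> \<tau> x = 0 \<sigma> \<tau> x" by (simp add: Phi_term_eq)
qed

lemma finite_Phi_terms: "finite {j. Phi_term D j \<noteq> 0}"
  by (rule finite_subset[of _ "{..<card (BT D)}"]) (use Phi_term_eq_0 not_less in auto)

lemma finite_paths: "finite (paths D \<sigma> \<tau>)"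
  unfolding paths_eq_UN using finite_paths_of_length by blast

lemma Phi_eq_Phi_path: "Phi D \<sigma> \<tau> = Phi_path D \<sigma> \<tau>"
proof -
  have "Phi D = (\<Sum>j<card (BT D). Phi_term D j)"
    unfolding Phi_def by (rule Sum_any.expand_superset) (use Phi_term_eq_0 not_less in auto)
  then have "Phi D \<sigma> \<tau> = (\<Sum>j<card (BT D). \<Sum>p\<in>paths_of_length D j \<sigma> \<tau>. (- 1) ^ j * weight D p)"
    by (simp add: sum_fun_at Phi_term_eq)
  also have "\<dots> = (\<Sum>j<card (BT D). \<Sum>p\<in>paths_of_length D j \<sigma> \<tau>. (- 1) ^ plength p * weight D p)"
    by (intro sum.cong refl) (simp add: paths_of_length_def)
  also have "\<dots> = Phi_path D \<sigma> \<tau>"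
    unfolding Phi_path_def paths_eq_UN
    by (rule sum.UNION_disjoint[symmetric]) (auto simp: finite_paths_of_length, auto simp: paths_of_length_def)
  finally show ?thesis .
qed

lemma weight_hom: "p \<in> paths D \<sigma> \<tau> \<Longrightarrow> weight D p \<in> hom_O D (O_exp D \<sigma>) (O_exp D \<tau>)"
proof (induction p arbitrary: \<sigma>)
  case Nil
  then show ?case by (simp add: paths_def)
next
  case (Cons aw p)
  obtain a w where aw: "aw = (a, w)" by (cases aw)
  show ?case
  proof (cases "p = []")
    case True
    then have "a = \<sigma>" "w = \<tau>" using Cons.prems by (auto simp: aw path_single_iff)
    then show ?thesis using True path_ends(3,4)[OF Cons.prems] by (simp add: aw weight_single HHL_hom)
  next
    case False
    let ?z = "fst (hd p)"
    have P: "a = \<sigma>" "type_I D \<sigma> w" "type_II D ?z w" "p \<in> paths D ?z \<tau>"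
      using Cons.prems unfolding aw path_Cons_iff[OF False] by blast+
    have "HHL D \<sigma> w * cst D (MP D ?z w) * weight D p \<in> hom_O D (O_exp D \<sigma>) (O_exp D \<tau>)"
      by (rule hom_O_mult[OF toric hom_O_mult[OF toric HHL_hom MP_hom[OF P(3)]] Cons.IH[OF P(4)]])
        (use P in \<open>auto simp: type_I_def\<close>)
    then show ?thesis by (simp only: aw weight_Cons[OF False] P(1))
  qed
qed

lemma Phi_path_hom: "Phi_path D \<sigma> \<tau> \<in> hom_O D (O_exp D \<sigma>) (O_exp D \<tau>)"
  unfolding Phi_path_def
proof (rule hom_O_sum[OF toric])
  fix p assume p: "p \<in> paths D \<sigma> \<tau>"
  show "(- 1) ^ plength p * weight D p \<in> hom_O D (O_exp D \<sigma>) (O_exp D \<tau>)"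
    using weight_hom[OF p] hom_O_uminus[OF toric weight_hom[OF p]] by (cases "even (plength p)") auto
qed

end

theorem theorem5p7:
  fixes D :: "('l::ab_group_add, 'm::ab_group_add, 'g) hhl_data"
  assumes "toric_setting D"
    and "HHL_choices D"
    and "BT_conventions D"
  shows "finite {j. Phi_term D j \<noteq> 0} \<and>
    (\<forall>\<sigma>\<in>strata D. \<forall>\<tau>\<in>strata D.
       finite (paths D \<sigma> \<tau>) \<and>
       Phi_path D \<sigma> \<tau> \<in> hom_O D (O_exp D \<sigma>) (O_exp D \<tau>) \<and>
       Phi D \<sigma> \<tau> = Phi_path D \<sigma> \<tau>)"
proof -
  interpret hhl D using assms by unfold_locales
  show ?thesis using finite_Phi_terms finite_paths Phi_path_hom Phi_eq_Phi_path by blast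
qed

end
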